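(* Let $P$ be a biobjective combinatorial optimization problem. Then the Dichotomic Approach without access to an algorithm to solve the lexicographic version of $P$ outputs the nondominated extreme points of $P$. Moreover, if the weighted-sum scalarization of $P$ is solvable in polynomial time, then this algorithm is output-sensitive.
   Context: A biobjective combinatorial optimization (BOCO) problem $P$ is a collection of instances $(\mathcal{S},C)$ with implicitly given solution set $\mathcal{S}\subseteq\{0,1\}^n$ and $C\in\mathbb{Q}^{2\times n}$; the input size is $n+\langle C\rangle$, where $\langle\cdot\rangle$ is binary encoding length. The Pareto-front is the set of minimal elements (nondominated points) of $\{Cx\mid x\in\mathcal{S}\}$ under the componentwise order $\le$. The nondominated extreme points of an instance, whose set is denoted $\mathcal{Y}_{\mathrm{X}}$, are the extreme points of the polyhedron $\{Cx\mid x\in\operatorname{conv}\mathcal{S}\}+\mathbb{R}^2_{\ge}$, where $\mathbb{R}^2_{\ge}$ is the set of vectors with nonnegative entries. For $\ell\in\mathbb{Q}^2$, $\ell\ge0$, the weighted-sum scalarization is $P^{\mathrm{WS}}(\ell):\ \min\{\ell^{T}Cx\mid x\in\mathcal{S}\}$. Below, "an optimal solution $y$ of $P^{\mathrm{WS}}(\ell)$" means the point $y=Cx$ for an optimal $x$. The lexicographic version of $P$ asks to solve $\operatorname{lexmin}\{(\ell^{T}Cx,c_1x,c_2x)\mid x\in\mathcal{S}\}$, where $c_1,c_2$ are the rows of $C$ and lexmin is the minimum in the lexicographic order; the algorithm below does not use it. The Dichotomic Approach (DA) without access to a lexicographic algorithm: 1. Compute optimal solutions $y^0$ and $y^1$ of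 $P^{\mathrm{WS}}((1,0))$ and $P^{\mathrm{WS}}((0,1))$, respectively. If $y^0=y^1$, terminate, since the ideal point (the vector of the two individual minima) is then a member of the Pareto-front; this point is the output. Otherwise add the pair $(y^0,y^1)$ to a queue $\mathcal{Q}$. Let $\mathcal{A}$ be the set collecting the points found, including $y^0$ and $y^1$. 2. While $\mathcal{Q}$ is nonempty: retrieve a pair $(y^2,y^3)$ from $\mathcal{Q}$, set $\lambda:=(|y^2_2-y^3_2|,\ |y^2_1-y^3_1|)$, so that $\lambda^{T}y^2=\lambda^{T}y^3$, and compute an optimal solution $\bar y$ of $P^{\mathrm{WS}}(\lambda)$. If $\bar y$ is located in the line segment spanned by $y^2$ and $y^3$, i.e., $\lambda^{T}y^2=\lambda^{T}\bar y=\lambda^{T}y^3$, neglect $\bar y$. Otherwise add $\bar y$ to $\mathcal{A}$ and add the pairs $(\bar y,y^2)$ and $(\bar y,y^3)$ to $\mathcal{Q}$. 3. When $\mathcal{Q}$ is empty, remove from $\mathcal{A}$ the nondominated non-extreme points (the nondominated points that are not nondominated extreme points), output the remaining points, and terminate. Output-sensitive means that the running time on a RAM (with memory cells of polynomially bounded bit length) is bounded by a polynomial in the input size and the size of the output $\mathcal{Y}_{\mathrm{X}}$.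
   Formalization: Step 3 of the algorithm is corrected: it removes from A all points that are not extreme points of conv A plus the nonnegative quadrant, hence also dominated points; removing only nondominated non-extreme points can leave a dominated point such as y^0 in the output. *)

theory Defs
  imports
    "HOL-Analysis.Analysis"
    "HOL-Computational_Algebra.Polynomial"
    "HOL-Library.Log_Nat"
    "Jordan_Normal_Form.Matrix"
begin

no_notation Finite_Cartesian_Product.vec_nth (infixl \<open>$\<close> 90)
hide_const (open) Finite_Cartesian_Product.vec
hide_type (open) Finite_Cartesian_Product.vec

section \<open>Biobjective combinatorial optimization\<close>

text \<open>Besides the solution set S and the cost matrix C, an instance carries the word
  \<open>code\<close> through which S is implicitly given to algorithms. It may be any list of integers;
  it does not count towards the input size.\<close>

record boco_inst =
  code :: "int list"
  dim :: nat
  sols :: "rat vec set"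
  costs :: "rat mat"

definition boco_instance :: "boco_inst \<Rightarrow> bool" where
  "boco_instance I \<longleftrightarrow>
     costs I \<in> carrier_mat 2 (dim I) \<and>
     sols I \<subseteq> {x \<in> carrier_vec (dim I). \<forall>i < dim I. x $ i \<in> {0, 1}}"

definition boco_problem :: "boco_inst set \<Rightarrow> bool" where
  "boco_problem P \<longleftrightarrow> (\<forall>I\<in>P. boco_instance I)"

text \<open>Encoding length: sign plus binary digits, and numerator plus denominator in lowest terms.\<close>

definition int_size :: "int \<Rightarrow> nat" where
  "int_size z = 1 + nat (bitlen \<bar>z\<bar>)"

definition rat_size :: "rat \<Rightarrow> nat" where
  "rat_size r = (case quotient_of r of (p, q) \<Rightarrow> int_size p + int_size q)"

definition inst_size :: "boco_inst \<Rightarrow> nat" where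
  "inst_size I = dim I + (\<Sum>i<2. \<Sum>j<dim I. rat_size (costs I $$ (i, j)))"

type_synonym point = "rat \<times> rat"

definition image_pt :: "boco_inst \<Rightarrow> rat vec \<Rightarrow> point" where
  "image_pt I x = ((costs I *\<^sub>v x) $ 0, (costs I *\<^sub>v x) $ 1)"

definition real_pt :: "point \<Rightarrow> real \<times> real" where
  "real_pt y = (of_rat (fst y), of_rat (snd y))"

definition dot :: "point \<Rightarrow> point \<Rightarrow> rat" where
  "dot l y = fst l * fst y + snd l * snd y"

subsection \<open>Nondominated extreme points\<close>

text \<open>The library's \<open>convex hull\<close> needs a vector-space type; real vectors of variable
  dimension do not form one, so the convex hull of a finite set is spelled out.\<close>

definition conv_vecs :: "nat \<Rightarrow> real vec set \<Rightarrow> real vec set" where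
  "conv_vecs n S = {vec n (\<lambda>i. \<Sum>s\<in>S. u s * s $ i) | u. (\<forall>s\<in>S. 0 \<le> u s) \<and> sum u S = 1}"

definition nonneg_quadrant :: "(real \<times> real) set" where
  "nonneg_quadrant = {r. 0 \<le> fst r \<and> 0 \<le> snd r}"

definition upper_image :: "boco_inst \<Rightarrow> (real \<times> real) set" where
  "upper_image I =
     {((map_mat of_rat (costs I) *\<^sub>v x) $ 0, (map_mat of_rat (costs I) *\<^sub>v x) $ 1) + r | x r.
        x \<in> conv_vecs (dim I) (map_vec of_rat ` sols I) \<and> r \<in> nonneg_quadrant}"

definition nd_extreme :: "boco_inst \<Rightarrow> (real \<times> real) set" where
  "nd_extreme I = {y. y extreme_point_of upper_image I}"

subsection \<open>Weighted-sum scalarization\<close>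

definition ws_optimal :: "boco_inst \<Rightarrow> point \<Rightarrow> rat vec \<Rightarrow> bool" where
  "ws_optimal I l x \<longleftrightarrow>
     x \<in> sols I \<and> (\<forall>x'\<in>sols I. dot l (image_pt I x) \<le> dot l (image_pt I x'))"

definition ws_optimal_pt :: "boco_inst \<Rightarrow> point \<Rightarrow> point \<Rightarrow> bool" where
  "ws_optimal_pt I l y \<longleftrightarrow> (\<exists>x. ws_optimal I l x \<and> y = image_pt I x)"


section \<open>The Dichotomic Approach without a lexicographic algorithm\<close>

definition weight :: "point \<Rightarrow> point \<Rightarrow> point" where
  "weight y2 y3 = (\<bar>snd y2 - snd y3\<bar>, \<bar>fst y2 - fst y3\<bar>)"

definition in_segment :: "point \<Rightarrow> point \<Rightarrow> point \<Rightarrow> bool" where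
  "in_segment y y2 y3 \<longleftrightarrow>
     dot (weight y2 y3) y2 = dot (weight y2 y3) y \<and> dot (weight y2 y3) y = dot (weight y2 y3) y3"

text \<open>The final clean-up only sees the set A of points found: it keeps the extreme points of
  conv A plus the nonnegative quadrant. This removes the nondominated non-extreme points, and
  also dominated points, which A may contain because the first two points need not be
  optimal for a lexicographic order.\<close>

definition clean_up :: "point set \<Rightarrow> point set" where
  "clean_up A =
     {y \<in> A. real_pt y extreme_point_of {z + r | z r. z \<in> convex hull (real_pt ` A) \<and> r \<in> nonneg_quadrant}}"

datatype da_state =
    Start
  | Loop "(point \<times> point) list" "point set"
  | Done "point set"

text \<open>Nondeterministic, since the optimal solutions returned are arbitrary. The first rule covers
  infeasible instances, where no optimal solution exists.\<close>

inductive da_step :: "boco_inst \<Rightarrow> da_state \<Rightarrow> da_state \<Rightarrow> bool" for I where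
  infeasible: "sols I = {} \<Longrightarrow> da_step I Start (Done {})"
| ideal: "\<lbrakk>ws_optimal_pt I (1, 0) y0; ws_optimal_pt I (0, 1) y1; y0 = y1\<rbrakk>
    \<Longrightarrow> da_step I Start (Done {y0})"
| init: "\<lbrakk>ws_optimal_pt I (1, 0) y0; ws_optimal_pt I (0, 1) y1; y0 \<noteq> y1\<rbrakk>
    \<Longrightarrow> da_step I Start (Loop [(y0, y1)] {y0, y1})"
| neglect: "\<lbrakk>ws_optimal_pt I (weight y2 y3) y; in_segment y y2 y3\<rbrakk>
    \<Longrightarrow> da_step I (Loop ((y2, y3) # Q) A) (Loop Q A)"
| split: "\<lbrakk>ws_optimal_pt I (weight y2 y3) y; \<not> in_segment y y2 y3\<rbrakk>
    \<Longrightarrow> da_step I (Loop ((y2, y3) # Q) A) (Loop (Q @ [(y, y2), (y, y3)]) (insert y A))"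
| finish: "da_step I (Loop [] A) (Done (clean_up A))"

definition da_terminates :: "boco_inst \<Rightarrow> bool" where
  "da_terminates I \<longleftrightarrow>
     (\<nexists>f :: nat \<Rightarrow> da_state. f 0 = Start \<and> (\<forall>i. da_step I (f i) (f (Suc i)))) \<and>
     (\<forall>s. (da_step I)\<^sup>*\<^sup>* Start s \<longrightarrow> (\<nexists>s'. da_step I s s') \<longrightarrow> (\<exists>Y. s = Done Y))"

definition da_output :: "boco_inst \<Rightarrow> point set \<Rightarrow> bool" where
  "da_output I Y \<longleftrightarrow> (da_step I)\<^sup>*\<^sup>* Start (Done Y)"


section \<open>Random access machines\<close>

text \<open>Unit-cost RAM programs with structured control flow. The memory of integer cells is organised
  as finitely many unbounded arrays (those named in the program text; on a flat memory they are
  interleaved); scalars are arrays used at index 0. The input is read-only, the output write-only.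
  \<open>Call c x k r\<close> runs the subroutine \<open>c\<close> in a fresh zero-initialised memory frame, on the
  input consisting of the first \<open>k\<close> cells of \<open>x\<close> followed by the caller's own input, and
  stores what it writes in \<open>r\<close>. With unboundedly many zero-initialised cells, a frame is just an
  unused part of memory.\<close>

type_synonym vname = string
type_synonym mem = "vname \<Rightarrow> nat \<Rightarrow> int"

datatype aexp =
    N int
  | Arr vname aexp
  | In aexp
  | InLen
  | Add aexp aexp
  | Sub aexp aexp
  | Mul aexp aexp
  | Div aexp aexp

datatype bexp = Eq aexp aexp | Less aexp aexp | Not bexp | And bexp bexp | Or bexp bexp

datatype com =
    SKIP
  | Assign vname aexp aexp
  | Write aexp
  | Seq com com  (infixr \<open>;;\<close> 60)
  | If bexp com com  (\<open>(IF _/ THEN _/ ELSE _)\<close> [0, 0, 61] 61)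
  | While bexp com  (\<open>(WHILE _/ DO _)\<close> [0, 61] 61)
  | Call com vname aexp vname

fun aval :: "int list \<Rightarrow> mem \<Rightarrow> aexp \<Rightarrow> int" where
  "aval inp m (N k) = k"
| "aval inp m (Arr x e) = m x (nat (aval inp m e))"
| "aval inp m (In e) = inp ! nat (aval inp m e)"
| "aval inp m InLen = int (length inp)"
| "aval inp m (Add e f) = aval inp m e + aval inp m f"
| "aval inp m (Sub e f) = aval inp m e - aval inp m f"
| "aval inp m (Mul e f) = aval inp m e * aval inp m f"
| "aval inp m (Div e f) = aval inp m e div aval inp m f"

text \<open>All addresses are valid and all intermediate values fit into w bits (plus sign).\<close>

fun asafe :: "nat \<Rightarrow> int list \<Rightarrow> mem \<Rightarrow> aexp \<Rightarrow> bool" where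
  "asafe w inp m (N k) \<longleftrightarrow> \<bar>k\<bar> < 2 ^ w"
| "asafe w inp m (Arr x e) \<longleftrightarrow>
     asafe w inp m e \<and> 0 \<le> aval inp m e \<and> \<bar>aval inp m (Arr x e)\<bar> < 2 ^ w"
| "asafe w inp m (In e) \<longleftrightarrow>
     asafe w inp m e \<and> 0 \<le> aval inp m e \<and> aval inp m e < int (length inp) \<and>
     \<bar>aval inp m (In e)\<bar> < 2 ^ w"
| "asafe w inp m InLen \<longleftrightarrow> \<bar>aval inp m InLen\<bar> < 2 ^ w"
| "asafe w inp m (Add e f) \<longleftrightarrow> asafe w inp m e \<and> asafe w inp m f \<and> \<bar>aval inp m (Add e f)\<bar> < 2 ^ w"
| "asafe w inp m (Sub e f) \<longleftrightarrow> asafe w inp m e \<and> asafe w inp m f \<and> \<bar>aval inp m (Sub e f)\<bar> < 2 ^ w"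
| "asafe w inp m (Mul e f) \<longleftrightarrow> asafe w inp m e \<and> asafe w inp m f \<and> \<bar>aval inp m (Mul e f)\<bar> < 2 ^ w"
| "asafe w inp m (Div e f) \<longleftrightarrow> asafe w inp m e \<and> asafe w inp m f \<and> \<bar>aval inp m (Div e f)\<bar> < 2 ^ w"

fun acost :: "aexp \<Rightarrow> nat" where
  "acost (N k) = 1"
| "acost (Arr x e) = 1 + acost e"
| "acost (In e) = 1 + acost e"
| "acost InLen = 1"
| "acost (Add e f) = 1 + acost e + acost f"
| "acost (Sub e f) = 1 + acost e + acost f"
| "acost (Mul e f) = 1 + acost e + acost f"
| "acost (Div e f) = 1 + acost e + acost f"

fun bval :: "int list \<Rightarrow> mem \<Rightarrow> bexp \<Rightarrow> bool" where
  "bval inp m (Eq e f) \<longleftrightarrow> aval inp m e = aval inp m f"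
| "bval inp m (Less e f) \<longleftrightarrow> aval inp m e < aval inp m f"
| "bval inp m (Not b) \<longleftrightarrow> \<not> bval inp m b"
| "bval inp m (And b c) \<longleftrightarrow> bval inp m b \<and> bval inp m c"
| "bval inp m (Or b c) \<longleftrightarrow> bval inp m b \<or> bval inp m c"

fun bsafe :: "nat \<Rightarrow> int list \<Rightarrow> mem \<Rightarrow> bexp \<Rightarrow> bool" where
  "bsafe w inp m (Eq e f) \<longleftrightarrow> asafe w inp m e \<and> asafe w inp m f"
| "bsafe w inp m (Less e f) \<longleftrightarrow> asafe w inp m e \<and> asafe w inp m f"
| "bsafe w inp m (Not b) \<longleftrightarrow> bsafe w inp m b"
| "bsafe w inp m (And b c) \<longleftrightarrow> bsafe w inp m b \<and> bsafe w inp m c"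
| "bsafe w inp m (Or b c) \<longleftrightarrow> bsafe w inp m b \<and> bsafe w inp m c"

fun bcost :: "bexp \<Rightarrow> nat" where
  "bcost (Eq e f) = 1 + acost e + acost f"
| "bcost (Less e f) = 1 + acost e + acost f"
| "bcost (Not b) = 1 + bcost b"
| "bcost (And b c) = 1 + bcost b + bcost c"
| "bcost (Or b c) = 1 + bcost b + bcost c"

text \<open>\<open>exec w inp c s t s'\<close>: with cells of w bits and input \<open>inp\<close>, the program \<open>c\<close> started in
  state \<open>s\<close> (memory and output so far) halts after t steps in state \<open>s'\<close>. A program that would
  exceed the cell size has no execution.\<close>

inductive exec :: "nat \<Rightarrow> int list \<Rightarrow> com \<Rightarrow> mem \<times> int list \<Rightarrow> nat \<Rightarrow> mem \<times> int list \<Rightarrow> bool"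
  for w where
  Skip: "exec w inp SKIP s 1 s"
| Assign: "\<lbrakk>asafe w inp m i; 0 \<le> aval inp m i; asafe w inp m e\<rbrakk> \<Longrightarrow>
    exec w inp (Assign x i e) (m, out) (1 + acost i + acost e)
      (m(x := (m x)(nat (aval inp m i) := aval inp m e)), out)"
| Write: "asafe w inp m e \<Longrightarrow>
    exec w inp (Write e) (m, out) (1 + acost e) (m, out @ [aval inp m e])"
| Seq: "\<lbrakk>exec w inp c s t s'; exec w inp d s' t' s''\<rbrakk> \<Longrightarrow> exec w inp (c ;; d) s (t + t') s''"
| IfTrue: "\<lbrakk>bsafe w inp (fst s) b; bval inp (fst s) b; exec w inp c s t s'\<rbrakk> \<Longrightarrow>
    exec w inp (IF b THEN c ELSE d) s (1 + bcost b + t) s'"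
| IfFalse: "\<lbrakk>bsafe w inp (fst s) b; \<not> bval inp (fst s) b; exec w inp d s t s'\<rbrakk> \<Longrightarrow>
    exec w inp (IF b THEN c ELSE d) s (1 + bcost b + t) s'"
| WhileFalse: "\<lbrakk>bsafe w inp (fst s) b; \<not> bval inp (fst s) b\<rbrakk> \<Longrightarrow>
    exec w inp (WHILE b DO c) s (1 + bcost b) s"
| WhileTrue: "\<lbrakk>bsafe w inp (fst s) b; bval inp (fst s) b; exec w inp c s t s';
      exec w inp (WHILE b DO c) s' t' s''\<rbrakk> \<Longrightarrow>
    exec w inp (WHILE b DO c) s (1 + bcost b + t + t') s''"
| Call: "\<lbrakk>asafe w inp m e; 0 \<le> aval inp m e; k = nat (aval inp m e);
      exec w (map (m x) [0..<k] @ inp) c (\<lambda>_ _. 0, []) t (m', res)\<rbrakk> \<Longrightarrow>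
    exec w inp (Call c x e r) (m, out) (1 + acost e + k + t + length res)
      (m(r := (\<lambda>i. if i < length res then res ! i else m r i)), out)"

definition runs :: "nat \<Rightarrow> int list \<Rightarrow> com \<Rightarrow> nat \<Rightarrow> int list \<Rightarrow> bool" where
  "runs w inp c t out \<longleftrightarrow> (\<exists>m. exec w inp c (\<lambda>_ _. 0, []) t (m, out))"

subsection \<open>Encodings, polynomial time, output-sensitivity\<close>

definition enc_rat :: "rat \<Rightarrow> int list" where
  "enc_rat r = (case quotient_of r of (p, q) \<Rightarrow> [p, q])"

definition enc_pt :: "point \<Rightarrow> int list" where
  "enc_pt y = enc_rat (fst y) @ enc_rat (snd y)"

definition enc_inst :: "boco_inst \<Rightarrow> int list" where
  "enc_inst I =
     int (dim I)
     # concat (map (\<lambda>j. enc_rat (costs I $$ (0, j))) [0..<dim I])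
     @ concat (map (\<lambda>j. enc_rat (costs I $$ (1, j))) [0..<dim I])
     @ code I"

text \<open>A solver of the weighted-sum scalarization writes 0 if the instance is infeasible, and
  otherwise 1 followed by the entries of an optimal solution.\<close>

definition ws_answer :: "boco_inst \<Rightarrow> point \<Rightarrow> int list \<Rightarrow> bool" where
  "ws_answer I l out \<longleftrightarrow>
     (if sols I = {} then out = [0]
      else \<exists>x. ws_optimal I l x \<and> out = 1 # map (\<lambda>i. \<lfloor>x $ i\<rfloor>) [0..<dim I])"

text \<open>Polynomial bounds have natural coefficients, so that they are monotone.\<close>

definition ws_poly_time_solver :: "boco_inst set \<Rightarrow> com \<Rightarrow> bool" where
  "ws_poly_time_solver P c \<longleftrightarrow>
     (\<exists>p q :: nat poly. \<forall>I\<in>P. \<forall>l. 0 \<le> fst l \<longrightarrow> 0 \<le> snd l \<longrightarrow>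
        (let N = inst_size I + rat_size (fst l) + rat_size (snd l) in
         \<exists>t out. runs (poly q N) (enc_pt l @ enc_inst I) c t out \<and> t \<le> poly p N \<and>
           ws_answer I l out))"

definition output_sensitive :: "boco_inst set \<Rightarrow> com \<Rightarrow> bool" where
  "output_sensitive P c \<longleftrightarrow>
     (\<exists>p q :: nat poly. \<forall>I\<in>P. \<exists>t ys.
        runs (poly q (inst_size I)) (enc_inst I) c t (concat (map enc_pt ys)) \<and>
        distinct ys \<and> real_pt ` set ys = nd_extreme I \<and>
        t \<le> poly p (inst_size I + card (nd_extreme I)))"


section \<open>The Dichotomic Approach as a RAM program\<close>

abbreviation V :: "vname \<Rightarrow> aexp" where "V x \<equiv> Arr x (N 0)"

abbreviation set_var :: "vname \<Rightarrow> aexp \<Rightarrow> com" (infix \<open>::=\<close> 62) where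
  "x ::= e \<equiv> Assign x (N 0) e"

text \<open>Fractions are pairs of expressions for a numerator and a positive denominator.\<close>

type_synonym fexp = "aexp \<times> aexp"

definition fadd :: "fexp \<Rightarrow> fexp \<Rightarrow> fexp" where
  "fadd x y = (Add (Mul (fst x) (snd y)) (Mul (fst y) (snd x)), Mul (snd x) (snd y))"

definition fsub :: "fexp \<Rightarrow> fexp \<Rightarrow> fexp" where
  "fsub x y = (Sub (Mul (fst x) (snd y)) (Mul (fst y) (snd x)), Mul (snd x) (snd y))"

definition fmul :: "fexp \<Rightarrow> fexp \<Rightarrow> fexp" where
  "fmul x y = (Mul (fst x) (fst y), Mul (snd x) (snd y))"

definition feq :: "fexp \<Rightarrow> fexp \<Rightarrow> bexp" where
  "feq x y = Eq (Mul (fst x) (snd y)) (Mul (fst y) (snd x))"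

definition flt :: "fexp \<Rightarrow> fexp \<Rightarrow> bexp" where
  "flt x y = Less (Mul (fst x) (snd y)) (Mul (fst y) (snd x))"

definition fle :: "fexp \<Rightarrow> fexp \<Rightarrow> bexp" where
  "fle x y = Not (flt y x)"

abbreviation cur :: fexp where "cur \<equiv> (V ''p'', V ''q'')"

definition set_cur :: "fexp \<Rightarrow> com" where
  "set_cur x = (''r'' ::= fst x ;; ''q'' ::= snd x ;; ''p'' ::= V ''r'')"

text \<open>Brings \<open>cur\<close> to lowest terms by the Euclidean algorithm.\<close>

definition reduce_cur :: com where
  "reduce_cur = (
     ''g'' ::= V ''p'' ;;
     IF Less (V ''g'') (N 0) THEN ''g'' ::= Sub (N 0) (V ''g'') ELSE SKIP ;;
     ''h'' ::= V ''q'' ;;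
     WHILE Not (Eq (V ''h'') (N 0)) DO (
       ''r'' ::= Sub (V ''g'') (Mul (Div (V ''g'') (V ''h'')) (V ''h'')) ;;
       ''g'' ::= V ''h'' ;;
       ''h'' ::= V ''r'') ;;
     ''p'' ::= Div (V ''p'') (V ''g'') ;;
     ''q'' ::= Div (V ''q'') (V ''g''))"

text \<open>Stores \<open>cur\<close> in lowest terms as the i-th component of the vector in array \<open>x\<close>.\<close>

definition store_cur :: "vname \<Rightarrow> nat \<Rightarrow> com" where
  "store_cur x i = (
     reduce_cur ;;
     Assign x (N (2 * int i)) (V ''p'') ;;
     Assign x (N (2 * int i + 1)) (V ''q''))"

definition comp :: "vname \<Rightarrow> nat \<Rightarrow> fexp" where
  "comp x i = (Arr x (N (2 * int i)), Arr x (N (2 * int i + 1)))"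

text \<open>Array A holds the points found, four cells each, \<open>m\<close> is their number;
  \<open>coord k i\<close> is component i of the k-th point.\<close>

definition coord :: "aexp \<Rightarrow> nat \<Rightarrow> fexp" where
  "coord k i = (Arr ''A'' (Add (Mul (N 4) k) (N (2 * int i))),
                Arr ''A'' (Add (Mul (N 4) k) (N (2 * int i + 1))))"

definition add_point :: com where
  "add_point = (
     Assign ''A'' (Mul (N 4) (V ''m'')) (Arr ''y'' (N 0)) ;;
     Assign ''A'' (Add (Mul (N 4) (V ''m'')) (N 1)) (Arr ''y'' (N 1)) ;;
     Assign ''A'' (Add (Mul (N 4) (V ''m'')) (N 2)) (Arr ''y'' (N 2)) ;;
     Assign ''A'' (Add (Mul (N 4) (V ''m'')) (N 3)) (Arr ''y'' (N 3)) ;;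
     ''m'' ::= Add (V ''m'') (N 1))"

definition write_point :: "aexp \<Rightarrow> com" where
  "write_point k = (
     Write (fst (coord k 0)) ;; Write (snd (coord k 0)) ;;
     Write (fst (coord k 1)) ;; Write (snd (coord k 1)))"

text \<open>\<open>cost_entry i\<close> is entry (i, j) of C, read from the input according to \<open>enc_inst\<close>.\<close>

definition cost_entry :: "nat \<Rightarrow> fexp" where
  "cost_entry i =
     (let a = Mul (N 2) (Add (Mul (N (int i)) (In (N 0))) (V ''j''))
      in (In (Add a (N 1)), In (Add a (N 2))))"

text \<open>y := C x, for the answer \<open>1 # x\<close> of the solver in array \<open>x\<close>.\<close>

definition compute_image :: "nat \<Rightarrow> com" where
  "compute_image i = (
     set_cur (N 0, N 1) ;;
     ''j'' ::= N 0 ;;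
     WHILE Less (V ''j'') (In (N 0)) DO (
       set_cur (fadd cur (fmul (cost_entry i) (Arr ''x'' (Add (V ''j'') (N 1)), N 1))) ;;
       ''j'' ::= Add (V ''j'') (N 1)) ;;
     store_cur ''y'' i)"

text \<open>y := the point of an optimal solution for the weights in \<open>lam\<close>, if feasible.\<close>

definition solve :: "com \<Rightarrow> com" where
  "solve ws = (
     Call ws ''lam'' (N 4) ''x'' ;;
     IF Eq (V ''x'') (N 0) THEN SKIP ELSE (compute_image 0 ;; compute_image 1))"

definition set_lam :: "int \<Rightarrow> int \<Rightarrow> com" where
  "set_lam l1 l2 = (
     Assign ''lam'' (N 0) (N l1) ;; Assign ''lam'' (N 1) (N 1) ;;
     Assign ''lam'' (N 2) (N l2) ;; Assign ''lam'' (N 3) (N 1))"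

definition store_abs_diff :: "nat \<Rightarrow> nat \<Rightarrow> com" where
  "store_abs_diff i j = (
     set_cur (fsub (coord (V ''a'') j) (coord (V ''b'') j)) ;;
     IF Less (V ''p'') (N 0) THEN ''p'' ::= Sub (N 0) (V ''p'') ELSE SKIP ;;
     store_cur ''lam'' i)"

text \<open>The queue Q holds pairs of indices into A, two cells each, from \<open>qh\<close> up to \<open>qt\<close>.\<close>

definition enqueue :: "aexp \<Rightarrow> aexp \<Rightarrow> com" where
  "enqueue k l = (
     Assign ''Q'' (Mul (N 2) (V ''qt'')) k ;;
     Assign ''Q'' (Add (Mul (N 2) (V ''qt'')) (N 1)) l ;;
     ''qt'' ::= Add (V ''qt'') (N 1))"

definition dequeue :: com where
  "dequeue = (
     ''a'' ::= Arr ''Q'' (Mul (N 2) (V ''qh'')) ;;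
     ''b'' ::= Arr ''Q'' (Add (Mul (N 2) (V ''qh'')) (N 1)) ;;
     ''qh'' ::= Add (V ''qh'') (N 1))"

definition weighted :: "(nat \<Rightarrow> fexp) \<Rightarrow> fexp" where
  "weighted y = fadd (fmul (comp ''lam'' 0) (y 0)) (fmul (comp ''lam'' 1) (y 1))"

definition iteration :: "com \<Rightarrow> com" where
  "iteration ws = (
     dequeue ;;
     store_abs_diff 0 1 ;;
     store_abs_diff 1 0 ;;
     solve ws ;;
     IF And (feq (weighted (coord (V ''a''))) (weighted (comp ''y'')))
            (feq (weighted (comp ''y'')) (weighted (coord (V ''b''))))
     THEN SKIP
     ELSE (
       enqueue (V ''m'') (V ''a'') ;;
       enqueue (V ''m'') (V ''b'') ;;
       add_point))"

text \<open>The point k is not an extreme point of conv A plus the quadrant iff, for some points a and b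
  of A different from it, it lies in the segment from a to b plus the quadrant: it is dominated by
  a, or its first component is between those of a and b and it is on or above the segment.\<close>

definition redundant :: bexp where
  "redundant =
     (let k = coord (V ''k''); a = coord (V ''a''); b = coord (V ''b'') in
      And (And (Not (Eq (V ''a'') (V ''k''))) (Not (Eq (V ''b'') (V ''k''))))
       (Or (And (fle (a 0) (k 0)) (fle (a 1) (k 1)))
           (And (And (flt (a 0) (b 0)) (And (fle (a 0) (k 0)) (fle (k 0) (b 0))))
                (fle (fmul (fsub (b 1) (a 1)) (fsub (k 0) (a 0)))
                     (fmul (fsub (b 0) (a 0)) (fsub (k 1) (a 1)))))))"

definition output_cleaned :: com where
  "output_cleaned = (
     ''k'' ::= N 0 ;;
     WHILE Less (V ''k'') (V ''m'') DO (
       ''keep'' ::= N 1 ;;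
       ''a'' ::= N 0 ;;
       WHILE Less (V ''a'') (V ''m'') DO (
         ''b'' ::= N 0 ;;
         WHILE Less (V ''b'') (V ''m'') DO (
           IF redundant THEN ''keep'' ::= N 0 ELSE SKIP ;;
           ''b'' ::= Add (V ''b'') (N 1)) ;;
         ''a'' ::= Add (V ''a'') (N 1)) ;;
       IF Eq (V ''keep'') (N 1) THEN write_point (V ''k'') ELSE SKIP ;;
       ''k'' ::= Add (V ''k'') (N 1)))"

text \<open>The parameter \<open>ws\<close> is the subroutine solving the weighted-sum scalarization.\<close>

definition da_program :: "com \<Rightarrow> com" where
  "da_program ws = (
     set_lam 1 0 ;;
     solve ws ;;
     IF Eq (V ''x'') (N 0) THEN SKIP
     ELSE (
       add_point ;;
       set_lam 0 1 ;;
       solve ws ;;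
       add_point ;;
       IF And (feq (coord (N 0) 0) (coord (N 1) 0)) (feq (coord (N 0) 1) (coord (N 1) 1))
       THEN write_point (N 0)
       ELSE (
         enqueue (N 0) (N 1) ;;
         WHILE Less (V ''qh'') (V ''qt'') DO iteration ws ;;
         output_cleaned)))"

end

(* Adding the nonnegative quadrant to the convex hull of the image, a point of a finite set is
   extreme unless two other points cover it, i.e. it lies in their segment plus the quadrant.
   Every point found by the algorithm minimizes some nonzero nonnegative weight, so a point that
   splits a pair lies in the box spanned by the pair and every uncovered point of the box stays
   in one of the two smaller boxes; a neglected box contains no uncovered point besides its
   corners. Hence all extreme points are found, and the clean-up leaves exactly these.

   For the running time, let N be the number of extreme points of the box of a pair that lie
   strictly below its line. A split keeps disjoint subsets of these points for the two new
   pairs, and some point is lost unless both subsets are nonempty: the minimizer itself is lost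
   if it is extreme, and otherwise the end points of its edge go to different sides. So 2N - 1
   bounds the number of splits of a pair, also when minimizers are not extreme.

   All numbers stay polynomially long because every point is reduced to lowest terms, and the
   number of points found is at most linear in the number of extreme points, which is at
   most 2 to the power of the dimension. *)

theory Submission
  imports Defs
begin

text \<open>The obstacle is that the solver may return dominated or non-extreme minimizers, so no
  invariant can call the points found nondominated. Instead, each is optimal for some nonzero
  weight, possibly with a zero entry; this alone confines every point below the line of a pair to
  the box of the pair. The points found form a chain from upper left to lower right, queued pairs
  are neighbours in it, and a new point therefore lies in only one queued box.

  Coverage by two points is a Caratheodory-type statement for a planar hull plus the quadrant.
  Written without division it means the same over the rationals and the reals, so it links real
  extreme points, the clean-up and the integer test of the program.

  In 2N - 1, at most N - 1 splits leave points on both sides, and at most N others lose a point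
  each. A pair with s splits below it causes 2s + 1 dequeuings, hence 1 + 2(2N - 1). For bit
  lengths, |p| + q is the measure of p/q that is submultiplicative under addition of
  fractions.\<close>

section \<open>Uncovered points of a finite set in the plane\<close>

text \<open>The clause for domination mentions only \<open>a\<close>, since \<open>a\<close> and
  \<open>b\<close> will range over all ordered pairs; \<open>a = b\<close> is allowed. The segment
  clause is cross-multiplied, and \<open>fst a < fst b\<close> keeps the factor positive.\<close>

definition covered :: "'a::linordered_field \<times> 'a \<Rightarrow> 'a \<times> 'a \<Rightarrow> 'a \<times> 'a \<Rightarrow> bool" where
  "covered a b y \<longleftrightarrow> (fst a \<le> fst y \<and> snd a \<le> snd y) \<or>
     (fst a < fst b \<and> fst a \<le> fst y \<and> fst y \<le> fst b \<and>
      (snd b - snd a) * (fst y - fst a) \<le> (fst b - fst a) * (snd y - snd a))"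

definition uncovered :: "('a::linordered_field \<times> 'a) set \<Rightarrow> ('a \<times> 'a) set" where
  "uncovered S = {y \<in> S. \<forall>a\<in>S - {y}. \<forall>b\<in>S - {y}. \<not> covered a b y}"

section \<open>Extreme points of a convex hull plus the quadrant\<close>

definition upper_hull :: "(real \<times> real) set \<Rightarrow> (real \<times> real) set" where
  "upper_hull S = {z + r | z r. z \<in> convex hull S \<and> r \<in> nonneg_quadrant}"

lemma mem_upper_hull: "y \<in> upper_hull S \<longleftrightarrow> (\<exists>z\<in>convex hull S. fst z \<le> fst y \<and> snd z \<le> snd y)"
proof
  assume "\<exists>z\<in>convex hull S. fst z \<le> fst y \<and> snd z \<le> snd y"
  then obtain z where z: "z \<in> convex hull S" "fst z \<le> fst y" "snd z \<le> snd y" by blast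
  have "y = z + (y - z)" by simp
  moreover have "y - z \<in> nonneg_quadrant" using z by (simp add: nonneg_quadrant_def)
  ultimately show "y \<in> upper_hull S" unfolding upper_hull_def using z by blast
next
  assume "y \<in> upper_hull S"
  then obtain z r where "y = z + r" "z \<in> convex hull S" "r \<in> nonneg_quadrant"
    unfolding upper_hull_def mem_Collect_eq by (elim exE conjE)
  then show "\<exists>z\<in>convex hull S. fst z \<le> fst y \<and> snd z \<le> snd y"
    by (intro bexI[of _ z]) (auto simp: nonneg_quadrant_def)
qed

lemma hull_subset_upper_hull: "convex hull S \<subseteq> upper_hull S"
  unfolding mem_upper_hull subset_iff by blast

lemma upper_hull_upward: "z \<in> upper_hull S \<Longrightarrow> fst z \<le> fst y \<Longrightarrow> snd z \<le> snd y \<Longrightarrow> y \<in> upper_hull S"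
  unfolding mem_upper_hull by (meson order_trans)

lemma convex_upper_hull: "convex (upper_hull S)"
proof -
  have "upper_hull S = (\<Union>z\<in>convex hull S. \<Union>r\<in>nonneg_quadrant. {z + r})"
  proof (rule Set.set_eqI)
    fix y show "y \<in> upper_hull S \<longleftrightarrow> y \<in> (\<Union>z\<in>convex hull S. \<Union>r\<in>nonneg_quadrant. {z + r})"
      unfolding upper_hull_def mem_Collect_eq UN_iff singleton_iff Bex_def by metis
  qed
  moreover have "convex nonneg_quadrant"
    by (auto simp: nonneg_quadrant_def convex_def)
  ultimately show ?thesis
    using convex_sums[OF convex_convex_hull, of nonneg_quadrant S] by simp
qed

lemma upper_hull_mono: "S \<subseteq> T \<Longrightarrow> upper_hull S \<subseteq> upper_hull T"
proof
  fix y assume "S \<subseteq> T" "y \<in> upper_hull S"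
  then show "y \<in> upper_hull T" using hull_mono[of S T convex] unfolding mem_upper_hull by (meson subsetD)
qed

text \<open>An upper hull is convex and upward closed, so forming it is a closure operation and
  generators can be exchanged.\<close>

lemma upper_hull_absorb: "S \<subseteq> upper_hull T \<Longrightarrow> upper_hull S \<subseteq> upper_hull T"
proof
  fix y assume S: "S \<subseteq> upper_hull T" and "y \<in> upper_hull S"
  then obtain z where z: "z \<in> convex hull S" "fst z \<le> fst y" "snd z \<le> snd y"
    by (auto simp: mem_upper_hull)
  have "convex hull S \<subseteq> upper_hull T" using S convex_upper_hull by (rule hull_minimal)
  with z show "y \<in> upper_hull T" using upper_hull_upward by blast
qed

text \<open>Reflect a smaller \<open>z\<close> through \<open>y\<close>: the image lies above
  \<open>y\<close>, so it is in the set as well, and \<open>y\<close> would be a proper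
  midpoint.\<close>

lemma extreme_upper_hull_minimal:
  assumes y: "y extreme_point_of upper_hull S" and z: "z \<in> upper_hull S" "fst z \<le> fst y" "snd z \<le> snd y"
  shows "z = y"
proof (rule ccontr)
  assume "z \<noteq> y"
  define z' where "z' = y + (y - z)"
  have "y \<in> upper_hull S" using y unfolding extreme_point_of_def by blast
  then have "z' \<in> upper_hull S" by (rule upper_hull_upward) (use z in \<open>auto simp: z'_def\<close>)
  moreover have mid: "y = midpoint z z'"
  proof -
    have "z + z' = 2 *\<^sub>R y" by (simp add: z'_def scaleR_2)
    then show ?thesis by (simp add: midpoint_def)
  qed
  moreover have "z \<noteq> z'" using \<open>z \<noteq> y\<close> mid by auto
  ultimately have "y \<in> open_segment z z'" by simp
  with y z(1) \<open>z' \<in> upper_hull S\<close> show False unfolding extreme_point_of_def by blast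
qed

text \<open>Forward: by minimality, an extreme point in the upper hull of \<open>T\<close> already
  lies in the convex hull of \<open>T\<close>, whose extreme points belong to \<open>T\<close>.
  Backward: remove the share of \<open>y\<close> from both ends of a segment through
  \<open>y\<close>; what remains puts \<open>y\<close> above a point of the hull of the
  others.\<close>

lemma extreme_upper_hull_iff:
  assumes "finite S"
  shows "y extreme_point_of upper_hull S \<longleftrightarrow> y \<in> S \<and> y \<notin> upper_hull (S - {y})"
proof
  assume y: "y extreme_point_of upper_hull S"
  have hull: "y \<in> convex hull T" if T: "T \<subseteq> S" "y \<in> upper_hull T" for T
  proof -
    obtain z where z: "z \<in> convex hull T" "fst z \<le> fst y" "snd z \<le> snd y"
      using T by (auto simp: mem_upper_hull)
    moreover have "z \<in> upper_hull S" using z(1) hull_mono[OF T(1)] hull_subset_upper_hull by blast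
    ultimately show ?thesis using extreme_upper_hull_minimal[OF y, of z] by simp
  qed
  have ext: "y \<in> T" if T: "T \<subseteq> S" "y \<in> upper_hull T" for T
  proof -
    have "y extreme_point_of convex hull T"
      using y hull[OF T] hull_mono[OF T(1), of convex] hull_subset_upper_hull[of S]
      unfolding extreme_point_of_def by blast
    then show ?thesis by (rule extreme_point_of_convex_hull)
  qed
  show "y \<in> S \<and> y \<notin> upper_hull (S - {y})"
    using ext[of S] ext[of "S - {y}"] y unfolding extreme_point_of_def by blast
next
  assume y: "y \<in> S \<and> y \<notin> upper_hull (S - {y})"
  have yS: "y \<in> upper_hull S" using y hull_subset_upper_hull[of S] hull_inc[of y S convex] by blast
  \<comment> \<open>\<open>v\<close> is the share of \<open>y\<close> in a hull point below
    \<open>u\<close>; \<open>p = y\<close> is a placeholder exactly when no share of the other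
    points remains.\<close>
  have decomp: "\<exists>v p. 0 \<le> v \<and> v \<le> 1 \<and> p \<in> upper_hull (S - {y}) \<union> {y} \<and> (v = 1 \<longleftrightarrow> p = y) \<and>
      fst (v *\<^sub>R y + (1 - v) *\<^sub>R p) \<le> fst u \<and> snd (v *\<^sub>R y + (1 - v) *\<^sub>R p) \<le> snd u"
    if u: "u \<in> upper_hull S" for u
  proof -
    obtain z where z: "z \<in> convex hull S" "fst z \<le> fst u" "snd z \<le> snd u"
      using u by (auto simp: mem_upper_hull)
    show ?thesis
    proof (cases "S - {y} = {}")
      case True
      then have "S = {y}" using y by blast
      with z show ?thesis by (intro exI[of _ 1] exI[of _ y]) auto
    next
      case False
      have "z \<in> convex hull (insert y (S - {y}))" using z y by (simp add: insert_absorb)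
      then obtain v v' b where vb: "0 \<le> v" "0 \<le> v'" "v + v' = 1"
          "b \<in> convex hull (S - {y})" "z = v *\<^sub>R y + v' *\<^sub>R b"
        unfolding convex_hull_insert[OF False] by blast
      have v': "v' = 1 - v" using vb by simp
      have "b \<in> upper_hull (S - {y})" using vb hull_subset_upper_hull[of "S - {y}"] by blast
      show ?thesis
      proof (cases "v = 1")
        case True
        then show ?thesis using vb z v' by (intro exI[of _ 1] exI[of _ y]) auto
      next
        case False
        have "b \<noteq> y" using \<open>b \<in> upper_hull (S - {y})\<close> y by blast
        then show ?thesis using False vb z v' \<open>b \<in> upper_hull (S - {y})\<close>
          by (intro exI[of _ v] exI[of _ b]) auto
      qed
    qed
  qed
  have "\<not> y \<in> open_segment u w" if uw: "u \<in> upper_hull S" "w \<in> upper_hull S" for u w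
  proof
    assume "y \<in> open_segment u w"
    then obtain s where s: "0 < s" "s < 1" "u \<noteq> w" and ys: "y = (1 - s) *\<^sub>R u + s *\<^sub>R w"
      by (auto simp: in_segment)
    obtain v p where v: "0 \<le> v" "v \<le> 1" "p \<in> upper_hull (S - {y}) \<union> {y}" "v = 1 \<longleftrightarrow> p = y"
      and vu: "fst (v *\<^sub>R y + (1 - v) *\<^sub>R p) \<le> fst u" "snd (v *\<^sub>R y + (1 - v) *\<^sub>R p) \<le> snd u"
      using decomp[OF uw(1)] by blast
    obtain v' p' where v': "0 \<le> v'" "v' \<le> 1" "p' \<in> upper_hull (S - {y}) \<union> {y}" "v' = 1 \<longleftrightarrow> p' = y"
      and vw: "fst (v' *\<^sub>R y + (1 - v') *\<^sub>R p') \<le> fst w" "snd (v' *\<^sub>R y + (1 - v') *\<^sub>R p') \<le> snd w"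
      using decomp[OF uw(2)] by blast
    \<comment> \<open>Shares of the other points in the two ends, weighted as the ends are in
      \<open>y\<close>. If both vanish, \<open>u\<close> and \<open>w\<close> lie above their own
      average \<open>y\<close>, hence both equal it.\<close>
    define c where "c = (1 - s) * (1 - v)"
    define c' where "c' = s * (1 - v')"
    have c: "0 \<le> c" "0 \<le> c'" "c = 0 \<longleftrightarrow> p = y" "c' = 0 \<longleftrightarrow> p' = y"
      using s v v' by (auto simp: c_def c'_def)
    have lin: "f (r *\<^sub>R x + r' *\<^sub>R x') = r * f x + r' * f x'"
      if "f = fst \<or> f = snd" for f :: "real \<times> real \<Rightarrow> real" and r r' x x'
      using that by auto
    have fy: "f y = (1 - s) * f u + s * f w"
      if "f = fst \<or> f = snd" for f :: "real \<times> real \<Rightarrow> real"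
      using lin[OF that] ys by metis
    have le: "c * f p + c' * f p' \<le> (c + c') * f y"
      if f: "f = fst \<or> f = snd" for f :: "real \<times> real \<Rightarrow> real"
    proof -
      have "(1 - s) * (v * f y + (1 - v) * f p) \<le> (1 - s) * f u"
        using vu s f by (intro mult_left_mono) auto
      moreover have "s * (v' * f y + (1 - v') * f p') \<le> s * f w"
        using vw s f by (intro mult_left_mono) auto
      moreover note fy[OF f]
      ultimately have "(1 - s) * (v * f y + (1 - v) * f p) + s * (v' * f y + (1 - v') * f p') \<le> f y"
        by linarith
      then show ?thesis by (simp add: c_def c'_def algebra_simps)
    qed
    show False
    proof (cases "c + c' = 0")
      case True
      then have "p = y" "p' = y" "v = 1" "v' = 1" using c v v' by auto
      then have "fst y \<le> fst u" "snd y \<le> snd u" "fst y \<le> fst w" "snd y \<le> snd w"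
        using vu vw by auto
      then have "f u = f y \<and> f w = f y" if f: "f = fst \<or> f = snd" for f :: "real \<times> real \<Rightarrow> real"
      proof -
        have "(1 - s) * (f u - f y) + s * (f w - f y) = 0" using fy[OF f] by (simp add: algebra_simps)
        moreover have "0 \<le> (1 - s) * (f u - f y)" "0 \<le> s * (f w - f y)"
          using s f \<open>fst y \<le> fst u\<close> \<open>snd y \<le> snd u\<close> \<open>fst y \<le> fst w\<close> \<open>snd y \<le> snd w\<close> by auto
        ultimately have "(1 - s) * (f u - f y) = 0" "s * (f w - f y) = 0" by linarith+
        then show ?thesis using s by simp
      qed
      from this[of fst] this[of snd] have "u = w" by (simp add: prod_eq_iff)
      with s show False by simp
    next
      case False
      define q where "q = (c / (c + c')) *\<^sub>R p + (c' / (c + c')) *\<^sub>R p'"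
      have pos: "0 < c + c'" using c False by linarith
      have "q \<in> upper_hull (S - {y})"
      proof (cases "c = 0 \<or> c' = 0")
        case True
        then show ?thesis using c v v' False by (auto simp: q_def)
      next
        case False
        then have "p \<in> upper_hull (S - {y})" "p' \<in> upper_hull (S - {y})" using c v v' by auto
        then show ?thesis unfolding q_def using c pos
          by (intro convexD[OF convex_upper_hull]) (auto simp: add_divide_distrib[symmetric])
      qed
      moreover have "f q \<le> f y" if f: "f = fst \<or> f = snd" for f :: "real \<times> real \<Rightarrow> real"
      proof -
        have "f q = (c * f p + c' * f p') / (c + c')"
          using f by (auto simp: q_def add_divide_distrib)
        also have "\<dots> \<le> f y" using le[OF f] pos by (simp add: field_simps)
        finally show ?thesis .
      qed
      ultimately have "y \<in> upper_hull (S - {y})" using upper_hull_upward by blast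
      with y show False by blast
    qed
  qed
  with yS show "y extreme_point_of upper_hull S" unfolding extreme_point_of_def by blast
qed

lemma covered_in_upper_hull:
  assumes "a \<in> T" "b \<in> T" "covered a b y"
  shows "y \<in> upper_hull T"
  using assms(3) unfolding covered_def
proof (elim disjE conjE)
  assume "fst a \<le> fst y" "snd a \<le> snd y"
  moreover have "a \<in> upper_hull T" using assms hull_subset_upper_hull[of T] hull_inc[of a T convex] by blast
  ultimately show ?thesis using upper_hull_upward by blast
next
  assume *: "fst a < fst b" "fst a \<le> fst y" "fst y \<le> fst b"
    "(snd b - snd a) * (fst y - fst a) \<le> (fst b - fst a) * (snd y - snd a)"
  define s where "s = (fst y - fst a) / (fst b - fst a)"
  have s: "0 \<le> s" "s \<le> 1" using * by (auto simp: s_def field_simps)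
  have "(1 - s) *\<^sub>R a + s *\<^sub>R b \<in> convex hull T"
    using s assms by (intro convexD[OF convex_convex_hull]) (auto intro: hull_inc)
  moreover have "fst ((1 - s) *\<^sub>R a + s *\<^sub>R b) = fst y"
  proof -
    have "s * (fst b - fst a) = fst y - fst a" using * by (simp add: s_def)
    then show ?thesis by (simp add: algebra_simps)
  qed
  moreover have "snd ((1 - s) *\<^sub>R a + s *\<^sub>R b) \<le> snd y"
  proof -
    have "s * (snd b - snd a) \<le> snd y - snd a" using * by (simp add: s_def field_simps)
    then show ?thesis by (simp add: algebra_simps)
  qed
  ultimately show ?thesis unfolding mem_upper_hull by (metis order_refl)
qed

text \<open>Suppose no pair covers \<open>y\<close>. Among the points not to the right of
  \<open>y\<close>, which then lie strictly above it, take \<open>a\<close> with the flattest line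
  to \<open>y\<close>. The functional \<open>f\<close> vanishing on that line is nonnegative on the
  left and positive on the right, while its average at a hull point below \<open>y\<close> is at
  most 0. So all weight sits on the left, where every point is too high.\<close>

lemma in_upper_hull_covered:
  assumes fin: "finite T" and y: "y \<in> upper_hull T"
  shows "\<exists>a\<in>T. \<exists>b\<in>T. covered a b y"
proof (rule ccontr)
  assume no: "\<not> ?thesis"
  obtain p where p: "p \<in> convex hull T" "fst p \<le> fst y" "snd p \<le> snd y"
    using y by (auto simp: mem_upper_hull)
  obtain u where u: "\<And>t. t \<in> T \<Longrightarrow> 0 \<le> u t" "sum u T = 1" and pu: "p = (\<Sum>t\<in>T. u t *\<^sub>R t)"
    using p(1) unfolding convex_hull_finite[OF fin] by auto
  have "fst p = (\<Sum>t\<in>T. u t * fst t)" "snd p = (\<Sum>t\<in>T. u t * snd t)"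
    unfolding pu by (simp_all add: fst_sum snd_sum)
  moreover have "(\<Sum>t\<in>T. u t * (f t - c)) = (\<Sum>t\<in>T. u t * f t) - c" for f c
    using u(2) by (simp add: right_diff_distrib sum_subtractf sum_distrib_right[symmetric])
  ultimately have s1: "(\<Sum>t\<in>T. u t * (fst t - fst y)) \<le> 0" and s2: "(\<Sum>t\<in>T. u t * (snd t - snd y)) \<le> 0"
    using p by simp_all
  have zero: "u t = 0 \<or> f t = 0"
    if "(\<Sum>t\<in>T. u t * f t) \<le> 0" "\<And>t. t \<in> T \<Longrightarrow> 0 \<le> u t * f t" "t \<in> T" for f :: "real \<times> real \<Rightarrow> real" and t
    using sum_nonneg_eq_0_iff[OF fin, of "\<lambda>t. u t * f t"] that sum_nonneg[of T "\<lambda>t. u t * f t"]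
    by force
  have allz: "\<exists>t\<in>T. u t \<noteq> 0" using u(2) by (metis sum.neutral zero_neq_one)
  define L where "L = {t \<in> T. fst t \<le> fst y}"
  have L2: "snd t > snd y" if "t \<in> L" for t
    using no that by (auto simp: L_def covered_def not_le)
  have "L \<noteq> {}"
  proof
    assume "L = {}"
    then have gt: "fst t > fst y" if "t \<in> T" for t using that unfolding L_def not_le[symmetric] by blast
    have "0 \<le> u t * (fst t - fst y)" if "t \<in> T" for t
      using u(1)[OF that] gt[OF that] by simp
    then have "u t = 0 \<or> fst t - fst y = 0" if "t \<in> T" for t
      using that by (rule zero[OF s1])
    then have "u t = 0" if "t \<in> T" for t
      using gt that by fastforce
    with allz show False by blast
  qed
  moreover have "finite L" using fin by (simp add: L_def)
  ultimately obtain a where a: "a \<in> L" and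
    amax: "\<And>t. t \<in> L \<Longrightarrow> (fst y - fst t) / (snd t - snd y) \<le> (fst y - fst a) / (snd a - snd y)"
  proof -
    define r where "r t = (fst y - fst t) / (snd t - snd y)" for t
    assume *: "\<And>a. a \<in> L \<Longrightarrow> (\<And>t. t \<in> L \<Longrightarrow> (fst y - fst t) / (snd t - snd y) \<le> (fst y - fst a) / (snd a - snd y)) \<Longrightarrow> thesis"
    have "Max (r ` L) \<in> r ` L" using \<open>finite L\<close> \<open>L \<noteq> {}\<close> by simp
    then obtain a where "a \<in> L" "r a = Max (r ` L)" by auto
    then show thesis using \<open>finite L\<close> by (intro *[of a]) (simp_all add: r_def[symmetric])
  qed
  \<comment> \<open>The normal of the line through \<open>a\<close> and \<open>y\<close>.\<close>
  define l1 where "l1 = snd a - snd y"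
  define l2 where "l2 = fst y - fst a"
  have l: "0 < l1" "0 \<le> l2" using a L2 by (auto simp: l1_def l2_def L_def)
  define f where "f = (\<lambda>t. l1 * (fst t - fst y) + l2 * (snd t - snd y))"
  have fL: "0 \<le> f t" if "t \<in> L" for t
  proof -
    have "(fst y - fst t) / (snd t - snd y) \<le> l2 / l1" using amax[OF that] by (simp add: l1_def l2_def)
    then have "(fst y - fst t) * l1 \<le> l2 * (snd t - snd y)" using L2[OF that] l by (simp add: field_simps)
    then show ?thesis by (simp add: f_def algebra_simps)
  qed
  have fR: "0 < f t" if "t \<in> T" "t \<notin> L" for t
  proof -
    have "\<not> covered a t y" using no a that by (auto simp: L_def)
    then have "\<not> (snd t - snd a) * (fst y - fst a) \<le> (fst t - fst a) * (snd y - snd a)"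
      using a that by (auto simp: covered_def L_def)
    then show ?thesis by (simp add: f_def l1_def l2_def algebra_simps)
  qed
  have fnn: "0 \<le> u t * f t" if "t \<in> T" for t using fL fR u(1) that by (cases "t \<in> L") (auto simp: less_imp_le)
  have "(\<Sum>t\<in>T. u t * f t) = l1 * (\<Sum>t\<in>T. u t * (fst t - fst y)) + l2 * (\<Sum>t\<in>T. u t * (snd t - snd y))"
    by (simp add: f_def sum_distrib_left sum.distrib[symmetric] algebra_simps)
  also have "\<dots> \<le> 0" using s1 s2 l by (simp add: add_nonpos_nonpos mult_nonneg_nonpos)
  finally have S0: "(\<Sum>t\<in>T. u t * f t) \<le> 0" .
  have R0: "u t = 0" if t: "t \<in> T" "t \<notin> L" for t
    using zero[OF S0 fnn t(1)] fR[OF t] by auto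
  have "u t = 0" if "t \<in> T" for t
  proof (cases "t \<in> L")
    case True
    have "0 \<le> u t * (snd t - snd y)" if "t \<in> T" for t
      using R0 L2 u(1) that by (cases "t \<in> L") (auto simp: less_imp_le)
    then have "u t = 0 \<or> snd t - snd y = 0" by (rule zero[OF s2 _ that])
    then show ?thesis using L2[OF True] by auto
  qed (use R0 that in blast)
  with allz show False by blast
qed

lemma extreme_upper_hull_uncovered:
  assumes "finite S"
  shows "y extreme_point_of upper_hull S \<longleftrightarrow> y \<in> uncovered S"
  unfolding extreme_upper_hull_iff[OF assms] uncovered_def
  using in_upper_hull_covered[of "S - {y}" y] covered_in_upper_hull[of _ "S - {y}" _ y] assms by blast

text \<open>A generating subset of least size consists of extreme points only: a non-extreme member
  lies in the upper hull of the others and could be dropped.\<close>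

lemma upper_hull_uncovered:
  assumes fin: "finite S"
  shows "S \<subseteq> upper_hull (uncovered S)"
proof -
  have "S \<subseteq> S \<and> S \<subseteq> upper_hull S" using hull_subset_upper_hull[of S] hull_subset[of S convex] by blast
  from ex_has_least_nat[where P = "\<lambda>B. B \<subseteq> S \<and> S \<subseteq> upper_hull B" and m = card, OF this]
  obtain B where B: "B \<subseteq> S" "S \<subseteq> upper_hull B" and
    Bmin: "\<And>B'. B' \<subseteq> S \<and> S \<subseteq> upper_hull B' \<Longrightarrow> card B \<le> card B'"
    by (elim exE conjE) metis
  have upB: "upper_hull B = upper_hull S" using upper_hull_mono[OF B(1)] upper_hull_absorb[OF B(2)] by blast
  have finB: "finite B" using B fin finite_subset by blast
  have "b extreme_point_of upper_hull B" if b: "b \<in> B" for b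
  proof (rule ccontr)
    assume "\<not> ?thesis"
    then have "b \<in> upper_hull (B - {b})" using b extreme_upper_hull_iff[OF finB] by blast
    then have "B \<subseteq> upper_hull (B - {b})" using hull_subset_upper_hull[of "B - {b}"] hull_subset[of "B - {b}" convex] by blast
    then have "S \<subseteq> upper_hull (B - {b})" using B(2) upper_hull_absorb by blast
    then have "card B \<le> card (B - {b})" using B(1) by (intro Bmin) auto
    then show False using card_Diff1_less[OF finB b] by linarith
  qed
  then have "B \<subseteq> uncovered S" unfolding upB using extreme_upper_hull_uncovered[OF fin] by blast
  then show ?thesis using B(2) upper_hull_mono by blast
qed

section \<open>Rational points and their real images\<close>

lemma inj_real_pt: "inj real_pt"
  by (auto simp: inj_def real_pt_def prod_eq_iff)

lemma covered_real_pt: "covered (real_pt a) (real_pt b) (real_pt y) \<longleftrightarrow> covered a b y"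
  by (simp add: covered_def real_pt_def of_rat_less_eq of_rat_less of_rat_diff[symmetric] of_rat_mult[symmetric])

lemma uncovered_real_pt: "uncovered (real_pt ` S) = real_pt ` uncovered S"
proof -
  have "real_pt ` S - {real_pt y} = real_pt ` (S - {y})" for y
    using inj_real_pt by (auto dest: injD)
  then have "real_pt x \<in> uncovered (real_pt ` S) \<longleftrightarrow> x \<in> uncovered S" for x
    by (simp add: uncovered_def covered_real_pt inj_image_mem_iff[OF inj_real_pt])
  moreover have "uncovered (real_pt ` S) \<subseteq> real_pt ` S" by (simp add: uncovered_def)
  ultimately show ?thesis by blast
qed

lemma extreme_upper_hull_real_pt:
  assumes "finite S"
  shows "real_pt y extreme_point_of upper_hull (real_pt ` S) \<longleftrightarrow> y \<in> uncovered S"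
  using extreme_upper_hull_uncovered[of "real_pt ` S"] assms
  by (simp add: uncovered_real_pt inj_image_mem_iff[OF inj_real_pt])

text \<open>The rational form of \<open>upper_hull_uncovered\<close>, obtained through the real
  images. If \<open>y\<close> is itself uncovered, then \<open>a = b = y\<close> is the
  witness.\<close>

lemma covered_by_uncovered:
  fixes S :: "point set"
  assumes "finite S" "y \<in> S"
  shows "\<exists>a\<in>uncovered S. \<exists>b\<in>uncovered S. covered a b y"
proof -
  have "real_pt y \<in> upper_hull (uncovered (real_pt ` S))"
    using upper_hull_uncovered[of "real_pt ` S"] assms by blast
  moreover have "finite (uncovered (real_pt ` S))" using assms by (simp add: uncovered_def)
  ultimately obtain a b where "a \<in> uncovered S" "b \<in> uncovered S" "covered (real_pt a) (real_pt b) (real_pt y)"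
    using in_upper_hull_covered[of "uncovered (real_pt ` S)" "real_pt y"] by (auto simp: uncovered_real_pt)
  then show ?thesis by (auto simp: covered_real_pt)
qed

lemma clean_up_uncovered:
  assumes "finite A"
  shows "clean_up A = uncovered A"
proof -
  have "uncovered A \<subseteq> A" by (simp add: uncovered_def)
  then show ?thesis
    unfolding clean_up_def upper_hull_def[symmetric] extreme_upper_hull_real_pt[OF assms] by blast
qed

text \<open>This justifies cleaning up \<open>A\<close> without knowing \<open>S\<close>: a point of
  \<open>A\<close> that is covered in \<open>S\<close> is covered by uncovered points of
  \<open>S\<close>, and these are all in \<open>A\<close>, so no spurious extreme point
  arises.\<close>

lemma uncovered_subset_eq:
  fixes S :: "point set"
  assumes "finite S" "uncovered S \<subseteq> A" "A \<subseteq> S"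
  shows "uncovered A = uncovered S"
proof
  show "uncovered S \<subseteq> uncovered A" using assms unfolding uncovered_def by blast
  show "uncovered A \<subseteq> uncovered S"
  proof
    fix y assume y: "y \<in> uncovered A"
    show "y \<in> uncovered S"
    proof (rule ccontr)
      assume n: "y \<notin> uncovered S"
      have "y \<in> S" using y assms by (auto simp: uncovered_def)
      then obtain a b where "a \<in> uncovered S" "b \<in> uncovered S" "covered a b y"
        using covered_by_uncovered assms by blast
      moreover from this have "a \<in> A - {y}" "b \<in> A - {y}" using n assms by blast+
      ultimately show False using y unfolding uncovered_def by blast
    qed
  qed
qed

section \<open>The upper image as the hull of finitely many image points\<close>

lemma convex_hull_image_finite:
  assumes "finite S"
  shows "convex hull (f ` S) = {\<Sum>s\<in>S. u s *\<^sub>R f s | u. (\<forall>s\<in>S. 0 \<le> u s) \<and> sum u S = (1::real)}"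
    (is "_ = ?C")
proof
  show "?C \<subseteq> convex hull (f ` S)"
  proof
    fix p assume "p \<in> ?C"
    then obtain u where "\<forall>s\<in>S. 0 \<le> u s" "sum u S = 1" "p = (\<Sum>s\<in>S. u s *\<^sub>R f s)" by blast
    then show "p \<in> convex hull (f ` S)"
      using convex_sum[OF assms convex_convex_hull, of u f "f ` S"] hull_inc[of _ "f ` S" convex] by blast
  qed
  show "convex hull (f ` S) \<subseteq> ?C"
  proof (rule hull_minimal)
    show "f ` S \<subseteq> ?C"
    proof
      fix p assume "p \<in> f ` S"
      then obtain s where "s \<in> S" "p = f s" by blast
      then show "p \<in> ?C" using assms
        \<comment> \<open>All weight on the preimage \<open>s\<close>. Coefficients are indexed by
          preimages because several solutions may share an image.\<close>
        by (intro CollectI exI[of _ "\<lambda>t. if t = s then 1 else 0"])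
          (simp add: if_distrib[of "\<lambda>c. c *\<^sub>R _"] cong: if_cong)
    qed
    show "convex ?C"
    proof (rule convexI)
      fix p q a b assume "p \<in> ?C" "q \<in> ?C" and ab: "0 \<le> a" "0 \<le> b" "a + b = (1::real)"
      then obtain u v where u: "\<forall>s\<in>S. 0 \<le> u s" "sum u S = 1" "p = (\<Sum>s\<in>S. u s *\<^sub>R f s)"
        and v: "\<forall>s\<in>S. 0 \<le> v s" "sum v S = 1" "q = (\<Sum>s\<in>S. v s *\<^sub>R f s)" by blast
      show "a *\<^sub>R p + b *\<^sub>R q \<in> ?C" using u v ab
        by (intro CollectI exI[of _ "\<lambda>s. a * u s + b * v s"])
          (simp add: sum.distrib sum_distrib_left[symmetric] scaleR_sum_right scaleR_add_left)
    qed
  qed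
qed

text \<open>A solution is determined by its 0-1 entries. The bound on the cardinality later keeps
  the counters of points within the cells.\<close>

lemma finite_sols:
  assumes "boco_instance I"
  shows "finite (sols I)" and "card (sols I) \<le> 2 ^ dim I"
proof -
  have inj: "inj_on (\<lambda>x. \<lambda>i\<in>{..<dim I}. x $ i) (sols I)"
  proof (rule inj_onI)
    fix x y assume xy: "x \<in> sols I" "y \<in> sols I"
      and eq: "(\<lambda>i\<in>{..<dim I}. x $ i) = (\<lambda>i\<in>{..<dim I}. y $ i)"
    have "x \<in> carrier_vec (dim I)" "y \<in> carrier_vec (dim I)"
      using xy assms by (auto simp: boco_instance_def)
    then show "x = y" using fun_cong[OF eq] by (intro eq_vecI) (auto simp: restrict_def split: if_splits, meson)
  qed
  have sub: "(\<lambda>x. \<lambda>i\<in>{..<dim I}. x $ i) ` sols I \<subseteq> ({..<dim I} \<rightarrow>\<^sub>E {0, 1})"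
    using assms by (force simp: boco_instance_def)
  have fin: "finite ({..<dim I} \<rightarrow>\<^sub>E {0, 1::rat})" by (intro finite_PiE) auto
  show "finite (sols I)" using finite_imageD[OF finite_subset[OF sub fin] inj] .
  have "card (sols I) \<le> card ({..<dim I} \<rightarrow>\<^sub>E {0, 1::rat})"
    using card_inj_on_le[OF inj sub fin] .
  then show "card (sols I) \<le> 2 ^ dim I" by (simp add: card_PiE numeral_2_eq_2)
qed

abbreviation image_pts :: "boco_inst \<Rightarrow> point set" where
  "image_pts I \<equiv> image_pt I ` sols I"

text \<open>Multiplication by the cost matrix is linear, so a convex combination of solutions goes
  to the combination of image points with the same coefficients. From here on only plane geometry is
  needed.\<close>

lemma upper_image_eq:
  assumes I: "boco_instance I"
  shows "upper_image I = upper_hull (real_pt ` image_pts I)"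
proof -
  define n where "n = dim I"
  define C where "C = costs I"
  define R :: "real mat" where "R = map_mat of_rat C"
  define f where "f = (\<lambda>x::real vec. ((R *\<^sub>v x) $ 0, (R *\<^sub>v x) $ 1))"
  define S :: "real vec set" where "S = map_vec of_rat ` sols I"
  have C: "C \<in> carrier_mat 2 n" and S: "\<And>s. s \<in> sols I \<Longrightarrow> s \<in> carrier_vec n"
    using I by (auto simp: boco_instance_def C_def n_def)
  have finS: "finite S" using finite_sols[OF I] by (simp add: S_def)
  have ent: "(R *\<^sub>v x) $ k = (\<Sum>j<n. R $$ (k, j) * x $ j)" if "x \<in> carrier_vec n" "k < 2" for x k
    using that C by (simp add: R_def scalar_prod_def lessThan_atLeast0)
  have "real_pt (image_pt I x) = f (map_vec of_rat x)" if "x \<in> sols I" for x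
  proof -
    have "of_rat ((C *\<^sub>v x) $ k) = (R *\<^sub>v map_vec of_rat x) $ k" if "k < 2" for k
      using S[OF \<open>x \<in> sols I\<close>] C that
      by (simp add: R_def scalar_prod_def of_rat_sum of_rat_mult)
    then show ?thesis by (simp add: real_pt_def image_pt_def f_def C_def)
  qed
  then have fS: "f ` S = real_pt ` image_pts I" by (force simp: S_def image_image)
  have "f (vec n (\<lambda>i. \<Sum>s\<in>S. u s * s $ i)) = (\<Sum>s\<in>S. u s *\<^sub>R f s)" for u
  proof -
    have "(R *\<^sub>v vec n (\<lambda>i. \<Sum>s\<in>S. u s * s $ i)) $ k = (\<Sum>s\<in>S. u s * (R *\<^sub>v s) $ k)" if k: "k < 2" for k
    proof -
      have "(\<Sum>s\<in>S. u s * (R *\<^sub>v s) $ k) = (\<Sum>s\<in>S. u s * (\<Sum>j<n. R $$ (k, j) * s $ j))"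
        using ent k S by (intro sum.cong) (auto simp: S_def)
      also have "\<dots> = (\<Sum>j<n. R $$ (k, j) * (\<Sum>s\<in>S. u s * s $ j))"
        by (subst sum_distrib_left, subst sum.swap) (simp add: sum_distrib_left mult_ac)
      finally show ?thesis using ent[of "vec n (\<lambda>i. \<Sum>s\<in>S. u s * s $ i)" k] k by simp
    qed
    then show ?thesis by (simp add: f_def prod_eq_iff fst_sum snd_sum)
  qed
  then have "f ` conv_vecs n S = convex hull (f ` S)"
  proof -
    assume *: "\<And>u. f (vec n (\<lambda>i. \<Sum>s\<in>S. u s * s $ i)) = (\<Sum>s\<in>S. u s *\<^sub>R f s)"
    have "f ` conv_vecs n S = {f (vec n (\<lambda>i. \<Sum>s\<in>S. u s * s $ i)) | u. (\<forall>s\<in>S. 0 \<le> u s) \<and> sum u S = 1}"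
      unfolding conv_vecs_def by blast
    then show ?thesis unfolding convex_hull_image_finite[OF finS] * .
  qed
  moreover have "upper_image I = {z + r | z r. z \<in> f ` conv_vecs n S \<and> r \<in> nonneg_quadrant}"
  proof -
    have "upper_image I = {f x + r | x r. x \<in> conv_vecs n S \<and> r \<in> nonneg_quadrant}"
      by (simp only: upper_image_def f_def R_def C_def n_def S_def)
    then show ?thesis by blast
  qed
  ultimately show ?thesis by (simp add: upper_hull_def fS)
qed

lemma nd_extreme_eq:
  assumes I: "boco_instance I"
  shows "nd_extreme I = real_pt ` uncovered (image_pts I)"
  using extreme_upper_hull_uncovered[of "real_pt ` image_pts I"] finite_sols(1)[OF I]
  by (auto simp: nd_extreme_def upper_image_eq[OF I] uncovered_real_pt)

section \<open>Invariants of the Dichotomic Approach\<close>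

text \<open>The order from upper left to lower right. Two points are incomparable only if one is
  strictly smaller in both components.\<close>

definition precedes :: "point \<Rightarrow> point \<Rightarrow> bool" where
  "precedes a b \<longleftrightarrow> fst a \<le> fst b \<and> snd b \<le> snd a"

text \<open>Symmetric, because queued pairs occur in either orientation; empty if the two points are
  incomparable.\<close>

definition box :: "point \<Rightarrow> point \<Rightarrow> point set" where
  "box a b = {z. precedes a z \<and> precedes z b \<or> precedes b z \<and> precedes z a}"

definition optimal :: "point set \<Rightarrow> point \<Rightarrow> point \<Rightarrow> bool" where
  "optimal S l y \<longleftrightarrow> y \<in> S \<and> (\<forall>s\<in>S. dot l y \<le> dot l s)"

text \<open>One weight may be zero: the minimizers for (1, 0) and (0, 1) qualify although they can
  be dominated.\<close>

definition supported :: "point set \<Rightarrow> point \<Rightarrow> bool" where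
  "supported S y \<longleftrightarrow> (\<exists>l. 0 \<le> fst l \<and> 0 \<le> snd l \<and> l \<noteq> (0, 0) \<and> optimal S l y)"

text \<open>The corners of a comparable pair lie on its line, so only extreme points still to be
  found are counted.\<close>

definition below :: "point set \<Rightarrow> point \<Rightarrow> point \<Rightarrow> point set" where
  "below S a b = {z \<in> uncovered S. z \<in> box a b \<and> dot (weight a b) z < dot (weight a b) a}"

text \<open>Bounds the dequeuings that a pair causes, itself included. Truncated subtraction yields
  no splits if nothing lies below the line.\<close>

definition potential :: "point set \<Rightarrow> point \<Rightarrow> point \<Rightarrow> nat" where
  "potential S a b = 1 + 2 * (2 * card (below S a b) - 1)"

definition queue_potential :: "point set \<Rightarrow> (point \<times> point) list \<Rightarrow> nat" where
  "queue_potential S Q = sum_list (map (\<lambda>(a, b). potential S a b) Q)"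

text \<open>The box condition makes queued pairs neighbours in the chain \<open>A\<close>.
  Distinctness is required of unordered pairs, so that a new point cannot lie in the boxes of two
  queued pairs.\<close>

definition da_inv :: "point set \<Rightarrow> point set \<Rightarrow> (point \<times> point) list \<Rightarrow> bool" where
  "da_inv S A Q \<longleftrightarrow> A \<subseteq> S \<and> (\<forall>a\<in>A. supported S a) \<and> (\<forall>a\<in>A. \<forall>b\<in>A. precedes a b \<or> precedes b a) \<and>
     (\<forall>(a, b)\<in>set Q. a \<in> A \<and> b \<in> A \<and> a \<noteq> b \<and> A \<inter> box a b \<subseteq> {a, b}) \<and>
     distinct (map (\<lambda>(a, b). {a, b}) Q) \<and>
     (\<forall>z\<in>uncovered S. z \<in> A \<or> (\<exists>(a, b)\<in>set Q. z \<in> box a b))"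

lemma ws_optimal_pt_iff: "ws_optimal_pt I l y \<longleftrightarrow> optimal (image_pts I) l y"
  by (auto simp: ws_optimal_pt_def ws_optimal_def optimal_def)

lemma precedes_refl [simp]: "precedes a a"
  by (simp add: precedes_def)

lemma precedes_trans: "precedes a b \<Longrightarrow> precedes b c \<Longrightarrow> precedes a c"
  by (auto simp: precedes_def)

lemma precedes_antisym: "precedes a b \<Longrightarrow> precedes b a \<Longrightarrow> a = b"
  by (auto simp: precedes_def prod_eq_iff)

lemma box_commute: "box a b = box b a"
  by (auto simp: box_def)

lemma box_precedes: "precedes a b \<Longrightarrow> z \<in> box a b \<longleftrightarrow> precedes a z \<and> precedes z b"
  unfolding box_def using precedes_trans precedes_antisym by (metis (no_types, lifting) mem_Collect_eq)

lemma weight_commute: "weight a b = weight b a"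
  by (simp add: weight_def abs_minus_commute)

lemma weight_precedes: "precedes a b \<Longrightarrow> weight a b = (snd a - snd b, fst b - fst a)"
  by (simp add: weight_def precedes_def)

text \<open>Because of the absolute values, \<open>weight\<close> is normal to the segment only if
  the segment does not ascend; hence the comparability.\<close>

lemma dot_weight_eq: "precedes a b \<or> precedes b a \<Longrightarrow> dot (weight a b) a = dot (weight a b) b"
  by (auto simp: weight_commute[of a b] weight_precedes dot_def algebra_simps) (auto simp: weight_commute[of b a] weight_precedes dot_def algebra_simps)

lemma below_commute: "precedes a b \<or> precedes b a \<Longrightarrow> below S a b = below S b a"
  unfolding below_def weight_commute[of b a] box_commute[of b a] using dot_weight_eq by metis

lemma potential_commute: "precedes a b \<or> precedes b a \<Longrightarrow> potential S a b = potential S b a"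
  using below_commute[of a b S] by (simp add: potential_def)

text \<open>The step (p, -q) leads from a supported point to its partner, (u, v) to a point below
  their line; neither improves the supporting weight (l1, l2). A step to the left is impossible: for
  positive \<open>l2\<close>, eliminating \<open>v\<close> from the two conditions on (u, v) makes u
  * (l2 * q - l1 * p) negative, although both factors are nonpositive.\<close>

lemma improving_direction:
  fixes l1 l2 p q u v :: rat
  assumes l: "0 \<le> l1" "0 \<le> l2" "l1 \<noteq> 0 \<or> l2 \<noteq> 0" and pq: "0 \<le> p" "0 \<le> q"
    and b: "l2 * q \<le> l1 * p" and y: "0 \<le> l1 * u + l2 * v" and lt: "q * u + p * v < 0"
  shows "0 \<le> u \<and> v < 0 \<and> 0 < p"
proof -
  have u: "0 \<le> u"
  proof (rule ccontr)
    assume "\<not> 0 \<le> u"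
    then have u: "u < 0" by simp
    show False
    proof (cases "l2 = 0")
      case True
      then have "l1 * u < 0" using l u by (intro mult_pos_neg) auto
      then show False using y True by simp
    next
      case False
      then have "l2 * (q * u + p * v) < 0" using l lt by (intro mult_pos_neg) auto
      moreover have "0 \<le> p * (l1 * u + l2 * v)" using y pq by simp
      ultimately have "u * (l2 * q - l1 * p) < 0" by (simp add: algebra_simps)
      moreover have "0 \<le> u * (l2 * q - l1 * p)" using u b by (intro mult_nonpos_nonpos) auto
      ultimately show False by simp
    qed
  qed
  have "v < 0"
  proof (rule ccontr)
    assume "\<not> v < 0"
    then have "0 \<le> q * u + p * v" using u pq by (intro add_nonneg_nonneg mult_nonneg_nonneg) auto
    with lt show False by simp
  qed
  moreover have "p \<noteq> 0" using lt u pq by (metis add.right_neutral linorder_not_less mult_nonneg_nonneg mult_zero_left)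
  ultimately show ?thesis using u pq by simp
qed

text \<open>\<open>improving_direction\<close> at \<open>a\<close>, and at \<open>b\<close> with the
  components exchanged. Supportedness of the corners takes the place of nondominance.\<close>

lemma optimal_between:
  assumes ab: "precedes a b" "supported S a" "supported S b" "a \<in> S" "b \<in> S"
    and y: "y \<in> S" "dot (weight a b) y < dot (weight a b) a"
  shows "precedes a y" "precedes y b" "y \<noteq> a" "y \<noteq> b" "fst a < fst b" "snd b < snd a"
proof -
  define p where "p = fst b - fst a"
  define q where "q = snd a - snd b"
  have pq: "0 \<le> p" "0 \<le> q" using ab by (auto simp: precedes_def p_def q_def)
  have w: "weight a b = (q, p)" using ab by (simp add: weight_precedes p_def q_def)
  have eq: "dot (weight a b) a = dot (weight a b) b" using ab dot_weight_eq by blast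
  obtain l where l: "0 \<le> fst l" "0 \<le> snd l" "l \<noteq> (0, 0)" "optimal S l a"
    using ab by (auto simp: supported_def)
  have A: "0 \<le> fst y - fst a \<and> snd y - snd a < 0 \<and> 0 < p"
  proof (rule improving_direction[of "fst l" "snd l"])
    show "snd l * q \<le> fst l * p" "0 \<le> fst l * (fst y - fst a) + snd l * (snd y - snd a)"
      using l ab y by (auto simp: optimal_def dot_def p_def q_def algebra_simps)
    show "q * (fst y - fst a) + p * (snd y - snd a) < 0"
      using y(2) unfolding w by (simp add: dot_def algebra_simps)
  qed (use l pq in \<open>auto simp: prod_eq_iff\<close>)
  obtain m where m: "0 \<le> fst m" "0 \<le> snd m" "m \<noteq> (0, 0)" "optimal S m b"
    using ab by (auto simp: supported_def)
  have B: "0 \<le> snd y - snd b \<and> fst y - fst b < 0 \<and> 0 < q"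
  proof (rule improving_direction[of "snd m" "fst m"])
    show "fst m * p \<le> snd m * q" "0 \<le> snd m * (snd y - snd b) + fst m * (fst y - fst b)"
      using m ab y by (auto simp: optimal_def dot_def p_def q_def algebra_simps)
    show "p * (snd y - snd b) + q * (fst y - fst b) < 0"
      using y(2) unfolding eq unfolding w by (simp add: dot_def algebra_simps)
  qed (use m pq in \<open>auto simp: prod_eq_iff\<close>)
  show "precedes a y" "precedes y b" "y \<noteq> a" "y \<noteq> b" "fst a < fst b" "snd b < snd a"
    using A B by (auto simp: precedes_def p_def q_def)
qed

text \<open>Transitivity of q/p < v/u < t/s in cross-multiplied form, which admits vertical
  directions with u = 0 or s = 0.\<close>

lemma slope_chain:
  fixes p q u v s t :: rat
  assumes "0 \<le> q" "0 \<le> s" "0 < v" "0 \<le> u" "0 \<le> t" "q * u < p * v" "v * s < u * t"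
  shows "q * s < p * t"
proof -
  have t: "0 < t" using assms by (metis less_eq_rat_def linorder_not_less mult_nonneg_nonneg mult_zero_right)
  have "v * (q * s) = q * (v * s)" by simp
  also have "\<dots> \<le> q * (u * t)" using assms by (intro mult_left_mono) auto
  also have "\<dots> = (q * u) * t" by simp
  also have "\<dots> < (p * v) * t" using assms t by (intro mult_strict_right_mono) auto
  also have "\<dots> = v * (p * t)" by simp
  finally show ?thesis using assms by simp
qed

lemma uncovered_dominated: "z \<in> uncovered S \<Longrightarrow> y \<in> S \<Longrightarrow> fst y \<le> fst z \<Longrightarrow> snd y \<le> snd z \<Longrightarrow> z = y"
  by (rule ccontr) (force simp: uncovered_def covered_def)

text \<open>Positive weights exclude domination. On a segment, the excesses of \<open>z1\<close> and
  \<open>z2\<close> over the optimum, interpolated at the first component of \<open>y\<close>, sum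
  to at most 0, so both vanish; \<open>y\<close> is then an inner point of an optimal edge.\<close>

lemma covered_optimal:
  assumes y: "optimal S (q, p) y" and pq: "0 < p" "0 < q" and z: "z1 \<in> S" "z2 \<in> S" "z1 \<noteq> y" "z2 \<noteq> y"
    and covered: "covered z1 z2 y"
  shows "fst z1 < fst y" "fst y < fst z2" "dot (q, p) z1 = dot (q, p) y" "dot (q, p) z2 = dot (q, p) y"
proof -
  define f where "f = dot (q, p)"
  have f: "f x = q * fst x + p * snd x" for x by (simp add: f_def dot_def)
  have le: "f y \<le> f z1" "f y \<le> f z2" using y z by (auto simp: optimal_def f_def)
  have same: "x = y" if "f x = f y" "fst x = fst y" for x
    using that pq by (simp add: f prod_eq_iff)
  have ndom: "\<not> (fst x \<le> fst y \<and> snd x \<le> snd y)" if "f y \<le> f x" "x \<noteq> y" for x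
  proof
    assume d: "fst x \<le> fst y \<and> snd x \<le> snd y"
    have "q * fst x \<le> q * fst y" "p * snd x \<le> p * snd y" using d pq by auto
    then have "q * fst x = q * fst y" "p * snd x = p * snd y" using that(1) unfolding f by linarith+
    then show False using that pq by (simp add: prod_eq_iff)
  qed
  define D where "D = fst z2 - fst z1"
  define s where "s = fst y - fst z1"
  have *: "0 < D" "0 \<le> s" "s \<le> D" "(snd z2 - snd z1) * s \<le> D * (snd y - snd z1)"
    using covered ndom[OF le(1)] z by (auto simp: covered_def D_def s_def)
  have "p * ((snd z2 - snd z1) * s) \<le> p * (D * (snd y - snd z1))" using * pq by simp
  moreover have "(D - s) * (f z1 - f y) + s * (f z2 - f y) =
      p * ((snd z2 - snd z1) * s) - p * (D * (snd y - snd z1))"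
    unfolding f D_def s_def by (simp add: algebra_simps)
  moreover have "0 \<le> (D - s) * (f z1 - f y)" "0 \<le> s * (f z2 - f y)" using * le by auto
  ultimately have 0: "(D - s) * (f z1 - f y) = 0" "s * (f z2 - f y) = 0" by linarith+
  have "s \<noteq> 0" using 0 * same[of z1] z by (auto simp: s_def)
  moreover have "s \<noteq> D" using 0 \<open>s \<noteq> 0\<close> same[of z2] z by (auto simp: s_def D_def)
  ultimately show "fst z1 < fst y" "fst y < fst z2" "dot (q, p) z1 = dot (q, p) y" "dot (q, p) z2 = dot (q, p) y"
    using 0 * by (auto simp: s_def D_def f_def)
qed

lemma split_facts_precedes:
  assumes fin: "finite S" and ab: "precedes a b" "supported S a" "supported S b" "a \<in> S" "b \<in> S"
    and y: "optimal S (weight a b) y" "dot (weight a b) y < dot (weight a b) a"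
  shows "y \<in> box a b" "y \<noteq> a" "y \<noteq> b" "a \<notin> box y b" "b \<notin> box y a" "box y a \<subseteq> box a b" "box y b \<subseteq> box a b"
    "\<And>z. z \<in> uncovered S \<Longrightarrow> z \<in> box a b \<Longrightarrow> z \<in> box y a \<or> z \<in> box y b"
    "potential S y a + potential S y b + 1 \<le> potential S a b"
proof -
  define p where "p = fst b - fst a"
  define q where "q = snd a - snd b"
  have w: "weight a b = (q, p)" using ab by (simp add: weight_precedes p_def q_def)
  have eq: "dot (weight a b) a = dot (weight a b) b" using ab dot_weight_eq by blast
  have yS: "y \<in> S" using y by (simp add: optimal_def)
  note btw = optimal_between[OF ab(1-5)]
  have ay: "precedes a y" "precedes y b" "y \<noteq> a" "y \<noteq> b" and pq: "0 < p" "0 < q"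
    using btw[OF yS y(2)] by (auto simp: p_def q_def)
  have ya_box: "z \<in> box y a \<longleftrightarrow> precedes a z \<and> precedes z y" and yb_box: "z \<in> box y b \<longleftrightarrow> precedes y z \<and> precedes z b" for z
    using box_precedes ay box_commute by metis+
  show ybox: "y \<in> box a b" "y \<noteq> a" "y \<noteq> b" using ay ab by (auto simp: box_precedes)
  show "a \<notin> box y b" "b \<notin> box y a" using ay precedes_antisym[of a y] precedes_antisym[of b y] by (auto simp: ya_box yb_box)
  show sub1: "box y a \<subseteq> box a b" and sub2: "box y b \<subseteq> box a b"
    unfolding subset_iff ya_box yb_box box_precedes[OF ab(1)] using ay precedes_trans by blast+
  have same: "x = y" if "x \<in> S" "fst x \<le> fst y" "snd x \<le> snd y" for x
  proof (rule ccontr)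
    assume "x \<noteq> y"
    then have "covered x x y" using that by (simp add: covered_def)
    from covered_optimal(1,2)[OF y(1)[unfolded w] pq that(1) that(1) \<open>x \<noteq> y\<close> \<open>x \<noteq> y\<close> this] show False by simp
  qed
  \<comment> \<open>If \<open>z\<close> lies in neither box, then one of \<open>y\<close> and
    \<open>z\<close> dominates the other, and either direction forces equality.\<close>
  show "z \<in> box y a \<or> z \<in> box y b" if z: "z \<in> uncovered S" "z \<in> box a b" for z
  proof -
    have "z \<in> S" using z by (simp add: uncovered_def)
    moreover have "precedes a z" "precedes z b" using z(2) by (simp_all add: box_precedes[OF ab(1)])
    ultimately show ?thesis
      using same[of z] uncovered_dominated[OF z(1) yS] ay unfolding ya_box yb_box
      by (metis linorder_linear precedes_def)
  qed
  define N where "N = below S a b"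
  define B1 where "B1 = below S y a"
  define B2 where "B2 = below S y b"
  have finN: "finite N" using fin by (simp add: N_def below_def uncovered_def)
  have B1: "B1 \<subseteq> N"
  proof
    fix z assume z: "z \<in> B1"
    then have zb: "precedes a z" "precedes z y" and lt: "dot (weight a y) z < dot (weight a y) a"
      unfolding B1_def using below_commute[of a y S] ay by (auto simp: below_def box_precedes)
    \<comment> \<open>Seen from \<open>a\<close>, the descent gets steeper from \<open>b\<close> to
      \<open>y\<close> to \<open>z\<close>.\<close>
    have "q * (fst z - fst a) < p * (snd a - snd z)"
    proof (rule slope_chain[of _ _ "snd a - snd y" "fst y - fst a"])
      show "(snd a - snd y) * (fst z - fst a) < (fst y - fst a) * (snd a - snd z)"
        using lt by (simp add: weight_precedes ay dot_def algebra_simps)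
      show *: "q * (fst y - fst a) < p * (snd a - snd y)"
        using y(2) by (simp add: w dot_def algebra_simps)
      show "0 < snd a - snd y"
      proof -
        have "0 \<le> q * (fst y - fst a)" using ay pq by (simp add: precedes_def)
        with * have "0 < p * (snd a - snd y)" by linarith
        then show ?thesis using pq by (simp add: zero_less_mult_iff)
      qed
    qed (use zb ay pq in \<open>auto simp: precedes_def\<close>)
    then have "dot (weight a b) z < dot (weight a b) a" by (simp add: w dot_def algebra_simps)
    then show "z \<in> N" using z sub1 by (auto simp: N_def B1_def below_def)
  qed
  have B2: "B2 \<subseteq> N"
  proof
    fix z assume z: "z \<in> B2"
    then have zb: "precedes y z" "precedes z b" and lt: "dot (weight y b) z < dot (weight y b) b"
      unfolding B2_def using dot_weight_eq[of y b] ay by (auto simp: below_def box_precedes)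
    have "p * (snd z - snd b) < q * (fst b - fst z)"
    \<comment> \<open>The same chain seen from \<open>b\<close>, with the components
      exchanged.\<close>
    proof (rule slope_chain[of _ _ "fst b - fst y" "snd y - snd b"])
      show "(fst b - fst y) * (snd z - snd b) < (snd y - snd b) * (fst b - fst z)"
        using lt by (simp add: weight_precedes ay dot_def algebra_simps)
      show *: "p * (snd y - snd b) < q * (fst b - fst y)"
        using y(2) unfolding eq by (simp add: w dot_def algebra_simps)
      show "0 < fst b - fst y"
      proof -
        have "0 \<le> p * (snd y - snd b)" using ay pq by (simp add: precedes_def)
        with * have "0 < q * (fst b - fst y)" by linarith
        then show ?thesis using pq by (simp add: zero_less_mult_iff)
      qed
    qed (use zb ay pq in \<open>auto simp: precedes_def\<close>)
    then have "dot (weight a b) z < dot (weight a b) b" by (simp add: w dot_def algebra_simps)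
    then show "z \<in> N" using z sub2 eq by (auto simp: N_def B2_def below_def)
  qed
  have yn: "y \<notin> B1" "y \<notin> B2" by (auto simp: B1_def B2_def below_def)
  have disj: "B1 \<inter> B2 = {}"
  proof -
    have "z = y" if "z \<in> B1" "z \<in> B2" for z
      using that precedes_antisym[of z y] by (simp add: B1_def B2_def below_def ya_box yb_box)
    with yn show ?thesis by blast
  qed
  \<comment> \<open>\<open>x1\<close> shows that \<open>B2\<close> alone does not exhaust
    \<open>N\<close>, and \<open>x2\<close> the same for \<open>B1\<close>; so an empty side forces
    a strict loss.\<close>
  have "\<exists>x1 x2. x1 \<in> N \<and> x1 \<notin> B2 \<and> x2 \<in> N \<and> x2 \<notin> B1 \<and> (x1 = x2 \<longrightarrow> x1 \<notin> B1)"
  proof (cases "y \<in> uncovered S")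
    case True
    then have "y \<in> N" using ybox y by (simp add: N_def below_def)
    then show ?thesis using yn by blast
  next
    case False
    obtain z1 z2 where z: "z1 \<in> uncovered S" "z2 \<in> uncovered S" "covered z1 z2 y"
      using covered_by_uncovered[OF fin yS] by blast
    have zS: "z1 \<in> S" "z2 \<in> S" using z by (auto simp: uncovered_def)
    note co = covered_optimal[OF y(1)[unfolded w] pq zS _ _ z(3)]
    have ne: "z1 \<noteq> y" "z2 \<noteq> y" using z False by auto
    have f: "dot (weight a b) z1 < dot (weight a b) a" "dot (weight a b) z2 < dot (weight a b) a"
      using co(3,4)[OF ne] y(2) by (simp_all add: w)
    have "z1 \<in> N" "z2 \<in> N"
      using z f btw(1,2)[OF zS(1) f(1)] btw(1,2)[OF zS(2) f(2)] ab by (simp_all add: N_def below_def box_precedes)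
    moreover have "z1 \<notin> B2" "z2 \<notin> B1" "z1 \<noteq> z2"
      using co(1,2)[OF ne] by (auto simp: B1_def B2_def below_def ya_box yb_box precedes_def)
    ultimately show ?thesis by blast
  qed
  then obtain x1 x2 where x: "x1 \<in> N" "x1 \<notin> B2" "x2 \<in> N" "x2 \<notin> B1" by blast
  have fin12: "finite B1" "finite B2" using B1 B2 finN finite_subset by blast+
  have c: "card B1 + card B2 \<le> card N"
    using card_mono[OF finN, of "B1 \<union> B2"] card_Un_disjoint[OF fin12 disj] B1 B2 by simp
  have cN: "0 < card N" using x finN card_gt_0_iff by blast
  have c': "card B1 + card B2 < card N" if "B1 = {} \<or> B2 = {}"
  proof -
    have "B1 \<union> B2 \<subset> N" using that x B1 B2 by blast
    then show ?thesis using psubset_card_mono[OF finN] card_Un_disjoint[OF fin12 disj] by metis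
  qed
  \<comment> \<open>With two nonempty sides the units cancel exactly. An empty side contributes 0
    instead of -1 by truncation, and the lost point pays for the difference.\<close>
  have "(2 * card B1 - 1) + (2 * card B2 - 1) + 1 \<le> 2 * card N - 1"
  proof (cases "B1 = {} \<or> B2 = {}")
    case True
    with c'[OF True] show ?thesis by auto
  next
    case False
    then have "0 < card B1" "0 < card B2" using fin12 by (auto simp: card_gt_0_iff)
    with c show ?thesis by linarith
  qed
  then show "potential S y a + potential S y b + 1 \<le> potential S a b"
    by (simp add: potential_def N_def B1_def B2_def)
qed

lemma split_facts:
  assumes fin: "finite S" and ab: "precedes a b \<or> precedes b a" "supported S a" "supported S b" "a \<in> S" "b \<in> S"
    and y: "optimal S (weight a b) y" "dot (weight a b) y < dot (weight a b) a"
  shows "y \<in> box a b \<and> y \<noteq> a \<and> y \<noteq> b \<and> a \<notin> box y b \<and> b \<notin> box y a \<and> box y a \<subseteq> box a b \<and> box y b \<subseteq> box a b \<and>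
    (\<forall>z \<in> uncovered S \<inter> box a b. z \<in> box y a \<or> z \<in> box y b) \<and>
    potential S y a + potential S y b + 1 \<le> potential S a b"
  using ab(1)
proof
  assume "precedes a b"
  from split_facts_precedes[OF fin this ab(2-5) y] show ?thesis by auto
next
  assume ba: "precedes b a"
  have y': "optimal S (weight b a) y" "dot (weight b a) y < dot (weight b a) b"
    using y dot_weight_eq[of a b] ba by (auto simp: weight_commute)
  from split_facts_precedes[OF fin ba ab(3,2,5,4) y'] show ?thesis
    using potential_commute[of a b S] ba box_commute[of a b] by auto
qed

text \<open>If the minimizer is on the line, a point of \<open>S\<close> in the box is on or above
  the segment, and the corners cover it unless it is one of them.\<close>

lemma neglect_facts:
  assumes ab: "precedes a b \<or> precedes b a" "a \<in> S" "b \<in> S"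
    and y: "optimal S (weight a b) y" "in_segment y a b"
    and z: "z \<in> uncovered S" "z \<in> box a b"
  shows "z = a \<or> z = b"
proof -
  have main: "z = a \<or> z = b" if ab: "precedes a b" "a \<in> S" "b \<in> S" and f: "dot (weight a b) a \<le> dot (weight a b) z"
    and z: "z \<in> box a b" for a b
  proof (rule ccontr)
    assume ne: "\<not> ?thesis"
    have zb: "precedes a z" "precedes z b" using z ab by (auto simp: box_precedes)
    have "covered a b z \<or> covered b b z"
    proof (cases "fst a < fst b")
      case True
      then have "covered a b z" using zb f ab by (simp add: covered_def precedes_def weight_precedes dot_def algebra_simps)
      then show ?thesis by simp
    next
      \<comment> \<open>The box is a vertical segment here, all of which its lower end
        \<open>b\<close> dominates.\<close>
      case False
      then show ?thesis using zb ab by (simp add: covered_def precedes_def)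
    qed
    then show False using ne ab \<open>z \<in> uncovered S\<close> by (auto simp: uncovered_def)
  qed
  have f: "dot (weight a b) a \<le> dot (weight a b) z" "dot (weight a b) b \<le> dot (weight a b) z"
    using y z by (auto simp: in_segment_def optimal_def uncovered_def)
  from ab(1) show ?thesis
  proof
    assume "precedes a b" then show ?thesis using main[of a b] f ab z by blast
  next
    assume "precedes b a" then show ?thesis using main[of b a] f ab z by (auto simp: weight_commute box_commute)
  qed
qed

section \<open>Preservation of the invariant\<close>

lemma da_inv_init:
  assumes y: "optimal S (1, 0) y0" "optimal S (0, 1) y1" "y0 \<noteq> y1"
  shows "da_inv S {y0, y1} [(y0, y1)]"
proof -
  have S: "y0 \<in> S" "y1 \<in> S" using y by (auto simp: optimal_def)
  have le: "fst y0 \<le> fst z" "snd y1 \<le> snd z" if "z \<in> S" for z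
    using y that by (auto simp: optimal_def dot_def)
  have precedes: "precedes y0 y1" using le S by (simp add: precedes_def)
  have sup: "supported S y0" "supported S y1"
    unfolding supported_def using y(1,2) by (intro exI[of _ "(1,0)"], simp, intro exI[of _ "(0,1)"], simp)
  \<comment> \<open>\<open>y0\<close> and \<open>y1\<close> may be dominated themselves, yet a point
    outside their box is dominated by one of them, and is uncovered only if equal to it.\<close>
  have "z = y0 \<or> z = y1 \<or> z \<in> box y0 y1" if z: "z \<in> uncovered S" for z
  proof -
    have "z \<in> S" using z by (simp add: uncovered_def)
    then show ?thesis unfolding box_precedes[OF precedes] precedes_def
      using le[of z] uncovered_dominated[OF z S(1)] uncovered_dominated[OF z S(2)] by linarith
  qed
  then show ?thesis using S y precedes sup by (auto simp: da_inv_def)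
qed

lemma uncovered_ideal:
  assumes y: "optimal S (1, 0) y" "optimal S (0, 1) y"
  shows "uncovered S = {y}"
proof -
  have S: "y \<in> S" and le: "fst y \<le> fst z" "snd y \<le> snd z" if "z \<in> S" for z
    using y that by (auto simp: optimal_def dot_def)
  have yS: "y \<in> S" using y by (simp add: optimal_def)
  have "\<not> covered a b y" if "a \<in> S - {y}" for a b
  proof
    assume "covered a b y"
    \<comment> \<open>The segment clause reduces to domination as well: \<open>fst a\<close> cannot
      be smaller than the minimum \<open>fst y\<close>, so its left side is 0.\<close>
    then have "fst a = fst y \<and> snd a = snd y"
      using le[of a] that by (auto simp: covered_def zero_le_mult_iff)
    then show False using that by (auto simp: prod_eq_iff)
  qed
  then have "y \<in> uncovered S" using yS by (auto simp: uncovered_def)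
  moreover have "z = y" if "z \<in> uncovered S" for z
    using uncovered_dominated[OF that yS] le[of z] that by (auto simp: uncovered_def)
  ultimately show ?thesis by blast
qed

lemma da_inv_neglect:
  assumes inv: "da_inv S A ((a, b) # Q)" and y: "optimal S (weight a b) y" "in_segment y a b"
  shows "da_inv S A Q"
proof -
  have ab: "precedes a b \<or> precedes b a" "a \<in> S" "b \<in> S" "a \<in> A" "b \<in> A" using inv by (auto simp: da_inv_def)
  have "z \<in> A \<or> (\<exists>(a, b)\<in>set Q. z \<in> box a b)" if z: "z \<in> uncovered S" for z
    using inv z neglect_facts[OF ab(1-3) y z] ab unfolding da_inv_def by auto
  then show ?thesis using inv by (auto simp: da_inv_def)
qed

text \<open>The delicate part is that \<open>y\<close> lies in no other queued box; otherwise the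
  pair of that box would no longer consist of neighbours.\<close>

lemma da_inv_split:
  assumes fin: "finite S" and inv: "da_inv S A ((a, b) # Q)"
    and y: "optimal S (weight a b) y" "\<not> in_segment y a b"
  shows "y \<notin> A" "da_inv S (insert y A) (Q @ [(y, a), (y, b)])"
    "queue_potential S (Q @ [(y, a), (y, b)]) + 1 \<le> queue_potential S ((a, b) # Q)"
proof -
  have AS: "A \<subseteq> S" and supA: "\<And>c. c \<in> A \<Longrightarrow> supported S c"
    and chain: "\<And>c d. c \<in> A \<Longrightarrow> d \<in> A \<Longrightarrow> precedes c d \<or> precedes d c"
    and Q: "\<And>c d. (c, d) \<in> set Q \<Longrightarrow> c \<in> A \<and> d \<in> A \<and> c \<noteq> d \<and> A \<inter> box c d \<subseteq> {c, d}"
    and ab: "a \<in> A" "b \<in> A" "a \<noteq> b" "A \<inter> box a b \<subseteq> {a, b}"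
    and dis: "distinct (map (\<lambda>(a, b). {a, b}) Q)" "{a, b} \<notin> (\<lambda>(a, b). {a, b}) ` set Q"
    and cover: "\<And>z. z \<in> uncovered S \<Longrightarrow> z \<in> A \<or> z \<in> box a b \<or> (\<exists>(a, b)\<in>set Q. z \<in> box a b)"
    using inv by (auto simp: da_inv_def)
  have abS: "a \<in> S" "b \<in> S" using ab AS by auto
  have "dot (weight a b) a = dot (weight a b) b" using dot_weight_eq chain ab by blast
  then have lt: "dot (weight a b) y < dot (weight a b) a"
    using y abS by (force simp: in_segment_def optimal_def)
  have sf: "y \<in> box a b" "y \<noteq> a" "y \<noteq> b" "a \<notin> box y b" "b \<notin> box y a" "box y a \<subseteq> box a b" "box y b \<subseteq> box a b"
    "\<And>z. z \<in> uncovered S \<Longrightarrow> z \<in> box a b \<Longrightarrow> z \<in> box y a \<or> z \<in> box y b"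
    "potential S y a + potential S y b + 1 \<le> potential S a b"
    using split_facts[OF fin chain[OF ab(1,2)] supA[OF ab(1)] supA[OF ab(2)] abS y(1) lt] by blast+
  show yA: "y \<notin> A" using sf ab by blast
  show "queue_potential S (Q @ [(y, a), (y, b)]) + 1 \<le> queue_potential S ((a, b) # Q)"
    using sf(9) by (simp add: queue_potential_def)
  have wab: "\<And>c. c \<in> A \<Longrightarrow> c \<noteq> a \<Longrightarrow> c \<noteq> b \<Longrightarrow> c \<notin> box a b" using ab by blast
  \<comment> \<open>A point of \<open>A\<close> other than \<open>a\<close> and \<open>b\<close> is
    comparable to both but not between them, so it precedes both or follows both, and
    \<open>y\<close> with them.\<close>
  have comp: "precedes c y \<or> precedes y c" if c: "c \<in> A" for c
    using chain[OF c ab(1)] chain[OF c ab(2)] wab[OF c] sf(1) precedes_trans unfolding box_def by blast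
  have supy: "supported S y"
  proof -
    have "weight a b \<noteq> (0, 0)" using ab(3) by (auto simp: weight_def prod_eq_iff)
    then show ?thesis unfolding supported_def using y(1)
      by (intro exI[of _ "weight a b"]) (auto simp: weight_def)
  qed
  have other: "y \<notin> box c d" if cd: "(c, d) \<in> set Q" for c d
  proof
    assume y': "y \<in> box c d"
    have cA: "c \<in> A" "d \<in> A" "c \<noteq> d" and wcd: "\<And>e. e \<in> A \<Longrightarrow> e \<noteq> c \<Longrightarrow> e \<noteq> d \<Longrightarrow> e \<notin> box c d"
      using Q[OF cd] by auto
    \<comment> \<open>Orient both pairs around \<open>y\<close>. Since neither box holds further
      points of \<open>A\<close>, the upper neighbours of \<open>y\<close> agree and so do the lower
      ones; the pairs coincide as sets, which distinctness of the queue forbids.\<close>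
    have or: "\<exists>c d. precedes c y \<and> precedes y d \<and> {c, d} = {a, b} \<and> c \<noteq> d" if "y \<in> box a b" "a \<noteq> b" for a b
      using that unfolding box_def by blast
    obtain a' b' where a': "precedes a' y" "precedes y b'" "{a', b'} = {a, b}" using or[OF sf(1) ab(3)] by blast
    obtain c' d' where c': "precedes c' y" "precedes y d'" "{c', d'} = {c, d}" using or[OF y' cA(3)] by blast
    have A: "a' \<in> A" "b' \<in> A" "c' \<in> A" "d' \<in> A" using a'(3) c'(3) ab(1,2) cA(1,2) by (auto simp: doubleton_eq_iff)
    have bx: "box a' b' = box a b" "box c' d' = box c d"
      using a'(3) c'(3) by (auto simp: doubleton_eq_iff box_commute)
    have pa: "precedes a' b'" "precedes c' d'" using a' c' precedes_trans by blast+
    have wa: "e = a' \<or> e = b'" if "e \<in> A" "precedes a' e" "precedes e b'" for e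
      using wab[OF that(1)] that a'(3) unfolding bx(1)[symmetric] box_precedes[OF pa(1)] by blast
    have wc: "e = c' \<or> e = d'" if "e \<in> A" "precedes c' e" "precedes e d'" for e
      using wcd[OF that(1)] that c'(3) unfolding bx(2)[symmetric] box_precedes[OF pa(2)] by blast
    have ny: "a' \<noteq> y" "b' \<noteq> y" "c' \<noteq> y" "d' \<noteq> y" using A yA by auto
    have "a' = c'"
    proof (cases "precedes a' c'")
      case True
      then show ?thesis using wa[OF A(3)] precedes_trans[OF c'(1) a'(2)] precedes_antisym a' c' ny by blast
    next
      case False
      then have "precedes c' a'" using chain A by blast
      then show ?thesis using wc[OF A(1)] precedes_trans[OF a'(1) c'(2)] precedes_antisym a' c' ny by blast
    qed
    moreover have "b' = d'"
    proof (cases "precedes d' b'")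
      case True
      then show ?thesis using wa[OF A(4)] precedes_trans[OF a'(1) c'(2)] precedes_antisym a' c' ny by blast
    next
      case False
      then have "precedes b' d'" using chain A by blast
      then show ?thesis using wc[OF A(2)] precedes_trans[OF c'(1) a'(2)] precedes_antisym a' c' ny by blast
    qed
    ultimately have "{a, b} = {c, d}" using a' c' by simp
    then show False using dis(2) cd by force
  qed
  have yab: "{y, a} \<noteq> {y, b}" using ab(3) sf(2,3) by (auto simp: doubleton_eq_iff)
  have newQ: "{y, e} \<notin> (\<lambda>(a, b). {a, b}) ` set Q" for e
    using Q yA by (auto simp: doubleton_eq_iff)
  have dis': "distinct (map (\<lambda>(a, b). {a, b}) (Q @ [(y, a), (y, b)]))"
    using dis(1) newQ yab by simp
  have boxA: "insert y A \<inter> box y a \<subseteq> {y, a}" "insert y A \<inter> box y b \<subseteq> {y, b}"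
    using sf(4-7) ab(4) by blast+
  have cover': "z \<in> insert y A \<or> (\<exists>(a, b)\<in>set (Q @ [(y, a), (y, b)]). z \<in> box a b)" if "z \<in> uncovered S" for z
    using cover[OF that] sf(8)[OF that] by auto
  have pairs: "c \<in> insert y A \<and> d \<in> insert y A \<and> c \<noteq> d \<and> insert y A \<inter> box c d \<subseteq> {c, d}"
    if "(c, d) \<in> set (Q @ [(y, a), (y, b)])" for c d
    using that boxA ab sf(2,3) Q[of c d] other[of c d] by auto
  show "da_inv S (insert y A) (Q @ [(y, a), (y, b)])"
    unfolding da_inv_def
  proof (intro conjI)
    show "insert y A \<subseteq> S" using AS y by (simp add: optimal_def)
    show "\<forall>a\<in>insert y A. supported S a" using supy supA by blast
    show "\<forall>a\<in>insert y A. \<forall>b\<in>insert y A. precedes a b \<or> precedes b a" using chain comp precedes_refl by blast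
    show "\<forall>(c, d)\<in>set (Q @ [(y, a), (y, b)]). c \<in> insert y A \<and> d \<in> insert y A \<and> c \<noteq> d \<and> insert y A \<inter> box c d \<subseteq> {c, d}"
      using pairs by blast
  qed (use dis' cover' in blast)+
qed

lemma queue_potential_neglect: "queue_potential S Q + 1 \<le> queue_potential S ((a, b) # Q)"
  by (simp add: queue_potential_def potential_def)

text \<open>For k > 0 points below the line the value is 4k - 1; the bound must also cover k = 0,
  where the truncated term vanishes and 1 remains.\<close>

lemma queue_potential_single: "finite S \<Longrightarrow> queue_potential S [(a, b)] \<le> 4 * card (uncovered S) + 1"
proof -
  assume "finite S"
  then have "card (below S a b) \<le> card (uncovered S)"
    by (intro card_mono) (auto simp: below_def uncovered_def)
  then show ?thesis by (simp add: queue_potential_def potential_def)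
qed

lemma length_le_queue_potential: "length Q \<le> queue_potential S Q"
  by (induction Q) (auto simp: queue_potential_def potential_def)

lemma da_inv_finish:
  assumes "finite S" "da_inv S A []"
  shows "uncovered A = uncovered S" "finite A"
proof -
  have "A \<subseteq> S" "uncovered S \<subseteq> A" using assms(2) unfolding da_inv_def by auto
  then show "uncovered A = uncovered S" "finite A"
    using assms(1) uncovered_subset_eq finite_subset by metis+
qed

section \<open>Termination and correctness of the transition system\<close>

fun da_ok :: "point set \<Rightarrow> da_state \<Rightarrow> bool" where
  "da_ok S Start \<longleftrightarrow> True"
| "da_ok S (Loop Q A) \<longleftrightarrow> da_inv S A Q"
| "da_ok S (Done Y) \<longleftrightarrow> Y = uncovered S"

text \<open>The value of \<open>Start\<close> exceeds the largest value 4k + 2 of the first loop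
  state; the unit added for \<open>Loop\<close> makes the final clean-up decrease the measure
  too.\<close>

fun da_measure :: "point set \<Rightarrow> da_state \<Rightarrow> nat" where
  "da_measure S Start = 4 * card (uncovered S) + 3"
| "da_measure S (Loop Q A) = queue_potential S Q + 1"
| "da_measure S (Done Y) = 0"

lemma da_step_ok:
  assumes step: "da_step I s s'" and fin: "finite (image_pts I)" and aexp_ok: "da_ok (image_pts I) s"
  shows "da_ok (image_pts I) s' \<and> da_measure (image_pts I) s' < da_measure (image_pts I) s"
  using step aexp_ok
proof cases
  case infeasible
  then show ?thesis by (simp add: uncovered_def)
next
  case (ideal y0 y1)
  then show ?thesis using uncovered_ideal[of "image_pts I" y0] by (simp add: ws_optimal_pt_iff)
next
  case (init y0 y1)
  then show ?thesis using da_inv_init[of "image_pts I" y0 y1] queue_potential_single[OF fin, of y0 y1]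
    by (simp add: ws_optimal_pt_iff)
next
  case (neglect y2 y3 y Q A)
  then show ?thesis using da_inv_neglect[of "image_pts I" A y2 y3 Q y] queue_potential_neglect[of "image_pts I" Q y2 y3] aexp_ok
    by (simp add: ws_optimal_pt_iff)
next
  case (split y2 y3 y Q A)
  then show ?thesis using da_inv_split[OF fin, of A y2 y3 Q y] aexp_ok
    by (simp add: ws_optimal_pt_iff)
next
  case (finish A)
  then show ?thesis using da_inv_finish[OF fin, of A] aexp_ok clean_up_uncovered[of A] by simp
qed

lemma optimal_exists:
  assumes "finite S" "S \<noteq> {}"
  shows "\<exists>y. optimal S l y"
proof -
  have "Min (dot l ` S) \<in> dot l ` S" using assms by simp
  then obtain y where "y \<in> S" "dot l y = Min (dot l ` S)" by (metis imageE)
  then show ?thesis using assms unfolding optimal_def by (intro exI[of _ y]) simp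
qed

lemma da_reachable_ok:
  assumes "(da_step I)\<^sup>*\<^sup>* Start s" "finite (image_pts I)"
  shows "da_ok (image_pts I) s"
  using assms(1)
proof induction
  case (step s s')
  then show ?case using da_step_ok assms(2) by blast
qed simp

lemma da_correct:
  assumes I: "boco_instance I"
  shows "da_terminates I" "da_output I Y \<Longrightarrow> real_pt ` Y = nd_extreme I"
proof -
  have fin: "finite (image_pts I)" using finite_sols[OF I] by simp
  show "real_pt ` Y = nd_extreme I" if "da_output I Y"
    using da_reachable_ok[OF that[unfolded da_output_def] fin] nd_extreme_eq[OF I] by simp
  have noinf: "\<nexists>f :: nat \<Rightarrow> da_state. f 0 = Start \<and> (\<forall>i. da_step I (f i) (f (Suc i)))"
  proof
    assume "\<exists>f :: nat \<Rightarrow> da_state. f 0 = Start \<and> (\<forall>i. da_step I (f i) (f (Suc i)))"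
    then obtain f where f: "f 0 = Start" "\<And>i. da_step I (f i) (f (Suc i))" by blast
    have aexp_ok: "da_ok (image_pts I) (f i)" for i
      by (induction i) (use f da_step_ok[OF _ fin] in auto)
    have "da_measure (image_pts I) (f i) + i \<le> da_measure (image_pts I) (f 0)" for i
    proof (induction i)
      case (Suc i)
      then show ?case using da_step_ok[OF f(2) fin aexp_ok, of i] by simp
    qed simp
    from this[of "Suc (da_measure (image_pts I) (f 0))"] show False by simp
  qed
  have "\<exists>Y. s = Done Y" if s: "(da_step I)\<^sup>*\<^sup>* Start s" "\<nexists>s'. da_step I s s'" for s
  proof (cases s)
    case Start
    have "image_pts I \<noteq> {}" using s(2) da_step.infeasible[of I] Start by blast
    then obtain y0 y1 where "optimal (image_pts I) (1, 0) y0" "optimal (image_pts I) (0, 1) y1" using optimal_exists[OF fin] by meson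
    then show ?thesis using s(2) Start da_step.ideal[of I y0 y1] da_step.init[of I y0 y1]
      by (cases "y0 = y1") (auto simp: ws_optimal_pt_iff)
  next
    case (Loop Q A)
    show ?thesis
    proof (cases Q)
      case Nil
      then show ?thesis using s(2) Loop da_step.finish by blast
    next
      case (Cons ab Q')
      obtain a b where ab: "ab = (a, b)" by (cases ab)
      have "da_inv (image_pts I) A Q" using da_reachable_ok[OF s(1) fin] Loop by simp
      \<comment> \<open>A queued pair consists of image points, so the instance is feasible and
        every scalarization has an optimum.\<close>
      then have "image_pts I \<noteq> {}" using Cons ab by (auto simp: da_inv_def)
      then obtain y where "ws_optimal_pt I (weight a b) y"
        using optimal_exists[OF fin] ws_optimal_pt_iff by blast
      then show ?thesis using s(2) Loop Cons ab da_step.neglect[of I a b y Q' A] da_step.split[of I a b y Q' A] by blast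
    qed
  qed simp
  with noinf show "da_terminates I" by (auto simp: da_terminates_def)
qed

section \<open>Structural time bounds and symbolic execution\<close>

lemma asafe_mono: "asafe w inp m e \<Longrightarrow> w \<le> w' \<Longrightarrow> asafe w' inp m e"
proof (induction e)
qed (auto intro: less_le_trans[OF _ power_increasing])

lemma bsafe_mono: "bsafe w inp m b \<Longrightarrow> w \<le> w' \<Longrightarrow> bsafe w' inp m b"
  by (induction b) (auto intro: asafe_mono)

text \<open>The cell size granted to the solver depends on the weights; this lets all calls share
  the one larger size of the caller.\<close>

lemma exec_mono: "exec w inp c s t s' \<Longrightarrow> w \<le> w' \<Longrightarrow> exec w' inp c s t s'"
  by (induction rule: exec.induct) (blast intro: exec.intros asafe_mono bsafe_mono)+

lemma poly_nat_mono: "x \<le> y \<Longrightarrow> poly p x \<le> poly p (y::nat)"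
  by (induction p) (auto intro: add_mono mult_mono)

text \<open>Every loop is charged L iterations and every call C steps, so that the bound is a
  polynomial whenever L and C are.\<close>

fun time_bound :: "nat \<Rightarrow> nat \<Rightarrow> com \<Rightarrow> nat" where
  "time_bound L C SKIP = 1"
| "time_bound L C (Assign x i e) = 1 + acost i + acost e"
| "time_bound L C (Write e) = 1 + acost e"
| "time_bound L C (c ;; d) = time_bound L C c + time_bound L C d"
| "time_bound L C (IF b THEN c ELSE d) = 1 + bcost b + (time_bound L C c + time_bound L C d)"
| "time_bound L C (WHILE b DO c) = 1 + bcost b + L * (1 + bcost b + time_bound L C c)"
| "time_bound L C (Call c x e r) = C"

lemma time_bound_poly: "\<exists>p :: nat poly. \<forall>S. time_bound (poly pL S) (poly pC S) c = poly p S"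
proof (induction c)
  case SKIP
  show ?case by (rule exI[of _ "[:1:]"]) simp
next
  case (Assign x i e)
  show ?case by (rule exI[of _ "[:1 + acost i + acost e:]"]) simp
next
  case (Write e)
  show ?case by (rule exI[of _ "[:1 + acost e:]"]) simp
next
  case (Seq c d)
  then obtain p q where "\<forall>S. time_bound (poly pL S) (poly pC S) c = poly p S" "\<forall>S. time_bound (poly pL S) (poly pC S) d = poly q S"
    by blast
  then show ?case by (intro exI[of _ "p + q"]) simp
next
  case (If b c d)
  then obtain p q where "\<forall>S. time_bound (poly pL S) (poly pC S) c = poly p S" "\<forall>S. time_bound (poly pL S) (poly pC S) d = poly q S"
    by blast
  then show ?case by (intro exI[of _ "[:1 + bcost b:] + (p + q)"]) simp
next
  case (While b c)
  then obtain p where "\<forall>S. time_bound (poly pL S) (poly pC S) c = poly p S" by blast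
  then show ?case by (intro exI[of _ "[:1 + bcost b:] + pL * ([:1 + bcost b:] + p)"]) simp
next
  case (Call c x e r)
  show ?case by (rule exI[of _ pC]) simp
qed

lemma pow_add_bound:
  fixes x y :: int
  assumes "\<bar>x\<bar> < 2 ^ a" "\<bar>y\<bar> < 2 ^ b"
  shows "\<bar>x\<bar> + \<bar>y\<bar> < 2 ^ Suc (a + b)"
proof -
  have "(2::int) ^ a \<le> 2 ^ (a + b)" "(2::int) ^ b \<le> 2 ^ (a + b)" by (intro power_increasing; simp)+
  with assms show ?thesis unfolding power_Suc by linarith
qed

lemma abs_div_le: "\<bar>(x::int) div y\<bar> \<le> \<bar>x\<bar>"
proof -
  have pos: "\<bar>x div y\<bar> \<le> \<bar>x\<bar>" if "0 < y" for x y :: int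
  proof (cases "0 \<le> x")
    case True
    then show ?thesis using zdiv_mono2[of x 1 y] that by (simp add: pos_imp_zdiv_nonneg_iff)
  next
    case False
    then show ?thesis using zdiv_mono2_neg[of x 1 y] that pos_imp_zdiv_neg_iff[of y x] by simp
  qed
  consider "0 < y" | "y = 0" | "0 < - y" by linarith
  then show ?thesis
  proof cases
    case 3
    then show ?thesis using pos[of "- y" "- x"] by simp
  qed (use pos in auto)
qed

text \<open>Cells hold \<open>K\<close> bits, intermediate values \<open>w\<close> bits. The widest
  expressions of the program, the cross-multiplied comparisons in \<open>redundant\<close>, take
  \<open>12 * K + 2\<close> bits, within \<open>20 * K\<close>. With \<open>4 <= K\<close>,
  constants below 16 count as \<open>K\<close>-bit values.\<close>

locale ram =
  fixes w K L C :: nat and inp :: "int list"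
  assumes K: "4 \<le> K" and w: "20 * K \<le> w"
begin

definition bounded_mem :: "mem \<Rightarrow> bool" where
  "bounded_mem m \<longleftrightarrow> (\<forall>x i. \<bar>m x i\<bar> < 2 ^ K)"

text \<open>All cells, and all input cells that are read, have at most K bits; \<open>ebits\<close> bounds the bits
  of an expression over them. Small constants are charged K bits as well.\<close>

fun ebits :: "aexp \<Rightarrow> nat" where
  "ebits (N k) = K"
| "ebits (Arr x e) = K"
| "ebits (In e) = K"
| "ebits InLen = K"
| "ebits (Add e f) = ebits e + ebits f + 1"
| "ebits (Sub e f) = ebits e + ebits f + 1"
| "ebits (Mul e f) = ebits e + ebits f"
| "ebits (Div e f) = ebits e + ebits f"

fun aexp_ok :: "mem \<Rightarrow> aexp \<Rightarrow> bool" where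
  "aexp_ok m (N k) \<longleftrightarrow> \<bar>k\<bar> < 16"
| "aexp_ok m (Arr x e) \<longleftrightarrow> aexp_ok m e \<and> ebits e \<le> w \<and> 0 \<le> aval inp m e"
| "aexp_ok m (In e) \<longleftrightarrow> aexp_ok m e \<and> ebits e \<le> w \<and> 0 \<le> aval inp m e \<and> aval inp m e < int (length inp) \<and>
     \<bar>aval inp m (In e)\<bar> < 2 ^ K"
| "aexp_ok m InLen \<longleftrightarrow> False"
| "aexp_ok m (Add e f) \<longleftrightarrow> aexp_ok m e \<and> aexp_ok m f"
| "aexp_ok m (Sub e f) \<longleftrightarrow> aexp_ok m e \<and> aexp_ok m f"
| "aexp_ok m (Mul e f) \<longleftrightarrow> aexp_ok m e \<and> aexp_ok m f"
| "aexp_ok m (Div e f) \<longleftrightarrow> aexp_ok m e \<and> aexp_ok m f"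

fun bexp_ok :: "mem \<Rightarrow> bexp \<Rightarrow> bool" where
  "bexp_ok m (Eq e f) \<longleftrightarrow> aexp_ok m e \<and> ebits e \<le> w \<and> aexp_ok m f \<and> ebits f \<le> w"
| "bexp_ok m (Less e f) \<longleftrightarrow> aexp_ok m e \<and> ebits e \<le> w \<and> aexp_ok m f \<and> ebits f \<le> w"
| "bexp_ok m (Not b) \<longleftrightarrow> bexp_ok m b"
| "bexp_ok m (And b c) \<longleftrightarrow> bexp_ok m b \<and> bexp_ok m c"
| "bexp_ok m (Or b c) \<longleftrightarrow> bexp_ok m b \<and> bexp_ok m c"

lemma K16: "\<bar>k\<bar> < 16 \<Longrightarrow> \<bar>k::int\<bar> < 2 ^ K"
proof -
  assume "\<bar>k\<bar> < 16"
  moreover have "(2::int) ^ 4 \<le> 2 ^ K" using K by (rule power_increasing) simp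
  ultimately show ?thesis by simp
qed

lemma ok_bound: "bounded_mem m \<Longrightarrow> aexp_ok m e \<Longrightarrow> \<bar>aval inp m e\<bar> < 2 ^ ebits e"
proof (induction e)
  case (Add e f)
  then show ?case using pow_add_bound[of "aval inp m e" "ebits e" "aval inp m f" "ebits f"]
      abs_triangle_ineq[of "aval inp m e" "aval inp m f"] by simp
next
  case (Sub e f)
  then show ?case using pow_add_bound[of "aval inp m e" "ebits e" "aval inp m f" "ebits f"]
      abs_triangle_ineq4[of "aval inp m e" "aval inp m f"] by simp
next
  case (Mul e f)
  then show ?case by (simp add: abs_mult power_add mult_strict_mono)
next
  case (Div e f)
  have "(2::int) ^ ebits e \<le> 2 ^ (ebits e + ebits f)" by (intro power_increasing) auto
  moreover have "\<bar>aval inp m e\<bar> < 2 ^ ebits e" using Div by simp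
  ultimately show ?case using abs_div_le[of "aval inp m e" "aval inp m f"]
    unfolding aval.simps ebits.simps by linarith
qed (auto simp: bounded_mem_def K16)

lemma ok_safe: "bounded_mem m \<Longrightarrow> aexp_ok m e \<Longrightarrow> ebits e \<le> w \<Longrightarrow> asafe w inp m e"
proof (induction e)
  case (Add e f)
  then show ?case using less_le_trans[OF ok_bound[OF Add.prems(1,2)] power_increasing[OF Add.prems(3)]] by simp
next
  case (Sub e f)
  then show ?case using less_le_trans[OF ok_bound[OF Sub.prems(1,2)] power_increasing[OF Sub.prems(3)]] by simp
next
  case (Mul e f)
  then show ?case using less_le_trans[OF ok_bound[OF Mul.prems(1,2)] power_increasing[OF Mul.prems(3)]] by simp
next
  case (Div e f)
  then show ?case using less_le_trans[OF ok_bound[OF Div.prems(1,2)] power_increasing[OF Div.prems(3)]] by simp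
next
  case (N k)
  then show ?case using less_le_trans[OF ok_bound[OF N.prems(1,2)] power_increasing[OF N.prems(3)]] by simp
next
  case (Arr x e)
  then show ?case using less_le_trans[OF ok_bound[OF Arr.prems(1,2)] power_increasing[OF Arr.prems(3)]] by simp
next
  case (In e)
  then show ?case using less_le_trans[OF ok_bound[OF In.prems(1,2)] power_increasing[OF In.prems(3)]] by simp
qed simp

lemma bok_safe: "bounded_mem m \<Longrightarrow> bexp_ok m b \<Longrightarrow> bsafe w inp m b"
  by (induction b) (auto intro: ok_safe)

text \<open>A weakest precondition for total correctness that also carries the time bound and the
  cell bound. A sequence is handled by making the second part the postcondition of the
  first.\<close>

definition runs_to :: "com \<Rightarrow> mem \<times> int list \<Rightarrow> (mem \<times> int list \<Rightarrow> bool) \<Rightarrow> bool" where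
  "runs_to c s Q \<longleftrightarrow> (\<exists>t s'. exec w inp c s t s' \<and> t \<le> time_bound L C c \<and> bounded_mem (fst s') \<and> Q s')"

lemma runs_to_post: "runs_to c s Q \<Longrightarrow> (\<And>s'. bounded_mem (fst s') \<Longrightarrow> Q s' \<Longrightarrow> R s') \<Longrightarrow> runs_to c s R"
  unfolding runs_to_def by blast

lemma runs_to_seq: "runs_to c s (\<lambda>s'. runs_to d s' Q) \<Longrightarrow> runs_to (c ;; d) s Q"
  unfolding runs_to_def by (fastforce intro: exec.Seq add_mono)

lemma runs_to_if:
  assumes "bounded_mem (fst s)" "bexp_ok (fst s) b"
    "bval inp (fst s) b \<Longrightarrow> runs_to c s Q" "\<not> bval inp (fst s) b \<Longrightarrow> runs_to d s Q"
  shows "runs_to (IF b THEN c ELSE d) s Q"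
proof (cases "bval inp (fst s) b")
  case True
  then obtain t s' where "exec w inp c s t s'" "t \<le> time_bound L C c" "bounded_mem (fst s')" "Q s'"
    using assms(3) by (auto simp: runs_to_def)
  then show ?thesis unfolding runs_to_def using exec.IfTrue[of w inp s b c t s' d] True bok_safe assms(1,2)
    by (intro exI[of _ "1 + bcost b + t"] exI[of _ s']) auto
next
  case False
  then obtain t s' where "exec w inp d s t s'" "t \<le> time_bound L C d" "bounded_mem (fst s')" "Q s'"
    using assms(4) by (auto simp: runs_to_def)
  then show ?thesis unfolding runs_to_def using exec.IfFalse[of w inp s b d t s' c] False bok_safe assms(1,2)
    by (intro exI[of _ "1 + bcost b + t"] exI[of _ s']) auto
qed

text \<open>The index of the invariant bounds the remaining iterations. The induction charges
  exactly this index, and only then is it weakened to \<open>L\<close>.\<close>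

lemma runs_to_while:
  assumes "I n s" "n \<le> L" "bounded_mem (fst s)"
    and bexp_ok: "\<And>n s. I n s \<Longrightarrow> bounded_mem (fst s) \<Longrightarrow> bexp_ok (fst s) b"
    and step: "\<And>n s. I n s \<Longrightarrow> bounded_mem (fst s) \<Longrightarrow> bval inp (fst s) b \<Longrightarrow> 0 < n \<and> runs_to c s (I (n - 1))"
    and post: "\<And>n s. I n s \<Longrightarrow> bounded_mem (fst s) \<Longrightarrow> \<not> bval inp (fst s) b \<Longrightarrow> Q s"
  shows "runs_to (WHILE b DO c) s Q"
proof -
  have "\<exists>t s'. exec w inp (WHILE b DO c) s t s' \<and> t \<le> 1 + bcost b + n * (1 + bcost b + time_bound L C c) \<and>
      bounded_mem (fst s') \<and> Q s'"
    using assms(1,3)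
  proof (induction n arbitrary: s)
    case (Suc n)
    show ?case
    proof (cases "bval inp (fst s) b")
      case True
      obtain t s' where c: "exec w inp c s t s'" "t \<le> time_bound L C c" "bounded_mem (fst s')" "I n s'"
        using step[OF Suc.prems True] by (auto simp: runs_to_def)
      obtain t' s'' where d: "exec w inp (WHILE b DO c) s' t' s''"
        "t' \<le> 1 + bcost b + n * (1 + bcost b + time_bound L C c)" "bounded_mem (fst s'')" "Q s''"
        using Suc.IH[OF c(4,3)] by blast
      have "exec w inp (WHILE b DO c) s (1 + bcost b + t + t') s''"
        using exec.WhileTrue[OF bok_safe[OF Suc.prems(2) bexp_ok[OF Suc.prems]] True c(1) d(1)] .
      moreover have "1 + bcost b + t + t' \<le> 1 + bcost b + Suc n * (1 + bcost b + time_bound L C c)"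
        using c(2) d(2) by simp
      ultimately show ?thesis using d by blast
    next
      case False
      then show ?thesis using exec.WhileFalse[OF bok_safe[OF Suc.prems(2) bexp_ok[OF Suc.prems]] False]
        post[OF Suc.prems False] Suc.prems by (intro exI[of _ "1 + bcost b"] exI[of _ s]) auto
    qed
  next
    case 0
    then have "\<not> bval inp (fst s) b" using step by blast
    then show ?case using exec.WhileFalse[OF bok_safe[OF 0(2) bexp_ok[OF 0]]]
        post[OF 0] 0 by (intro exI[of _ "1 + bcost b"] exI[of _ s]) auto
  qed
  moreover have "n * (1 + bcost b + time_bound L C c) \<le> L * (1 + bcost b + time_bound L C c)"
    using \<open>n \<le> L\<close> by (rule mult_le_mono1)
  ultimately show ?thesis unfolding runs_to_def by fastforce
qed

text \<open>Rewriting evaluates straight-line code completely, while loops and calls are handed over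
  to \<open>runs_to\<close>. The bound in the clause for assignments is where values of up to
  \<open>w\<close> bits must return to \<open>K\<close> bits.\<close>

fun sym_exec :: "com \<Rightarrow> (mem \<times> int list \<Rightarrow> bool) \<Rightarrow> mem \<times> int list \<Rightarrow> bool" where
  "sym_exec (Assign x i e) Q (m, out) \<longleftrightarrow> aexp_ok m i \<and> ebits i \<le> w \<and> 0 \<le> aval inp m i \<and> aexp_ok m e \<and> ebits e \<le> w \<and>
     \<bar>aval inp m e\<bar> < 2 ^ K \<and>
     Q (m(x := (m x)(nat (aval inp m i) := aval inp m e)), out)"
| "sym_exec (c ;; d) Q s \<longleftrightarrow> sym_exec c (sym_exec d Q) s"
| "sym_exec SKIP Q s \<longleftrightarrow> Q s"
| "sym_exec (Write e) Q (m, out) \<longleftrightarrow> aexp_ok m e \<and> ebits e \<le> w \<and> Q (m, out @ [aval inp m e])"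
| "sym_exec (IF b THEN c ELSE d) Q (m, out) \<longleftrightarrow> bexp_ok m b \<and> (if bval inp m b then sym_exec c Q (m, out) else sym_exec d Q (m, out))"
| "sym_exec (WHILE b DO c) Q s \<longleftrightarrow> (bounded_mem (fst s) \<longrightarrow> runs_to (WHILE b DO c) s Q)"
| "sym_exec (Call c x e r) Q s \<longleftrightarrow> (bounded_mem (fst s) \<longrightarrow> runs_to (Call c x e r) s Q)"

lemma sym_exec_runs_to: "bounded_mem (fst s) \<Longrightarrow> sym_exec c Q s \<Longrightarrow> runs_to c s Q"
proof (induction c arbitrary: s Q)
  case (Assign x i e)
  obtain m out where s: "s = (m, out)" by (cases s)
  define m' where "m' = m(x := (m x)(nat (aval inp m i) := aval inp m e))"
  have "bounded_mem m'" using Assign s by (auto simp: bounded_mem_def m'_def)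
  moreover have "exec w inp (Assign x i e) s (1 + acost i + acost e) (m', out)"
    unfolding s m'_def using Assign s by (intro exec.Assign ok_safe) auto
  ultimately show ?case using Assign s unfolding runs_to_def
    by (intro exI[of _ "1 + acost i + acost e"] exI[of _ "(m', out)"]) (simp add: m'_def)
next
  case (Write e)
  obtain m out where s: "s = (m, out)" by (cases s)
  have "exec w inp (Write e) s (1 + acost e) (m, out @ [aval inp m e])"
    unfolding s using Write s by (intro exec.Write ok_safe) auto
  then show ?case using Write s unfolding runs_to_def
    by (intro exI[of _ "1 + acost e"] exI[of _ "(m, out @ [aval inp m e])"]) simp
next
  case SKIP
  then show ?case unfolding runs_to_def using exec.Skip by (intro exI[of _ 1] exI[of _ s]) simp
next
  case (Seq c d)
  have "runs_to c s (sym_exec d Q)" using Seq by simp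
  then have "runs_to c s (\<lambda>s'. runs_to d s' Q)" by (rule runs_to_post) (rule Seq.IH(2))
  then show ?case by (rule runs_to_seq)
next
  case (If b c d)
  obtain m out where s: "s = (m, out)" by (cases s)
  then show ?case using If by (intro runs_to_if) auto
qed auto

lemma sym_exec_runs_to_seq: "bounded_mem (fst s) \<Longrightarrow> runs_to c s (sym_exec d Q) \<Longrightarrow> runs_to (c ;; d) s Q"
  by (rule runs_to_seq) (erule runs_to_post, rule sym_exec_runs_to)

end

section \<open>Fractions in lowest terms\<close>

definition num :: "rat \<Rightarrow> int" where "num r = fst (quotient_of r)"
definition den :: "rat \<Rightarrow> int" where "den r = snd (quotient_of r)"

lemma den_pos [simp]: "0 < den r"
  by (simp add: den_def quotient_of_denom_pos')

lemma num_den [simp]: "of_int (num r) / of_int (den r) = r"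
  using quotient_of_div[of r "num r" "den r"] by (simp add: num_def den_def)

lemma enc_rat_eq: "enc_rat r = [num r, den r]"
  by (simp add: enc_rat_def num_def den_def split: prod.split)

lemma rat_size_eq: "rat_size r = int_size (num r) + int_size (den r)"
  by (simp add: rat_size_def num_def den_def split: prod.split)

lemma num_den_quotient:
  assumes "0 < q"
  shows "num (of_int p / of_int q) = p div gcd p q" "den (of_int p / of_int q) = q div gcd p q"
  using assms by (simp_all add: num_def den_def Fract_of_int_quotient[symmetric] quotient_of_Fract Rat.normalize_def Let_def)

lemma num_den_quotient_le:
  assumes "0 < q"
  shows "\<bar>num (of_int p / of_int q)\<bar> \<le> \<bar>p\<bar>" "den (of_int p / of_int q) \<le> q"
  unfolding num_den_quotient[OF assms] using abs_div_le[of p "gcd p q"] abs_div_le[of q "gcd p q"] assms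
  by auto

lemma abs_less_bitlen: "\<bar>z\<bar> < 2 ^ nat (bitlen \<bar>z\<bar>)"
proof (cases "z = 0")
  case False
  then show ?thesis using bitlen_bounds[of "\<bar>z\<bar>"] by simp
qed (simp add: bitlen_def)

lemma abs_less_int_size: "2 * \<bar>z\<bar> < 2 ^ int_size z"
  using abs_less_bitlen[of z] by (simp add: int_size_def)

lemma int_size_le: "\<bar>z\<bar> < 2 ^ k \<Longrightarrow> int_size z \<le> 1 + k"
proof (cases "z = 0")
  case False
  assume "\<bar>z\<bar> < 2 ^ k"
  then have "bitlen \<bar>z\<bar> \<le> int k" using False bitlen_le_iff_power[of "\<bar>z\<bar>" k] by simp
  then show ?thesis by (simp add: int_size_def)
qed (simp add: int_size_def bitlen_def floorlog_def)

text \<open>The sign bit counted by \<open>int_size\<close> leaves a factor 2, which pays for adding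
  numerator and denominator.\<close>

lemma num_den_size: "\<bar>num r\<bar> + den r \<le> 2 ^ rat_size r"
proof -
  have "2 * \<bar>num r\<bar> < 2 ^ int_size (num r)" "2 * \<bar>den r\<bar> < 2 ^ int_size (den r)"
    by (rule abs_less_int_size)+
  moreover have "(2::int) ^ int_size (num r) \<le> 2 ^ rat_size r" "(2::int) ^ int_size (den r) \<le> 2 ^ rat_size r"
    by (intro power_increasing; simp add: rat_size_eq)+
  moreover have "\<bar>den r\<bar> = den r" by (simp add: less_imp_le)
  ultimately show ?thesis by linarith
qed

lemma rat_size_le: "\<bar>num r\<bar> < 2 ^ k \<Longrightarrow> \<bar>den r\<bar> < 2 ^ k \<Longrightarrow> rat_size r \<le> 2 + 2 * k"
  using int_size_le[of "num r" k] int_size_le[of "den r" k] by (simp add: rat_size_eq)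

lemma concat_pairs:
  "length (concat (map (\<lambda>j. [a j, b j]) [0..<n])) = 2 * n"
  "j < n \<Longrightarrow> concat (map (\<lambda>j. [a j, b j]) [0..<n]) ! (2 * j) = a j"
  "j < n \<Longrightarrow> concat (map (\<lambda>j. [a j, b j]) [0..<n]) ! Suc (2 * j) = b j"
proof -
  show len: "length (concat (map (\<lambda>j. [a j, b j]) [0..<n])) = 2 * n" for n by (induction n) auto
  show "j < n \<Longrightarrow> concat (map (\<lambda>j. [a j, b j]) [0..<n]) ! (2 * j) = a j"
    by (induction n) (auto simp: nth_append len less_Suc_eq)
  show "j < n \<Longrightarrow> concat (map (\<lambda>j. [a j, b j]) [0..<n]) ! Suc (2 * j) = b j"
    by (induction n) (auto simp: nth_append len less_Suc_eq)
qed

lemma enc_inst_nth: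
  assumes "i < 2" "j < dim I"
  shows "enc_inst I ! Suc (2 * (i * dim I + j)) = num (costs I $$ (i, j))"
    "enc_inst I ! Suc (Suc (2 * (i * dim I + j))) = den (costs I $$ (i, j))"
    "Suc (Suc (2 * (i * dim I + j))) < length (enc_inst I)"
proof -
  have i: "i = 0 \<or> i = 1" using assms by auto
  show "enc_inst I ! Suc (2 * (i * dim I + j)) = num (costs I $$ (i, j))"
    "enc_inst I ! Suc (Suc (2 * (i * dim I + j))) = den (costs I $$ (i, j))"
    "Suc (Suc (2 * (i * dim I + j))) < length (enc_inst I)"
    using i assms(2) unfolding enc_inst_def enc_rat_eq
    by (auto simp: nth_append concat_pairs)
qed

lemma enc_inst_0: "enc_inst I ! 0 = int (dim I)" "0 < length (enc_inst I)"
  by (simp_all add: enc_inst_def)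

section \<open>Memory frames and reduction by the Euclidean algorithm\<close>

definition frame :: "vname set \<Rightarrow> mem \<Rightarrow> mem \<Rightarrow> bool" where
  "frame X m m' \<longleftrightarrow> (\<forall>x. x \<notin> X \<longrightarrow> m' x = m x)"

lemma frameD: "frame X m m' \<Longrightarrow> x \<notin> X \<Longrightarrow> m' x = m x"
  by (simp add: frame_def)

lemma frame_refl: "frame X m m"
  by (simp add: frame_def)

lemma frame_trans: "frame X m m' \<Longrightarrow> frame Y m' m'' \<Longrightarrow> X \<subseteq> W \<Longrightarrow> Y \<subseteq> W \<Longrightarrow> frame W m m''"
  unfolding frame_def by (metis subsetD)

text \<open>\<open>2 * K + 1\<close> iterations suffice for the Euclidean algorithm on
  \<open>K\<close>-bit numbers: the product has at most \<open>2 * K\<close> bits, and one step may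
  go to the initial swap.\<close>

locale ram_loop = ram +
  assumes L: "2 * K + 1 \<le> L"
begin

lemma bmD [simp]: "bounded_mem m \<Longrightarrow> \<bar>m x i\<bar> < 2 ^ K"
  by (simp add: bounded_mem_def)

lemma runs_to_gcd_loop:
  assumes bm: "bounded_mem m" and nonneg: "0 \<le> m ''g'' 0" "0 \<le> m ''h'' 0"
    and post: "\<And>m'. bounded_mem m' \<Longrightarrow> frame {''g'', ''h'', ''r''} m m' \<Longrightarrow>
      m' ''g'' 0 = gcd (m ''g'' 0) (m ''h'' 0) \<Longrightarrow> Q (m', out)"
  shows "runs_to (WHILE Not (Eq (V ''h'') (N 0)) DO (
       ''r'' ::= Sub (V ''g'') (Mul (Div (V ''g'') (V ''h'')) (V ''h'')) ;;
       ''g'' ::= V ''h'' ;;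
       ''h'' ::= V ''r'')) (m, out) Q"
proof -
  \<comment> \<open>If \<open>g < h\<close>, the first step merely swaps them; from then on every step halves \<open>g * h\<close>.\<close>
  define I where "I = (\<lambda>n (s :: mem \<times> int list). snd s = out \<and> frame {''g'', ''h'', ''r''} m (fst s) \<and>
    0 \<le> fst s ''g'' 0 \<and> 0 \<le> fst s ''h'' 0 \<and> gcd (fst s ''g'' 0) (fst s ''h'' 0) = gcd (m ''g'' 0) (m ''h'' 0) \<and>
    (fst s ''h'' 0 \<le> fst s ''g'' 0 \<and> fst s ''g'' 0 * fst s ''h'' 0 < 2 ^ n \<or>
     0 < n \<and> fst s ''g'' 0 < fst s ''h'' 0 \<and> fst s ''g'' 0 * fst s ''h'' 0 < 2 ^ (n - 1)))"
  have "m ''g'' 0 * m ''h'' 0 < 2 ^ K * 2 ^ K"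
    using nonneg bmD[OF bm, of "''g''" 0] bmD[OF bm, of "''h''" 0] by (intro mult_strict_mono) auto
  then have "m ''g'' 0 * m ''h'' 0 < 2 ^ (2 * K)" by (simp add: mult_2 power_add)
  moreover from this have "m ''g'' 0 * m ''h'' 0 < 2 * 2 ^ (2 * K)"
    using zero_less_power[of "2::int" "2 * K"] by linarith
  ultimately have I0: "I (2 * K + 1) (m, out)"
    using nonneg \<open>m ''g'' 0 * m ''h'' 0 < 2 ^ (2 * K)\<close>
    by (cases "m ''h'' 0 \<le> m ''g'' 0") (simp_all add: I_def frame_refl)
  show ?thesis
  proof (rule runs_to_while[where I = I, OF I0 L])
    show "bounded_mem (fst (m, out))" using bm by simp
    show "bexp_ok (fst s) (Not (Eq (V ''h'') (N 0)))" for s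
      using w K by simp
    fix n s assume I: "I n s" and bms: "bounded_mem (fst s)"
    obtain m1 where s: "s = (m1, out)" using I by (cases s) (simp add: I_def)
    {
      assume "\<not> bval inp (fst s) (Not (Eq (V ''h'') (N 0)))"
      then have "m1 ''h'' 0 = 0" using s by simp
      then have "m1 ''g'' 0 = gcd (m ''g'' 0) (m ''h'' 0)" "frame {''g'', ''h'', ''r''} m m1"
        using I s by (auto simp: I_def)
      then show "Q s" using bms s post[of m1] by simp
    }
    assume "bval inp (fst s) (Not (Eq (V ''h'') (N 0)))"
    then have h: "0 < m1 ''h'' 0" using I s by (simp add: I_def)
    define g where "g = m1 ''g'' 0"
    define h where "h = m1 ''h'' 0"
    have gh: "0 \<le> g" "0 < h" "gcd g h = gcd (m ''g'' 0) (m ''h'' 0)"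
      "h \<le> g \<and> g * h < 2 ^ n \<or> 0 < n \<and> g < h \<and> g * h < 2 ^ (n - 1)"
      using I h by (simp_all add: I_def s g_def h_def)
    have n: "0 < n"
    proof (rule ccontr)
      assume "\<not> 0 < n"
      then have "h \<le> g" "g * h < 1" using gh by auto
      moreover have "0 < g * h" using gh \<open>h \<le> g\<close> by simp
      ultimately show False by simp
    qed
    have r: "g - g div h * h = g mod h" by (simp add: minus_div_mult_eq_mod)
    have mod: "0 \<le> g mod h" "g mod h < h" using gh by simp_all
    \<comment> \<open>For \<open>h <= g\<close> the remainder is at most half of \<open>g\<close>,
      because it is smaller than \<open>h\<close> and the rest of \<open>g\<close> is at least
      \<open>h\<close>.\<close>
    have dec: "h * (g mod h) < 2 ^ (n - 1)"
    proof (cases "h \<le> g")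
      case True
      then have "1 \<le> g div h" using gh by (simp add: pos_imp_zdiv_pos_iff int_one_le_iff_zero_less)
      then have "h \<le> g div h * h" using gh by simp
      then have "2 * (g mod h) \<le> g" using r mod by linarith
      then have "h * (2 * (g mod h)) \<le> h * g" using gh by simp
      also have "\<dots> < 2 ^ n" using gh True by (simp add: mult.commute)
      also have "\<dots> = 2 * 2 ^ (n - 1)" using n by (cases n) auto
      finally show ?thesis by simp
    next
      case False
      then show ?thesis using gh by (simp add: mult.commute)
    qed
    define m2 where "m2 = m1(''r'' := (m1 ''r'')(0 := g mod h), ''g'' := (m1 ''g'')(0 := h), ''h'' := (m1 ''h'')(0 := g mod h))"
    have "gcd h (g mod h) = gcd g h" by (metis gcd.commute gcd_red_int)
    then have I2: "I (n - 1) (m2, out)"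
      using I gh mod dec by (simp add: I_def m2_def s frame_def)
    have ghK: "\<bar>h\<bar> < 2 ^ K" "\<bar>g mod h\<bar> < 2 ^ K" using bms s mod bmD[of m1 "''h''" 0] by (simp_all add: h_def)
    have "runs_to (''r'' ::= Sub (V ''g'') (Mul (Div (V ''g'') (V ''h'')) (V ''h'')) ;;
         ''g'' ::= V ''h'' ;;  ''h'' ::= V ''r'') s (I (n - 1))"
      apply (rule sym_exec_runs_to[OF bms])
      using w K ghK I2 r
      by (simp add: s g_def[symmetric] h_def[symmetric] m2_def)
    with n show "0 < n \<and> runs_to (''r'' ::= Sub (V ''g'') (Mul (Div (V ''g'') (V ''h'')) (V ''h'')) ;;
         ''g'' ::= V ''h'' ;;  ''h'' ::= V ''r'') s (I (n - 1))" by simp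
  qed
qed

lemma runs_to_reduce_cur:
  assumes bm: "bounded_mem m" and q: "0 < m ''q'' 0"
    and post: "\<And>m'. bounded_mem m' \<Longrightarrow> frame {''p'', ''q'', ''g'', ''h'', ''r''} m m' \<Longrightarrow>
      m' ''p'' 0 = num (of_int (m ''p'' 0) / of_int (m ''q'' 0)) \<Longrightarrow>
      m' ''q'' 0 = den (of_int (m ''p'' 0) / of_int (m ''q'' 0)) \<Longrightarrow> Q (m', out)"
  shows "runs_to reduce_cur (m, out) Q"
proof -
  define p where "p = m ''p'' 0"
  define q where "q = m ''q'' 0"
  have pqK: "\<bar>p\<bar> < 2 ^ K" "\<bar>q\<bar> < 2 ^ K" using bm by (simp_all add: p_def q_def)
  define d where "d = (\<lambda>m1 :: mem. m1(''p'' := (m1 ''p'')(0 := p div gcd p q), ''q'' := (m1 ''q'')(0 := q div gcd p q)))"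
  have div: "\<bar>p div gcd p q\<bar> < 2 ^ K" "\<bar>q div gcd p q\<bar> < 2 ^ K"
    using abs_div_le[of p "gcd p q"] abs_div_le[of q "gcd p q"] pqK by linarith+
  have fin: "Q (d m1, out)" if "bounded_mem m1" "frame {''g'', ''h'', ''r''} m m1" for m1
  proof (rule post)
    show "bounded_mem (d m1)" using that(1) div by (simp add: d_def bounded_mem_def)
    show "frame {''p'', ''q'', ''g'', ''h'', ''r''} m (d m1)" using that(2) by (simp add: d_def frame_def)
  qed (use assms(2) in \<open>simp_all add: d_def num_den_quotient p_def q_def\<close>)
  have sx2: "sym_exec (''p'' ::= Div (V ''p'') (V ''g'') ;; ''q'' ::= Div (V ''q'') (V ''g'')) Q (m1, out)"
    if "bounded_mem m1" "frame {''g'', ''h'', ''r''} m m1" "m1 ''g'' 0 = gcd p q" for m1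
  proof -
    have "m1 ''p'' 0 = p" "m1 ''q'' 0 = q" using frameD[OF that(2)] by (simp_all add: p_def q_def)
    then show ?thesis using fin[OF that(1,2)] that(1,3) w K div by (simp add: d_def)
  qed
  have loop: "runs_to (WHILE Not (Eq (V ''h'') (N 0)) DO (
       ''r'' ::= Sub (V ''g'') (Mul (Div (V ''g'') (V ''h'')) (V ''h'')) ;;
       ''g'' ::= V ''h'' ;;
       ''h'' ::= V ''r'')) (m1, out) (sym_exec (''p'' ::= Div (V ''p'') (V ''g'') ;; ''q'' ::= Div (V ''q'') (V ''g'')) Q)"
    if "bounded_mem m1" "frame {''g'', ''h'', ''r''} m m1" "m1 ''g'' 0 = \<bar>p\<bar>" "m1 ''h'' 0 = q" for m1
  proof (rule runs_to_gcd_loop)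
    fix m' assume "bounded_mem m'" "frame {''g'', ''h'', ''r''} m1 m'" "m' ''g'' 0 = gcd (m1 ''g'' 0) (m1 ''h'' 0)"
    then show "sym_exec (''p'' ::= Div (V ''p'') (V ''g'') ;; ''q'' ::= Div (V ''q'') (V ''g'')) Q (m', out)"
      using that by (intro sx2) (auto intro: frame_trans)
  qed (use that assms(2) in \<open>auto simp: q_def\<close>)
  show ?thesis
    unfolding reduce_cur_def
    apply (rule sym_exec_runs_to)
    subgoal using bm by simp
    using w K bm pqK abs_less_iff[of p "2 ^ K"]
    by (simp add: p_def[symmetric] q_def[symmetric]) (intro conjI impI loop; simp add: frame_def p_def q_def)
qed

lemma runs_to_store_cur:
  assumes bm: "bounded_mem m" and q: "0 < m ''q'' 0" and x: "x \<notin> {''p'', ''q'', ''g'', ''h'', ''r''}" and i: "i < 2"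
    and post: "\<And>m'. bounded_mem m' \<Longrightarrow> frame {''p'', ''q'', ''g'', ''h'', ''r'', x} m m' \<Longrightarrow>
      m' x = (m x)(2 * i := num (of_int (m ''p'' 0) / of_int (m ''q'' 0)),
                   2 * i + 1 := den (of_int (m ''p'' 0) / of_int (m ''q'' 0))) \<Longrightarrow> Q (m', out)"
  shows "runs_to (store_cur x i) (m, out) Q"
  unfolding store_cur_def
proof (rule sym_exec_runs_to_seq)
  show "runs_to reduce_cur (m, out) (sym_exec (Assign x (N (2 * int i)) (V ''p'') ;; Assign x (N (2 * int i + 1)) (V ''q'')) Q)"
  proof (rule runs_to_reduce_cur[OF bm q])
    fix m' assume m': "bounded_mem m'" "frame {''p'', ''q'', ''g'', ''h'', ''r''} m m'"
      "m' ''p'' 0 = num (of_int (m ''p'' 0) / of_int (m ''q'' 0))"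
      "m' ''q'' 0 = den (of_int (m ''p'' 0) / of_int (m ''q'' 0))"
    have "nat (2 * int i) = 2 * i" "nat (2 * int i + 1) = 2 * i + 1" by simp_all
    moreover have "m' x = m x" using frameD[OF m'(2) x] .
    moreover define m2 where "m2 = m'(x := (m x)(2 * i := m' ''p'' 0, 2 * i + 1 := m' ''q'' 0))"
    moreover have "Q (m2, out)"
    proof (rule post)
      show "bounded_mem m2" using m'(1) bm by (simp add: m2_def bounded_mem_def)
      show "frame {''p'', ''q'', ''g'', ''h'', ''r'', x} m m2" using m'(2) by (auto simp: m2_def frame_def)
    qed (simp add: m2_def m'(3,4))
    moreover have "''p'' \<noteq> x" "''q'' \<noteq> x" using x by auto
    ultimately show "sym_exec (Assign x (N (2 * int i)) (V ''p'') ;; Assign x (N (2 * int i + 1)) (V ''q'')) Q (m', out)"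
      using w K i m'(1) by simp
  qed
qed (use bm in simp)

end

section \<open>The image of a solution\<close>

definition pt_at :: "mem \<Rightarrow> vname \<Rightarrow> nat \<Rightarrow> point \<Rightarrow> bool" where
  "pt_at m x k y \<longleftrightarrow> m x k = num (fst y) \<and> m x (k + 1) = den (fst y) \<and>
     m x (k + 2) = num (snd y) \<and> m x (k + 3) = den (snd y)"

lemma nat_addr [simp]:
  "nat (4 * int k) = 4 * k" "nat (4 * int k + 1) = 4 * k + 1" "nat (4 * int k + 2) = 4 * k + 2"
  "nat (4 * int k + 3) = 4 * k + 3" "nat (2 * int k) = 2 * k" "nat (2 * int k + 1) = 2 * k + 1"
  "nat (2 * (int i * int n)) = 2 * (i * n)"
  by (simp_all add: nat_add_distrib nat_mult_distrib)

context ram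
begin

lemma sym_exec_step:
  "bounded_mem (fst s) \<Longrightarrow> sym_exec c (\<lambda>s'. bounded_mem (fst s') \<longrightarrow> runs_to d s' Q) s \<Longrightarrow> runs_to (c ;; d) s Q"
  by (rule runs_to_seq) (drule (1) sym_exec_runs_to, erule runs_to_post, simp)

end

text \<open>With n the instance size, coordinates of image points have numerators and denominators
  up to 2^n; the unreduced difference of two of them reaches 2^(2n + 1) and has to fit into a
  cell.\<close>

locale ram_inst = ram_loop +
  fixes I :: boco_inst
  assumes I: "boco_instance I" and inp: "inp = enc_inst I" and KI: "2 * inst_size I + 10 \<le> K"
    and dimL: "dim I \<le> L"
begin

text \<open>The bits that suffice for the partial sum of a row, which the program leaves unreduced
  until the row is complete.\<close>

definition row_bits :: "nat \<Rightarrow> nat \<Rightarrow> nat" where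
  "row_bits i j = (\<Sum>l<j. rat_size (costs I $$ (i, l)))"

definition row_sum :: "nat \<Rightarrow> rat vec \<Rightarrow> nat \<Rightarrow> rat" where
  "row_sum i x j = (\<Sum>l<j. costs I $$ (i, l) * x $ l)"

lemma row_bits_le: "i < 2 \<Longrightarrow> row_bits i (dim I) \<le> inst_size I"
  unfolding row_bits_def inst_size_def
  using member_le_sum[of i "{..<2}" "\<lambda>i. \<Sum>j<dim I. rat_size (costs I $$ (i, j))"] by simp

lemma row_bits_mono: "j \<le> k \<Longrightarrow> row_bits i j \<le> row_bits i k"
  unfolding row_bits_def by (intro sum_mono2) auto

lemma pow_K: "n \<le> 2 * inst_size I + 9 \<Longrightarrow> x \<le> 2 ^ n \<Longrightarrow> x < (2::int) ^ K"
  using KI by (intro le_less_trans[of x "2 ^ n"] power_strict_increasing) auto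

lemma entry_K:
  assumes "i < 2" "j < dim I"
  shows "\<bar>num (costs I $$ (i, j))\<bar> < 2 ^ K" "\<bar>den (costs I $$ (i, j))\<bar> < 2 ^ K"
proof -
  define c where "c = costs I $$ (i, j)"
  have "rat_size c \<le> row_bits i (Suc j)" by (simp add: row_bits_def c_def)
  also have "\<dots> \<le> inst_size I" using row_bits_mono[of "Suc j" "dim I" i] row_bits_le assms by (meson Suc_leI order_trans)
  finally have "rat_size c \<le> 2 * inst_size I + 9" by simp
  then have "\<bar>num c\<bar> + den c < 2 ^ K" using num_den_size[of c] by (rule pow_K)
  then have "\<bar>num c\<bar> < 2 ^ K" "\<bar>den c\<bar> < 2 ^ K" using den_pos[of c] by linarith+
  then show "\<bar>num (costs I $$ (i, j))\<bar> < 2 ^ K" "\<bar>den (costs I $$ (i, j))\<bar> < 2 ^ K" by (simp_all add: c_def)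
qed

text \<open>Expanding (|p| + q) * (|num c| + den c) yields both the new numerator and the new
  denominator among its nonnegative terms, so adding an entry costs at most its encoding
  length.\<close>

lemma row_step:
  assumes pq: "0 < q" "of_int p / of_int q = row_sum i x j" "\<bar>p\<bar> + q \<le> 2 ^ row_bits i j"
    and z: "z = 0 \<or> z = 1" "of_int z = x $ j"
  defines "c \<equiv> costs I $$ (i, j)"
  defines "p' \<equiv> p * den c + num c * z * q"
  shows "0 < q * den c" "of_int p' / of_int (q * den c) = row_sum i x (Suc j)"
    "\<bar>p'\<bar> + q * den c \<le> 2 ^ row_bits i (Suc j)"
proof -
  show "0 < q * den c" using pq by simp
  have d: "of_int (den c) \<noteq> (0::rat)" "of_int q \<noteq> (0::rat)"
    using pq(1) den_pos[of c] unfolding of_int_eq_0_iff by linarith+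
  have "row_sum i x (Suc j) = of_int p / of_int q + of_int (num c) / of_int (den c) * of_int z"
    using pq(2) z(2) by (simp add: row_sum_def c_def)
  also have "\<dots> = of_int p' / of_int (q * den c)"
    using d by (simp add: p'_def field_simps del: num_den)
  finally show "of_int p' / of_int (q * den c) = row_sum i x (Suc j)" by simp
  have "\<bar>p'\<bar> \<le> \<bar>p\<bar> * den c + \<bar>num c\<bar> * q"
  proof -
    have "\<bar>num c * z * q\<bar> \<le> \<bar>num c\<bar> * q" using z pq by (auto simp: abs_mult)
    moreover have "\<bar>p * den c\<bar> = \<bar>p\<bar> * den c" by (simp add: abs_mult less_imp_le)
    ultimately show ?thesis unfolding p'_def using abs_triangle_ineq[of "p * den c" "num c * z * q"] by linarith
  qed
  moreover have "0 \<le> \<bar>p\<bar> * \<bar>num c\<bar>" by simp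
  moreover have "(\<bar>p\<bar> + q) * (\<bar>num c\<bar> + den c) = \<bar>p\<bar> * \<bar>num c\<bar> + \<bar>p\<bar> * den c + \<bar>num c\<bar> * q + q * den c"
    by (simp add: algebra_simps)
  ultimately have "\<bar>p'\<bar> + q * den c \<le> (\<bar>p\<bar> + q) * (\<bar>num c\<bar> + den c)" by linarith
  also have "\<dots> \<le> 2 ^ row_bits i j * 2 ^ rat_size c"
    using pq num_den_size[of c] less_imp_le[OF den_pos[of c]] by (intro mult_mono add_nonneg_nonneg) auto
  also have "\<dots> = 2 ^ row_bits i (Suc j)" by (simp add: row_bits_def c_def power_add)
  finally show "\<bar>p'\<bar> + q * den c \<le> 2 ^ row_bits i (Suc j)" .
qed

lemma sols_entry: "x \<in> sols I \<Longrightarrow> j < dim I \<Longrightarrow> \<lfloor>x $ j\<rfloor> = 0 \<or> \<lfloor>x $ j\<rfloor> = 1"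
  "x \<in> sols I \<Longrightarrow> j < dim I \<Longrightarrow> of_int \<lfloor>x $ j\<rfloor> = x $ j"
  using I unfolding boco_instance_def by force+

lemma row_sum_eq: "x \<in> sols I \<Longrightarrow> i < 2 \<Longrightarrow> row_sum i x (dim I) = (costs I *\<^sub>v x) $ i"
  using I unfolding boco_instance_def row_sum_def
  by (subst index_mult_mat_vec) (auto simp: scalar_prod_def lessThan_atLeast0)

lemma row_bound: "x \<in> sols I \<Longrightarrow> j \<le> dim I \<Longrightarrow>
  \<exists>p q. 0 < q \<and> of_int p / of_int q = row_sum i x j \<and> \<bar>p\<bar> + q \<le> 2 ^ row_bits i j"
proof (induction j)
  case 0
  show ?case by (intro exI[of _ 0] exI[of _ 1]) (simp add: row_sum_def row_bits_def)
next
  case (Suc j)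
  then obtain p q where "0 < q" "of_int p / of_int q = row_sum i x j" "\<bar>p\<bar> + q \<le> 2 ^ row_bits i j" by auto
  from row_step[OF this sols_entry[of x j]] show ?case using Suc.prems by (meson Suc_le_lessD)
qed

text \<open>Lowest terms are no longer than the unreduced row sum. The bound holds for every image
  point, whatever iteration finds it, so numbers do not grow along the run.\<close>

lemma image_bound:
  assumes "x \<in> sols I" "i < 2"
  shows "\<bar>num ((costs I *\<^sub>v x) $ i)\<bar> \<le> 2 ^ inst_size I" "den ((costs I *\<^sub>v x) $ i) \<le> 2 ^ inst_size I"
proof -
  obtain p q where pq: "0 < q" "of_int p / of_int q = row_sum i x (dim I)" "\<bar>p\<bar> + q \<le> 2 ^ row_bits i (dim I)"
    using row_bound[OF assms(1) order_refl] by blast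
  have "(2::int) ^ row_bits i (dim I) \<le> 2 ^ inst_size I" using row_bits_le assms by (intro power_increasing) auto
  then have "\<bar>p\<bar> \<le> 2 ^ inst_size I" "q \<le> 2 ^ inst_size I" using pq by linarith+
  then show "\<bar>num ((costs I *\<^sub>v x) $ i)\<bar> \<le> 2 ^ inst_size I" "den ((costs I *\<^sub>v x) $ i) \<le> 2 ^ inst_size I"
    using num_den_quotient_le[OF pq(1), of p] row_sum_eq[OF assms] pq(2) by auto
qed

lemma runs_to_compute_image:
  assumes bm: "bounded_mem m" and i: "i < 2" and x: "x \<in> sols I"
    and mx: "\<And>j. j < dim I \<Longrightarrow> m ''x'' (Suc j) = \<lfloor>x $ j\<rfloor>"
    and post: "\<And>m'. bounded_mem m' \<Longrightarrow> frame {''p'', ''q'', ''g'', ''h'', ''r'', ''j'', ''y''} m m' \<Longrightarrow>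
      m' ''y'' = (m ''y'')(2 * i := num ((costs I *\<^sub>v x) $ i), 2 * i + 1 := den ((costs I *\<^sub>v x) $ i)) \<Longrightarrow>
      Q (m', out)"
  shows "runs_to (compute_image i) (m, out) Q"
proof -
  let ?F = "{''p'', ''q'', ''r'', ''j''}"
  let ?body = "set_cur (fadd cur (fmul (cost_entry i) (Arr ''x'' (Add (V ''j'') (N 1)), N 1))) ;;
       ''j'' ::= Add (V ''j'') (N 1)"
  \<comment> \<open>The variant counts the entries left; \<open>cur\<close> holds an unreduced
    fraction for the partial row sum.\<close>
  define J where "J = (\<lambda>n (s :: mem \<times> int list). snd s = out \<and> (\<exists>j \<le> dim I. n = dim I - j \<and>
     fst s ''j'' 0 = int j \<and> frame ?F m (fst s) \<and> 0 < fst s ''q'' 0 \<and>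
     of_int (fst s ''p'' 0) / of_int (fst s ''q'' 0) = row_sum i x j \<and>
     \<bar>fst s ''p'' 0\<bar> + fst s ''q'' 0 \<le> 2 ^ row_bits i j))"
  have in0: "inp ! 0 = int (dim I)" "inp \<noteq> []" using enc_inst_0[of I] by (auto simp: inp)
  have n: "int (dim I) < 2 ^ K"
  proof -
    have "int (dim I) < 2 ^ dim I" by (simp add: of_nat_less_two_power)
    also have "(2::int) ^ dim I \<le> 2 ^ K" using KI by (intro power_increasing) (auto simp: inst_size_def)
    finally show ?thesis .
  qed
  have xK: "\<bar>num (costs I $$ (i, j))\<bar> < 2 ^ K" "\<bar>den (costs I $$ (i, j))\<bar> < 2 ^ K"
    "inp ! Suc (2 * (i * dim I + j)) = num (costs I $$ (i, j))"
    "inp ! Suc (Suc (2 * (i * dim I + j))) = den (costs I $$ (i, j))"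
    "2 * (int i * int (dim I) + int j) + 2 < int (length inp)" if "j < dim I" for j
  proof -
    show "2 * (int i * int (dim I) + int j) + 2 < int (length inp)"
    proof -
      have "int (Suc (Suc (2 * (i * dim I + j)))) < int (length inp)"
        using enc_inst_nth(3)[OF i that] unfolding inp of_nat_less_iff .
      then show ?thesis by simp
    qed
  qed (use entry_K[OF i that] enc_inst_nth[OF i that] in \<open>simp_all add: inp\<close>)
  have loop: "runs_to (WHILE Less (V ''j'') (In (N 0)) DO ?body) (m1, out) (\<lambda>s. runs_to (store_cur ''y'' i) s Q)"
    if m1: "bounded_mem m1" "J (dim I) (m1, out)" for m1
  proof (rule runs_to_while[where I = J, OF m1(2) dimL])
    show "bounded_mem (fst (m1, out))" using m1 by simp
    show "bexp_ok (fst s) (Less (V ''j'') (In (N 0)))" for s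
      using in0 n w K by simp
    fix k s assume J: "J k s" and bms: "bounded_mem (fst s)"
    obtain m2 where s: "s = (m2, out)" using J by (cases s) (simp add: J_def)
    obtain j where j: "j \<le> dim I" "k = dim I - j" "m2 ''j'' 0 = int j" "frame ?F m m2"
      and pq: "0 < m2 ''q'' 0" "of_int (m2 ''p'' 0) / of_int (m2 ''q'' 0) = row_sum i x j"
        "\<bar>m2 ''p'' 0\<bar> + m2 ''q'' 0 \<le> 2 ^ row_bits i j"
      using J by (auto simp: J_def s)
    {
      assume "\<not> bval inp (fst s) (Less (V ''j'') (In (N 0)))"
      then have "j = dim I" using j s in0 by simp
      then have val: "of_int (m2 ''p'' 0) / of_int (m2 ''q'' 0) = (costs I *\<^sub>v x) $ i"
        using pq row_sum_eq[OF x i] by simp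
      show "runs_to (store_cur ''y'' i) s Q"
        unfolding s
      proof (rule runs_to_store_cur)
        fix m' assume m': "bounded_mem m'" "frame {''p'', ''q'', ''g'', ''h'', ''r'', ''y''} m2 m'"
          "m' ''y'' = (m2 ''y'')(2 * i := num (of_int (m2 ''p'' 0) / of_int (m2 ''q'' 0)),
             2 * i + 1 := den (of_int (m2 ''p'' 0) / of_int (m2 ''q'' 0)))"
        have "m2 ''y'' = m ''y''" using frameD[OF j(4)] by simp
        then show "Q (m', out)"
          using m' val by (intro post) (auto intro: frame_trans[OF j(4)])
      qed (use bms s pq i in auto)
    }
    assume "bval inp (fst s) (Less (V ''j'') (In (N 0)))"
    then have jn: "j < dim I" using j s in0 by simp
    define z where "z = m2 ''x'' (Suc j)"
    have z: "z = \<lfloor>x $ j\<rfloor>" using mx[OF jn] frameD[OF j(4), of "''x''"] by (simp add: z_def)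
    have zz: "z = 0 \<or> z = 1" "of_int z = x $ j" using sols_entry[OF x jn] by (simp_all add: z)
    define p where "p = m2 ''p'' 0"
    define q where "q = m2 ''q'' 0"
    define c where "c = costs I $$ (i, j)"
    define p' where "p' = p * den c + num c * z * q"
    have step: "0 < q * den c" "of_int p' / of_int (q * den c) = row_sum i x (Suc j)"
      "\<bar>p'\<bar> + q * den c \<le> 2 ^ row_bits i (Suc j)"
      using row_step[OF pq zz] by (simp_all add: p_def q_def c_def p'_def)
    have rb: "row_bits i (Suc j) \<le> 2 * inst_size I + 9"
      using row_bits_mono[of "Suc j" "dim I" i] row_bits_le[OF i] jn by simp
    have "\<bar>p'\<bar> + q * den c < 2 ^ K" using pow_K[OF rb step(3)] .
    then have pK: "\<bar>p'\<bar> < 2 ^ K" "\<bar>q * den c\<bar> < 2 ^ K" using step(1) by linarith+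
    have "int j + 1 \<le> int (dim I)" using jn by simp
    then have jK: "\<bar>int j + 1\<bar> < 2 ^ K" using n by linarith
    define m3 where "m3 = m2(''r'' := (m2 ''r'')(0 := p'), ''q'' := (m2 ''q'')(0 := q * den c),
      ''p'' := (m2 ''p'')(0 := p'), ''j'' := (m2 ''j'')(0 := int j + 1))"
    have "J (k - 1) (m3, out)"
      unfolding J_def fst_conv snd_conv
    proof (intro conjI exI[of _ "Suc j"])
      show "frame ?F m m3" using j(4) by (simp add: frame_def m3_def)
    qed (use jn j(2) step in \<open>simp_all add: m3_def\<close>)
    then have "runs_to ?body s (J (k - 1))"
      unfolding s
      apply (intro sym_exec_runs_to)
      subgoal using bms s by simp
      using pK jK in0 n w K i xK[OF jn] j(3) xK(3,4)[OF jn]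
      by (simp add: set_cur_def fadd_def fmul_def cost_entry_def Let_def m3_def p_def[symmetric] q_def[symmetric]
          z_def[symmetric] c_def[symmetric] p'_def nat_add_distrib)
    then show "0 < k \<and> runs_to ?body s (J (k - 1))" using j jn by simp
  qed
  show ?thesis
    unfolding compute_image_def
    apply (rule sym_exec_step)
    subgoal using bm by simp
    using w K apply (simp add: set_cur_def)
    apply (rule impI)
    apply (rule sym_exec_step)
    subgoal by simp
    apply simp
    apply (rule impI)
    apply (rule runs_to_seq)
    apply (rule loop[unfolded set_cur_def])
    subgoal by simp
    by (auto simp: J_def frame_def row_sum_def row_bits_def)
qed

end

section \<open>Calls of the solver\<close>

definition component :: "nat \<Rightarrow> point \<Rightarrow> rat" where
  "component i y = (if i = 0 then fst y else snd y)"

section \<open>Fraction expressions read as rational numbers\<close>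

context ram
begin

definition frac_val :: "mem \<Rightarrow> fexp \<Rightarrow> rat" where
  "frac_val m f = of_int (aval inp m (fst f)) / of_int (aval inp m (snd f))"

text \<open>Positive denominators are what makes the cross-multiplied tests agree with the
  comparison of rationals.\<close>

definition frac_pos :: "mem \<Rightarrow> fexp \<Rightarrow> bool" where
  "frac_pos m f \<longleftrightarrow> 0 < aval inp m (snd f)"

lemma frac_pos_ops:
  assumes "frac_pos m x" "frac_pos m y"
  shows "frac_pos m (fadd x y)" "frac_pos m (fsub x y)" "frac_pos m (fmul x y)"
  using assms by (simp_all add: frac_pos_def fadd_def fsub_def fmul_def)

lemma frac_val_ops:
  assumes "frac_pos m x" "frac_pos m y"
  shows "frac_val m (fadd x y) = frac_val m x + frac_val m y" "frac_val m (fsub x y) = frac_val m x - frac_val m y"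
    "frac_val m (fmul x y) = frac_val m x * frac_val m y"
  using assms by (simp_all add: frac_val_def frac_pos_def fadd_def fsub_def fmul_def add_frac_eq diff_frac_eq)

lemma bval_flt:
  assumes "frac_pos m x" "frac_pos m y"
  shows "bval inp m (flt x y) \<longleftrightarrow> frac_val m x < frac_val m y"
proof -
  have "frac_val m x < frac_val m y \<longleftrightarrow>
      (of_int (aval inp m (fst x)) * of_int (aval inp m (snd y)) :: rat) < of_int (aval inp m (fst y)) * of_int (aval inp m (snd x))"
    using assms by (simp add: frac_val_def frac_pos_def divide_less_eq pos_less_divide_eq mult.commute)
  then show ?thesis by (simp add: flt_def flip: of_int_mult)
qed

lemma bval_fle: "frac_pos m x \<Longrightarrow> frac_pos m y \<Longrightarrow> bval inp m (fle x y) \<longleftrightarrow> frac_val m x \<le> frac_val m y"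
  by (simp add: fle_def bval_flt not_less)

lemma bval_feq:
  assumes "frac_pos m x" "frac_pos m y"
  shows "bval inp m (feq x y) \<longleftrightarrow> frac_val m x = frac_val m y"
proof -
  have "frac_val m x = frac_val m y \<longleftrightarrow>
      (of_int (aval inp m (fst x)) * of_int (aval inp m (snd y)) :: rat) = of_int (aval inp m (fst y)) * of_int (aval inp m (snd x))"
    using assms by (simp add: frac_val_def frac_pos_def frac_eq_eq)
  then show ?thesis by (simp add: feq_def flip: of_int_mult)
qed

lemma frac_val_coord:
  assumes "pt_at m ''A'' (4 * k) y" "aval inp m e = int k" "i < 2"
  shows "frac_val m (coord e i) = component i y" "frac_pos m (coord e i)"
  using assms less_2_cases[of i] by (auto simp: frac_val_def frac_pos_def coord_def pt_at_def component_def)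

lemma frac_val_comp:
  assumes "pt_at m x 0 y" "i < 2"
  shows "frac_val m (comp x i) = component i y" "frac_pos m (comp x i)"
  using assms less_2_cases[of i] by (auto simp: frac_val_def frac_pos_def comp_def pt_at_def component_def numeral_3_eq_3 numeral_2_eq_2)

end

text \<open>Weights are read from cells, so each of the two has encoding length at most
  \<open>2 * K + 2\<close>; the solver is needed for such weights only. \<open>C\<close> pays for
  its run, for passing the weights and for copying the answer, and \<open>L\<close> also covers
  loops over all points found.\<close>

locale ram_da = ram_inst +
  fixes ws :: com and T :: nat
  assumes ws: "\<And>l. 0 \<le> fst l \<Longrightarrow> 0 \<le> snd l \<Longrightarrow> rat_size (fst l) + rat_size (snd l) \<le> 4 * K + 4 \<Longrightarrow>
      \<exists>t out. runs w (enc_pt l @ inp) ws t out \<and> t \<le> T \<and> ws_answer I l out"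
    and C: "T + dim I + 8 \<le> C"
    and Lk: "4 * card (uncovered (image_pts I)) + 3 \<le> L"
begin

lemma fin_image_pts: "finite (image_pts I)"
  using finite_sols(1)[OF I] by simp

lemma runs_to_call:
  assumes bm: "bounded_mem m" and l: "pt_at m ''lam'' 0 l" "0 \<le> fst l" "0 \<le> snd l"
    and post: "\<And>res. ws_answer I l res \<Longrightarrow>
      bounded_mem (m(''x'' := (\<lambda>i. if i < length res then res ! i else m ''x'' i))) \<Longrightarrow>
      Q (m(''x'' := (\<lambda>i. if i < length res then res ! i else m ''x'' i)), out)"
  shows "runs_to (Call ws ''lam'' (N 4) ''x'') (m, out) Q"
proof -
  have "\<bar>num (fst l)\<bar> < 2 ^ K" "\<bar>den (fst l)\<bar> < 2 ^ K" "\<bar>num (snd l)\<bar> < 2 ^ K" "\<bar>den (snd l)\<bar> < 2 ^ K"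
    using bmD[OF bm] l(1) unfolding pt_at_def by metis+
  then have "rat_size (fst l) + rat_size (snd l) \<le> 4 * K + 4"
    using rat_size_le[of "fst l" K] rat_size_le[of "snd l" K] by simp
  then obtain t res where "runs w (enc_pt l @ inp) ws t res" "t \<le> T" and ans: "ws_answer I l res"
    using ws l by blast
  then obtain m' where ex: "exec w (enc_pt l @ inp) ws (\<lambda>_ _. 0, []) t (m', res)" and t: "t \<le> T"
    by (auto simp: runs_def)
  define m2 where "m2 = m(''x'' := (\<lambda>i. if i < length res then res ! i else m ''x'' i))"
  have "map (m ''lam'') [0..<4] = enc_pt l"
    using l(1) by (simp add: pt_at_def enc_pt_def enc_rat_eq upt_rec numeral_3_eq_3 numeral_2_eq_2)
  then have e1: "exec w inp (Call ws ''lam'' (N 4) ''x'') (m, out) (1 + acost (N 4) + 4 + t + length res) (m2, out)"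
    unfolding m2_def using ex K w ok_safe[OF bm, of "N 4"] by (intro exec.Call) simp_all
  \<comment> \<open>The answer consists of entries 0 and 1, so copying it keeps the cells
    bounded.\<close>
  have len: "length res \<le> dim I + 1" and res: "\<And>z. z \<in> set res \<Longrightarrow> z = 0 \<or> z = 1"
  proof -
    have cs: thesis if "res = [0] \<Longrightarrow> thesis" "\<And>x. x \<in> sols I \<Longrightarrow> res = 1 # map (\<lambda>i. \<lfloor>x $ i\<rfloor>) [0..<dim I] \<Longrightarrow> thesis" for thesis
      using ans that by (auto simp: ws_answer_def ws_optimal_def split: if_splits)
    show "length res \<le> dim I + 1" by (rule cs) simp_all
    show "z = 0 \<or> z = 1" if "z \<in> set res" for z
    proof (rule cs)
      fix x assume x: "x \<in> sols I" "res = 1 # map (\<lambda>i. \<lfloor>x $ i\<rfloor>) [0..<dim I]"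
      then have "z = 1 \<or> (\<exists>j < dim I. z = \<lfloor>x $ j\<rfloor>)" using that by auto
      then show ?thesis using sols_entry(1)[OF x(1)] by blast
    qed (use that in simp)
  qed
  have b2: "bounded_mem m2" unfolding bounded_mem_def
  proof (intro allI)
    fix x i show "\<bar>m2 x i\<bar> < 2 ^ K"
      using res[of "res ! i"] bmD[OF bm, of x i] K16[of 0] K16[of 1]
      by (auto simp: m2_def)
  qed
  have t2: "1 + acost (N 4) + 4 + t + length res \<le> time_bound L C (Call ws ''lam'' (N 4) ''x'')"
    using t len C by simp
  show ?thesis
    unfolding runs_to_def
  proof (intro exI conjI)
    show "bounded_mem (fst (m2, out))" using b2 by simp
    show "Q (m2, out)" using post[OF ans] b2 by (simp add: m2_def)
  qed (rule e1 t2)+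
qed

lemma runs_to_solve:
  assumes bm: "bounded_mem m" and l: "pt_at m ''lam'' 0 l" "0 \<le> fst l" "0 \<le> snd l"
    and infeasible: "\<And>m'. sols I = {} \<Longrightarrow> bounded_mem m' \<Longrightarrow> m' ''x'' 0 = 0 \<Longrightarrow> Q (m', out)"
    and post: "\<And>m' y. bounded_mem m' \<Longrightarrow>
      frame {''x'', ''p'', ''q'', ''g'', ''h'', ''r'', ''j'', ''y''} m m' \<Longrightarrow> m' ''x'' 0 = 1 \<Longrightarrow>
      optimal (image_pts I) l y \<Longrightarrow> pt_at m' ''y'' 0 y \<Longrightarrow> Q (m', out)"
  shows "runs_to (solve ws) (m, out) Q"
  unfolding solve_def
proof (rule runs_to_seq, rule runs_to_call[OF bm l])
  fix res
  define m2 where "m2 = m(''x'' := (\<lambda>i. if i < length res then res ! i else m ''x'' i))"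
  assume ans: "ws_answer I l res" and bm2': "bounded_mem (m(''x'' := (\<lambda>i. if i < length res then res ! i else m ''x'' i)))"
  have bm2: "bounded_mem m2" using bm2' by (simp add: m2_def)
  show "runs_to (IF Eq (V ''x'') (N 0) THEN SKIP ELSE (compute_image 0 ;; compute_image 1))
     (m(''x'' := (\<lambda>i. if i < length res then res ! i else m ''x'' i)), out) Q"
    unfolding m2_def[symmetric]
  proof (rule runs_to_if)
    show "bounded_mem (fst (m2, out))" using bm2 by simp
    show "bexp_ok (fst (m2, out)) (Eq (V ''x'') (N 0))" using w K by simp
  next
    assume "bval inp (fst (m2, out)) (Eq (V ''x'') (N 0))"
    then have "m2 ''x'' 0 = 0" by simp
    moreover from this have "sols I = {}"
      using ans by (auto simp: ws_answer_def m2_def split: if_splits)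
    ultimately show "runs_to SKIP (m2, out) Q"
      using infeasible bm2 by (intro sym_exec_runs_to) simp_all
  next
    assume "\<not> bval inp (fst (m2, out)) (Eq (V ''x'') (N 0))"
    then have "sols I \<noteq> {}" using ans by (auto simp: ws_answer_def m2_def split: if_splits)
    then obtain x where x: "ws_optimal I l x" "res = 1 # map (\<lambda>i. \<lfloor>x $ i\<rfloor>) [0..<dim I]"
      using ans by (auto simp: ws_answer_def)
    have xS: "x \<in> sols I" using x by (simp add: ws_optimal_def)
    have m2x: "m2 ''x'' 0 = 1" "\<And>j. j < dim I \<Longrightarrow> m2 ''x'' (Suc j) = \<lfloor>x $ j\<rfloor>"
      by (simp_all add: m2_def x(2))
    have fr2: "frame {''x''} m m2" by (simp add: frame_def m2_def)
    show "runs_to (compute_image 0 ;; compute_image 1) (m2, out) Q"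
    proof (rule runs_to_seq, rule runs_to_compute_image[OF bm2 _ xS m2x(2)])
      fix m3 assume m3: "bounded_mem m3" "frame {''p'', ''q'', ''g'', ''h'', ''r'', ''j'', ''y''} m2 m3"
        "m3 ''y'' = (m2 ''y'')(2 * 0 := num ((costs I *\<^sub>v x) $ 0), 2 * 0 + 1 := den ((costs I *\<^sub>v x) $ 0))"
      have x3: "m3 ''x'' = m2 ''x''" using frameD[OF m3(2)] by simp
      show "runs_to (compute_image 1) (m3, out) Q"
      proof (rule runs_to_compute_image[OF m3(1) _ xS])
        fix m4 assume m4: "bounded_mem m4" "frame {''p'', ''q'', ''g'', ''h'', ''r'', ''j'', ''y''} m3 m4"
          "m4 ''y'' = (m3 ''y'')(2 * 1 := num ((costs I *\<^sub>v x) $ 1), 2 * 1 + 1 := den ((costs I *\<^sub>v x) $ 1))"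
        have fr24: "frame {''p'', ''q'', ''g'', ''h'', ''r'', ''j'', ''y''} m2 m4"
          using frame_trans[OF m3(2) m4(2)] by simp
        show "Q (m4, out)"
        proof (rule post[of m4 "image_pt I x"])
          show "frame {''x'', ''p'', ''q'', ''g'', ''h'', ''r'', ''j'', ''y''} m m4"
            by (rule frame_trans[OF fr2 fr24]) auto
          show "m4 ''x'' 0 = 1" using frameD[OF fr24] m2x by simp
          show "optimal (image_pts I) l (image_pt I x)" using x xS by (auto simp: optimal_def ws_optimal_def)
          show "pt_at m4 ''y'' 0 (image_pt I x)"
            using m3(3) m4(3) by (simp add: pt_at_def image_pt_def numeral_3_eq_3 numeral_2_eq_2)
        qed (rule m4(1))
      qed (use m2x x3 in simp_all)
    qed simp_all
  qed
qed

text \<open>Sharper than the cell bound, to leave room for the difference of two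
  coordinates.\<close>

definition small :: "rat \<Rightarrow> bool" where
  "small r \<longleftrightarrow> \<bar>num r\<bar> \<le> 2 ^ inst_size I \<and> den r \<le> 2 ^ inst_size I"

lemma small_image_pts: "y \<in> image_pts I \<Longrightarrow> small (component i y)"
  using image_bound[of _ 0] image_bound[of _ 1] by (auto simp: small_def image_pt_def component_def)

lemma mult_small:
  assumes "\<bar>a\<bar> \<le> 2 ^ inst_size I" "\<bar>b\<bar> \<le> 2 ^ inst_size I"
  shows "\<bar>a * b :: int\<bar> \<le> 2 ^ (2 * inst_size I)"
proof -
  have "\<bar>a\<bar> * \<bar>b\<bar> \<le> 2 ^ inst_size I * 2 ^ inst_size I" using assms by (intro mult_mono) auto
  then show ?thesis by (simp add: abs_mult mult_2 power_add)
qed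

lemma runs_to_store_abs_diff:
  assumes bm: "bounded_mem m" and ij: "i < 2" "j < 2"
    and ab: "m ''a'' 0 = int ka" "m ''b'' 0 = int kb" "pt_at m ''A'' (4 * ka) a" "pt_at m ''A'' (4 * kb) b"
    and sm: "small (component j a)" "small (component j b)"
    and post: "\<And>m'. bounded_mem m' \<Longrightarrow> frame {''p'', ''q'', ''g'', ''h'', ''r'', ''lam''} m m' \<Longrightarrow>
      m' ''lam'' = (m ''lam'')(2 * i := num \<bar>component j a - component j b\<bar>, 2 * i + 1 := den \<bar>component j a - component j b\<bar>) \<Longrightarrow> Q (m', out)"
  shows "runs_to (store_abs_diff i j) (m, out) Q"
proof -
  define n1 where "n1 = num (component j a)"
  define d1 where "d1 = den (component j a)"
  define n2 where "n2 = num (component j b)"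
  define d2 where "d2 = den (component j b)"
  define P where "P = n1 * d2 - n2 * d1"
  define D where "D = d1 * d2"
  have d: "0 < d1" "0 < d2" by (simp_all add: d1_def d2_def)
  have D: "0 < D" using d by (simp add: D_def)
  have le: "\<bar>n1\<bar> \<le> 2 ^ inst_size I" "\<bar>d1\<bar> \<le> 2 ^ inst_size I" "\<bar>n2\<bar> \<le> 2 ^ inst_size I" "\<bar>d2\<bar> \<le> 2 ^ inst_size I"
    using sm abs_of_pos[OF d(1)] abs_of_pos[OF d(2)]
    by (simp_all add: small_def n1_def n2_def d1_def d2_def)
  have "\<bar>n1 * d2\<bar> \<le> 2 ^ (2 * inst_size I)" "\<bar>n2 * d1\<bar> \<le> 2 ^ (2 * inst_size I)" "\<bar>D\<bar> \<le> 2 ^ (2 * inst_size I)"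
    unfolding D_def by (rule mult_small; rule le)+
  then have "\<bar>P\<bar> \<le> 2 ^ Suc (2 * inst_size I)" "\<bar>D\<bar> \<le> 2 ^ Suc (2 * inst_size I)"
    unfolding P_def power_Suc by linarith+
  then have PD: "\<bar>P\<bar> < 2 ^ K" "\<bar>D\<bar> < 2 ^ K" by (intro pow_K[of "Suc (2 * inst_size I)"]; simp)+
  have mP: "- P < 2 ^ K" using PD by linarith
  have val: "of_int \<bar>P\<bar> / of_int D = \<bar>component j a - component j b\<bar>"
  proof -
    have "component j a - component j b = of_int n1 / of_int d1 - of_int n2 / of_int d2"
      by (simp add: n1_def n2_def d1_def d2_def)
    also have "\<dots> = of_int P / of_int D"
      using d by (simp add: P_def D_def diff_frac_eq)
    finally show ?thesis using D by (simp add: abs_divide)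
  qed
  have store: "runs_to (store_cur ''lam'' i) (m4, out) Q"
    if "bounded_mem m4" "frame {''p'', ''q'', ''r''} m m4" "m4 ''p'' 0 = \<bar>P\<bar>" "m4 ''q'' 0 = D" for m4
  proof (rule runs_to_store_cur)
    fix m' assume m': "bounded_mem m'" "frame {''p'', ''q'', ''g'', ''h'', ''r'', ''lam''} m4 m'"
      "m' ''lam'' = (m4 ''lam'')(2 * i := num (of_int (m4 ''p'' 0) / of_int (m4 ''q'' 0)),
                   2 * i + 1 := den (of_int (m4 ''p'' 0) / of_int (m4 ''q'' 0)))"
    have "m4 ''lam'' = m ''lam''" using frameD[OF that(2)] by simp
    then have "m' ''lam'' = (m ''lam'')(2 * i := num \<bar>component j a - component j b\<bar>, 2 * i + 1 := den \<bar>component j a - component j b\<bar>)"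
      using m'(3) unfolding that(3,4) val by simp
    then show "Q (m', out)" using m' frame_trans[OF that(2) m'(2), of "{''p'', ''q'', ''g'', ''h'', ''r'', ''lam''}"] by (intro post) auto
  qed (use that D ij in auto)
  have A: "m ''A'' (4 * ka + 2 * j) = n1" "m ''A'' (4 * ka + 2 * j + 1) = d1"
    "m ''A'' (4 * kb + 2 * j) = n2" "m ''A'' (4 * kb + 2 * j + 1) = d2"
  proof -
    have idx: "4 * k + 2 * 0 = 4 * k" "4 * k + 2 * 1 = 4 * k + 2" "4 * k + 2 + 1 = 4 * k + 3" for k :: nat
      by simp_all
    have "m ''A'' (4 * k + 2 * j) = num (component j y)" "m ''A'' (4 * k + 2 * j + 1) = den (component j y)"
      if "pt_at m ''A'' (4 * k) y" for k y
      using that less_2_cases[OF ij(2)] unfolding pt_at_def component_def by (elim disjE conjE; simp only: idx One_nat_def[symmetric]; simp)+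
    then show "m ''A'' (4 * ka + 2 * j) = n1" "m ''A'' (4 * ka + 2 * j + 1) = d1"
      "m ''A'' (4 * kb + 2 * j) = n2" "m ''A'' (4 * kb + 2 * j + 1) = d2"
      using ab(3,4) unfolding n1_def n2_def d1_def d2_def by blast+
  qed
  have addr: "nat (4 * int k + 2 * int j) = 4 * k + 2 * j" "nat (4 * int k + (2 * int j + 1)) = 4 * k + 2 * j + 1" for k
    by simp_all
  show ?thesis
    unfolding store_abs_diff_def
    apply (rule sym_exec_step)
    subgoal using bm by simp
    using w K A ab(1,2) PD ij(2) addr apply (simp add: set_cur_def fsub_def coord_def P_def[symmetric] D_def[symmetric])
    apply (rule impI)
    apply (rule sym_exec_step)
    subgoal by simp
    apply (simp add: mP)
    apply (intro conjI impI)
    by (rule store; simp add: frame_def)+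
qed

end

section \<open>The loops of the program\<close>

lemma nat_addr2 [simp]: "nat (2 * int k + 2) = 2 * k + 2" "nat (2 * int k + 3) = 2 * k + 3"
  "nat (2 + 2 * int k) = 2 * k + 2" "nat (3 + 2 * int k) = 2 * k + 3"
  by simp_all

context ram
begin

lemma sym_exec_runs_to': "bounded_mem (fst s) \<Longrightarrow> sym_exec c (\<lambda>s'. bounded_mem (fst s') \<longrightarrow> R s') s \<Longrightarrow> runs_to c s R"
  by (drule (1) sym_exec_runs_to, erule runs_to_post, simp)

end

lemma pt_at_frame: "frame X m m' \<Longrightarrow> x \<notin> X \<Longrightarrow> pt_at m' x k y \<longleftrightarrow> pt_at m x k y"
  using frameD[of X m m' x] by (simp add: pt_at_def)

context ram_da
begin

text \<open>The abstract queue holds points, the array holds positions in \<open>As\<close>. These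
  stay valid because \<open>As\<close> only grows at its end.\<close>

definition queue_at :: "mem \<Rightarrow> point list \<Rightarrow> nat \<Rightarrow> (point \<times> point) list \<Rightarrow> bool" where
  "queue_at m As h Q \<longleftrightarrow> (\<forall>j < length Q. \<exists>a b. a < length As \<and> b < length As \<and>
     m ''Q'' (2 * (h + j)) = int a \<and> m ''Q'' (2 * (h + j) + 1) = int b \<and> Q ! j = (As ! a, As ! b))"

definition points_at :: "mem \<Rightarrow> point list \<Rightarrow> bool" where
  "points_at m As \<longleftrightarrow> m ''m'' 0 = int (length As) \<and> (\<forall>k < length As. pt_at m ''A'' (4 * k) (As ! k))"

text \<open>Two budgets: with k extreme points, the number of points starts at 2 and the head of the
  queue at 0, and the first potential is at most 4k + 1. A split adds one point, every iteration
  advances the head by one, and each time the potential drops by at least as much.\<close>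

definition loop_inv :: "mem \<Rightarrow> point list \<Rightarrow> nat \<Rightarrow> (point \<times> point) list \<Rightarrow> bool" where
  "loop_inv m As h Q \<longleftrightarrow> points_at m As \<and> m ''qh'' 0 = int h \<and> m ''qt'' 0 = int (h + length Q) \<and>
     queue_at m As h Q \<and> distinct As \<and> da_inv (image_pts I) (set As) Q \<and>
     length As + queue_potential (image_pts I) Q \<le> 4 * card (uncovered (image_pts I)) + 3 \<and>
     h + queue_potential (image_pts I) Q \<le> 4 * card (uncovered (image_pts I)) + 1"

text \<open>There may be exponentially many points, but at most 2^dim of them are extreme, so all
  counters need only dim plus a constant number of bits.\<close>

lemma count_K: "4 * int (card (uncovered (image_pts I))) + 4 < 2 ^ K"
proof -
  have "card (uncovered (image_pts I)) \<le> card (image_pts I)"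
    using fin_image_pts by (intro card_mono) (auto simp: uncovered_def)
  also have "\<dots> \<le> card (sols I)" using finite_sols(1)[OF I] by (rule card_image_le)
  also have "\<dots> \<le> 2 ^ dim I" using finite_sols(2)[OF I] .
  also have "\<dots> \<le> 2 ^ inst_size I" by (intro power_increasing) (auto simp: inst_size_def)
  finally have "int (card (uncovered (image_pts I))) \<le> 2 ^ inst_size I" by (simp add: zle_int flip: of_nat_power)
  moreover have "(1::int) \<le> 2 ^ inst_size I" by simp
  moreover have "(2::int) ^ (inst_size I + 3) = 8 * 2 ^ inst_size I" by (simp add: power_add)
  ultimately have "4 * int (card (uncovered (image_pts I))) + 4 \<le> 2 ^ (inst_size I + 3)" by linarith
  also have "(2::int) ^ (inst_size I + 3) < 2 ^ K" using KI by (intro power_strict_increasing) auto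
  finally show ?thesis .
qed

lemma points_at_frame: "points_at m As \<Longrightarrow> frame X m m' \<Longrightarrow> ''A'' \<notin> X \<Longrightarrow> ''m'' \<notin> X \<Longrightarrow> points_at m' As"
  by (simp add: points_at_def pt_at_frame frameD)

lemma points_at_snoc:
  assumes "points_at m As"
    and "m' ''A'' = (m ''A'')(4 * length As := num (fst y), 4 * length As + 1 := den (fst y),
      4 * length As + 2 := num (snd y), 4 * length As + 3 := den (snd y))"
    and "m' ''m'' 0 = int (length As) + 1"
  shows "points_at m' (As @ [y])"
  unfolding points_at_def
proof (intro conjI allI impI)
  fix k assume k: "k < length (As @ [y])"
  show "pt_at m' ''A'' (4 * k) ((As @ [y]) ! k)"
  proof (cases "k = length As")
    case True
    then show ?thesis using assms(2) by (simp add: pt_at_def)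
  next
    case False
    then have "k < length As" using k by simp
    moreover from this have "4 * k + 3 < 4 * length As" by simp
    ultimately show ?thesis using assms by (simp add: points_at_def pt_at_def nth_append)
  qed
qed (use assms in simp)

lemma queue_at_tl:
  "queue_at m As h (p # Q) \<Longrightarrow> queue_at m As (Suc h) Q"
  unfolding queue_at_def by (metis (no_types, lifting) Suc_less_eq add_Suc_shift length_Cons nth_Cons_Suc)

lemma queue_at_mem: "m' ''Q'' = m ''Q'' \<Longrightarrow> queue_at m As h Q \<Longrightarrow> queue_at m' As h Q"
  by (simp add: queue_at_def)

text \<open>The new point is enqueued under the index \<open>length As\<close> before it is stored
  there; \<open>t\<close> is the tail of the queue at that moment.\<close>

lemma queue_at_split:
  assumes "queue_at m As h Q" and t: "t = h + length Q" and ab: "a < length As" "b < length As"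
    and m': "m' ''Q'' = (m ''Q'')(2 * t := int (length As), 2 * t + 1 := int a, 2 * t + 2 := int (length As), 2 * t + 3 := int b)"
  shows "queue_at m' (As @ [y]) h (Q @ [(y, As ! a), (y, As ! b)])"
  unfolding queue_at_def
proof (intro allI impI)
  fix j assume "j < length (Q @ [(y, As ! a), (y, As ! b)])"
  then consider "j < length Q" | "j = length Q" | "j = Suc (length Q)" by fastforce
  then show "\<exists>a' b'. a' < length (As @ [y]) \<and> b' < length (As @ [y]) \<and> m' ''Q'' (2 * (h + j)) = int a' \<and>
      m' ''Q'' (2 * (h + j) + 1) = int b' \<and> (Q @ [(y, As ! a), (y, As ! b)]) ! j = ((As @ [y]) ! a', (As @ [y]) ! b')"
  proof cases
    case 1
    then obtain c d where cd: "c < length As" "d < length As" "m ''Q'' (2 * (h + j)) = int c"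
      "m ''Q'' (2 * (h + j) + 1) = int d" "Q ! j = (As ! c, As ! d)"
      using assms(1) unfolding queue_at_def by blast
    have "2 * (h + j) + 1 < 2 * t" using 1 t by simp
    then have "m' ''Q'' (2 * (h + j)) = int c" "m' ''Q'' (2 * (h + j) + 1) = int d"
      using cd unfolding m' by simp_all
    then show ?thesis using cd 1 by (intro exI[of _ c] exI[of _ d]) (simp add: nth_append)
  next
    case 2
    then have "2 * (h + j) = 2 * t" using t by simp
    then show ?thesis using 2 ab unfolding m' by (intro exI[of _ "length As"] exI[of _ a]) (simp add: nth_append)
  next
    case 3
    then have "2 * (h + j) = 2 * t + 2" using t by simp
    then show ?thesis using 3 ab unfolding m' by (intro exI[of _ "length As"] exI[of _ b]) (simp add: nth_append)
  qed
qed

lemma runs_to_iteration: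
  assumes bm: "bounded_mem m" and loop_inv: "loop_inv m As h ((a, b) # Q)"
    and post: "\<And>m' As' Q'. bounded_mem m' \<Longrightarrow> loop_inv m' As' (Suc h) Q' \<Longrightarrow>
      queue_potential (image_pts I) Q' < queue_potential (image_pts I) ((a, b) # Q) \<Longrightarrow> R (m', out)"
  shows "runs_to (iteration ws) (m, out) R"
proof -
  let ?S = "image_pts I"
  have pts: "points_at m As" and qh: "m ''qh'' 0 = int h" and qt: "m ''qt'' 0 = int h + int (length Q) + 1"
    and que: "queue_at m As h ((a, b) # Q)" and dist: "distinct As" and inv: "da_inv ?S (set As) ((a, b) # Q)"
    and cnt: "length As + queue_potential ?S ((a, b) # Q) \<le> 4 * card (uncovered ?S) + 3"
    "h + queue_potential ?S ((a, b) # Q) \<le> 4 * card (uncovered ?S) + 1"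
    using loop_inv by (auto simp: loop_inv_def)
  obtain ia ib where i: "ia < length As" "ib < length As" "m ''Q'' (2 * h) = int ia" "m ''Q'' (2 * h + 1) = int ib"
    "a = As ! ia" "b = As ! ib"
    using que unfolding queue_at_def by force
  have AS: "set As \<subseteq> ?S" using inv by (simp add: da_inv_def)
  have aS: "a \<in> ?S" "b \<in> ?S" using i AS nth_mem by blast+
  have ptA: "pt_at m ''A'' (4 * ia) a" "pt_at m ''A'' (4 * ib) b" using pts i by (simp_all add: points_at_def)
  have pq: "Suc (queue_potential ?S Q) \<le> queue_potential ?S ((a, b) # Q)" using queue_potential_neglect[of ?S Q a b] by simp
  define m1 where "m1 = m(''a'' := (m ''a'')(0 := int ia), ''b'' := (m ''b'')(0 := int ib), ''qh'' := (m ''qh'')(0 := int h + 1))"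
  have m1: "m1 ''a'' 0 = int ia" "m1 ''b'' 0 = int ib" "m1 ''qh'' 0 = int (Suc h)" by (simp_all add: m1_def)
  have fr1: "frame {''a'', ''b'', ''qh''} m m1" by (simp add: m1_def frame_def)
  have ptA1: "pt_at m1 ''A'' (4 * ia) a" "pt_at m1 ''A'' (4 * ib) b" using ptA pt_at_frame[OF fr1] by simp_all
  let ?W = "{''x'', ''p'', ''q'', ''g'', ''h'', ''r'', ''j'', ''y'', ''lam''}"
  let ?cond = "And (feq (weighted (coord (V ''a''))) (weighted (comp ''y'')))
            (feq (weighted (comp ''y'')) (weighted (coord (V ''b''))))"
  let ?else = "enqueue (V ''m'') (V ''a'') ;; enqueue (V ''m'') (V ''b'') ;; add_point"
  \<comment> \<open>The iteration is verified from its end to its start, each piece being the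
    continuation of the one before it.\<close>
  have if_part: "runs_to (IF ?cond THEN SKIP ELSE ?else) (m4, out) R"
    if bm4: "bounded_mem m4" and fr4: "frame ?W m1 m4" and y: "optimal ?S (weight a b) y" "pt_at m4 ''y'' 0 y"
      and lam: "pt_at m4 ''lam'' 0 (weight a b)" for m4 y
  proof -
    have ptA4: "pt_at m4 ''A'' (4 * ia) a" "pt_at m4 ''A'' (4 * ib) b" using ptA1 pt_at_frame[OF fr4] by simp_all
    have m4: "m4 ''a'' 0 = int ia" "m4 ''b'' 0 = int ib" "m4 ''qh'' 0 = int (Suc h)"
      using m1 frameD[OF fr4] by simp_all
    have fr14: "frame (?W \<union> {''a'', ''b'', ''qh''}) m m4"
      using frame_trans[OF fr1 fr4, of "?W \<union> {''a'', ''b'', ''qh''}"] by auto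
    have pts4: "points_at m4 As" using points_at_frame[OF pts fr14] by simp
    have que4: "queue_at m4 As (Suc h) Q" using queue_at_mem[OF _ queue_at_tl[OF que]] frameD[OF fr14] by simp
    have qt4: "m4 ''qt'' 0 = int (Suc h + length Q)" using qt frameD[OF fr14] by simp
    have wt: "frac_val m4 (weighted f) = dot (weight a b) z \<and> frac_pos m4 (weighted f)"
      if "\<And>i. i < 2 \<Longrightarrow> frac_val m4 (f i) = component i z \<and> frac_pos m4 (f i)" for f z
      using that[of 0] that[of 1] frac_val_comp[OF lam, of 0] frac_val_comp[OF lam, of 1]
      by (simp add: weighted_def frac_val_ops frac_pos_ops dot_def component_def)
    have cond: "bval inp m4 ?cond \<longleftrightarrow> in_segment y a b"
      using wt[of "coord (V ''a'')" a] wt[of "coord (V ''b'')" b] wt[of "comp ''y''" y]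
        frac_val_coord[OF ptA4(1), of "V ''a''"] frac_val_coord[OF ptA4(2), of "V ''b''"] frac_val_comp[OF y(2)] m4
      by (simp add: bval_feq in_segment_def)
    show ?thesis
    proof (rule runs_to_if)
      show "bexp_ok (fst (m4, out)) ?cond"
        using w K m4 by (simp add: feq_def weighted_def fadd_def fmul_def coord_def comp_def)
      show "runs_to SKIP (m4, out) R" if "bval inp (fst (m4, out)) ?cond"
      proof -
        have "in_segment y a b" using that cond by (simp only: fst_conv)
        then have "da_inv ?S (set As) Q" using da_inv_neglect[OF inv y(1)] by simp
        then have "loop_inv m4 As (Suc h) Q" using pts4 m4 qt4 que4 dist cnt pq by (simp add: loop_inv_def)
        then show ?thesis using post[OF bm4, of As Q] pq bm4 by (intro sym_exec_runs_to) simp_all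
      qed
      show "runs_to ?else (m4, out) R" if "\<not> bval inp (fst (m4, out)) ?cond"
      proof -
        have "\<not> in_segment y a b" using that unfolding fst_conv cond .
        note sp = da_inv_split[OF fin_image_pts inv y(1) this]
        let ?Q = "Q @ [(y, a), (y, b)]"
        define t where "t = Suc h + length Q"
        have qt4: "m4 ''qt'' 0 = int t" using qt4 by (simp add: t_def)
        \<comment> \<open>Every queued pair contributes at least 1, so the potential bounds the tail
          index too.\<close>
        have len: "length Q + 2 \<le> queue_potential ?S ?Q" using length_le_queue_potential[of ?Q ?S] by simp
        have n: "m4 ''m'' 0 = int (length As)" using pts4 by (simp add: points_at_def)
        have nK: "\<bar>int (length As) + 1\<bar> < 2 ^ K" "\<bar>int t + 1\<bar> < 2 ^ K" "\<bar>int t + 2\<bar> < 2 ^ K"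
          using count_K cnt sp(3) len unfolding t_def by linarith+
        have iK: "\<bar>int (length As)\<bar> < 2 ^ K" "\<bar>int ia\<bar> < 2 ^ K" "\<bar>int ib\<bar> < 2 ^ K"
          using nK(1) i(1,2) by linarith+
        have yK: "\<bar>num (fst y)\<bar> < 2 ^ K" "\<bar>den (fst y)\<bar> < 2 ^ K" "\<bar>num (snd y)\<bar> < 2 ^ K" "\<bar>den (snd y)\<bar> < 2 ^ K"
          using bmD[OF bm4] y(2) unfolding pt_at_def by metis+
        have yv: "m4 ''y'' 0 = num (fst y)" "m4 ''y'' (Suc 0) = den (fst y)" "m4 ''y'' 2 = num (snd y)" "m4 ''y'' 3 = den (snd y)"
          using y(2) by (simp_all add: pt_at_def numeral_3_eq_3 numeral_2_eq_2)
        have fin: "R (m', out)" if bm': "bounded_mem m'"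
          and A: "m' ''A'' = (m4 ''A'')(4 * length As := num (fst y), 4 * length As + 1 := den (fst y),
            4 * length As + 2 := num (snd y), 4 * length As + 3 := den (snd y))" "m' ''m'' 0 = int (length As) + 1"
          and Q: "m' ''Q'' = (m4 ''Q'')(2 * t := int (length As), 2 * t + 1 := int ia,
            2 * t + 2 := int (length As), 2 * t + 3 := int ib)"
            "m' ''qt'' 0 = int t + 2" "m' ''qh'' 0 = m4 ''qh'' 0" for m'
        proof (rule post[OF bm', of "As @ [y]" ?Q])
          show "loop_inv m' (As @ [y]) (Suc h) ?Q"
            unfolding loop_inv_def
          proof (intro conjI)
            show "points_at m' (As @ [y])" using points_at_snoc[OF pts4 A] .
            show "queue_at m' (As @ [y]) (Suc h) ?Q" using queue_at_split[OF que4 t_def i(1,2), of m' y] Q(1) i by simp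
            show "da_inv ?S (set (As @ [y])) ?Q" using sp(2) by simp
          qed (use Q m4 dist sp cnt t_def in \<open>simp_all\<close>)
          show "queue_potential ?S ?Q < queue_potential ?S ((a, b) # Q)" using sp(3) by simp
        qed
        show ?thesis
          apply (rule sym_exec_runs_to')
          subgoal using bm4 by simp
          using w K m4 n qt4 nK iK yK yv bm4
          apply (simp add: enqueue_def add_point_def)
          apply (rule impI)
          apply (rule fin)
          apply simp_all
          done
      qed
    qed (use bm4 in simp)
  qed
  have wab: "weight a b = (\<bar>component 1 a - component 1 b\<bar>, \<bar>component 0 a - component 0 b\<bar>)" by (simp add: weight_def component_def)
  have solve_part: "runs_to (solve ws ;; IF ?cond THEN SKIP ELSE ?else) (m3, out) R"
    if bm3: "bounded_mem m3" and fr3: "frame {''p'', ''q'', ''g'', ''h'', ''r'', ''lam''} m1 m3"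
      and lam: "pt_at m3 ''lam'' 0 (weight a b)" for m3
  proof (rule runs_to_seq, rule runs_to_solve[OF bm3 lam])
    show "0 \<le> fst (weight a b)" "0 \<le> snd (weight a b)" by (simp_all add: weight_def)
  next
    fix m' assume "sols I = {}"
    then show "runs_to (IF ?cond THEN SKIP ELSE ?else) (m', out) R" using aS by simp
  next
    fix m' y assume m': "bounded_mem m'" "frame {''x'', ''p'', ''q'', ''g'', ''h'', ''r'', ''j'', ''y''} m3 m'"
      "optimal ?S (weight a b) y" "pt_at m' ''y'' 0 y"
    have "frame ?W m1 m'" by (rule frame_trans[OF fr3 m'(2)]) auto
    moreover have "pt_at m' ''lam'' 0 (weight a b)" using lam pt_at_frame[OF m'(2)] by simp
    ultimately show "runs_to (IF ?cond THEN SKIP ELSE ?else) (m', out) R" using if_part m' by blast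
  qed
  have iK: "\<bar>int ia\<bar> < 2 ^ K" "\<bar>int ib\<bar> < 2 ^ K" "\<bar>int h + 1\<bar> < 2 ^ K"
    using i(1,2) count_K cnt pq by linarith+
  then have bm1: "bounded_mem m1" using bm by (simp add: m1_def bounded_mem_def)
  have main: "runs_to (store_abs_diff 0 1 ;; store_abs_diff 1 0 ;; solve ws ;; IF ?cond THEN SKIP ELSE ?else) (m1, out) R"
  proof (rule runs_to_seq, rule runs_to_store_abs_diff[OF bm1 _ _ m1(1,2) ptA1 small_image_pts[OF aS(1)] small_image_pts[OF aS(2)]])
    fix m2 assume m2: "bounded_mem m2" "frame {''p'', ''q'', ''g'', ''h'', ''r'', ''lam''} m1 m2"
      "m2 ''lam'' = (m1 ''lam'')(2 * 0 := num \<bar>component 1 a - component 1 b\<bar>, 2 * 0 + 1 := den \<bar>component 1 a - component 1 b\<bar>)"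
    have m2v: "m2 ''a'' 0 = int ia" "m2 ''b'' 0 = int ib" using m1 frameD[OF m2(2)] by simp_all
    have ptA2: "pt_at m2 ''A'' (4 * ia) a" "pt_at m2 ''A'' (4 * ib) b" using ptA1 pt_at_frame[OF m2(2)] by simp_all
    show "runs_to (store_abs_diff 1 0 ;; solve ws ;; IF ?cond THEN SKIP ELSE ?else) (m2, out) R"
    proof (rule runs_to_seq, rule runs_to_store_abs_diff[OF m2(1) _ _ m2v ptA2 small_image_pts[OF aS(1)] small_image_pts[OF aS(2)]])
      fix m3 assume m3: "bounded_mem m3" "frame {''p'', ''q'', ''g'', ''h'', ''r'', ''lam''} m2 m3"
        "m3 ''lam'' = (m2 ''lam'')(2 * 1 := num \<bar>component 0 a - component 0 b\<bar>, 2 * 1 + 1 := den \<bar>component 0 a - component 0 b\<bar>)"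
      have "pt_at m3 ''lam'' 0 (weight a b)"
        using m3(3) m2(3) by (simp add: pt_at_def wab numeral_3_eq_3 numeral_2_eq_2)
      then show "runs_to (solve ws ;; IF ?cond THEN SKIP ELSE ?else) (m3, out) R"
        using m3(1) frame_trans[OF m2(2) m3(2)] by (intro solve_part) auto
    qed simp_all
  qed simp_all
  show ?thesis
    unfolding iteration_def
    apply (rule sym_exec_step)
    subgoal using bm by simp
    using w K qh i bm main iK
    by (simp add: dequeue_def m1_def)
qed

section \<open>The final clean-up\<close>

lemma fst_snd_component: "fst y = component 0 y" "snd y = component 1 y"
  by (simp_all add: component_def)

lemma bval_redundant:
  assumes "pt_at m ''A'' (4 * k) z" "pt_at m ''A'' (4 * a) x" "pt_at m ''A'' (4 * b) y"
    and "m ''k'' 0 = int k" "m ''a'' 0 = int a" "m ''b'' 0 = int b"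
  shows "bval inp m redundant \<longleftrightarrow> a \<noteq> k \<and> b \<noteq> k \<and> covered x y z"
proof -
  have v: "frac_val m (coord (V ''k'') i) = component i z" "frac_pos m (coord (V ''k'') i)"
    "frac_val m (coord (V ''a'') i) = component i x" "frac_pos m (coord (V ''a'') i)"
    "frac_val m (coord (V ''b'') i) = component i y" "frac_pos m (coord (V ''b'') i)" if "i < 2" for i
    using frac_val_coord[OF assms(1), of "V ''k''" i] frac_val_coord[OF assms(2), of "V ''a''" i]
      frac_val_coord[OF assms(3), of "V ''b''" i] assms(4-6) that by simp_all
  show ?thesis
    using v[of 0] v[of 1] assms(4-6)
    by (simp add: redundant_def Let_def bval_fle bval_flt frac_val_ops frac_pos_ops covered_def fst_snd_component[of x] fst_snd_component[of y] fst_snd_component[of z])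
qed

lemma bok_redundant:
  assumes "m ''k'' 0 = int k" "m ''a'' 0 = int a" "m ''b'' 0 = int b"
  shows "bexp_ok m redundant"
  using w K assms by (simp add: redundant_def Let_def fle_def flt_def fsub_def fmul_def coord_def)

lemma runs_to_output_cleaned:
  assumes bm: "bounded_mem m" and pts: "points_at m As" and dist: "distinct As" and n: "length As \<le> L"
    and post: "\<And>m'. bounded_mem m' \<Longrightarrow> Q (m', out @ concat (map enc_pt (filter (\<lambda>y. y \<in> uncovered (set As)) As)))"
  shows "runs_to output_cleaned (m, out) Q"
proof -
  define n where "n = length As"
  have mn: "m ''m'' 0 = int n" and ptA: "\<And>k. k < n \<Longrightarrow> pt_at m ''A'' (4 * k) (As ! k)"
    using pts by (simp_all add: points_at_def n_def)
  have nK: "int n < 2 ^ K" using bmD[OF bm, of "''m''" 0] mn by simp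
  define red where "red = (\<lambda>k a b. a \<noteq> k \<and> b \<noteq> k \<and> covered (As ! a) (As ! b) (As ! k))"
  let ?bbody = "IF redundant THEN ''keep'' ::= N 0 ELSE SKIP ;; ''b'' ::= Add (V ''b'') (N 1)"
  let ?bloop = "WHILE Less (V ''b'') (V ''m'') DO ?bbody"
  let ?abody = "''b'' ::= N 0 ;; ?bloop ;; ''a'' ::= Add (V ''a'') (N 1)"
  let ?aloop = "WHILE Less (V ''a'') (V ''m'') DO ?abody"
  let ?X = "{''k'', ''keep'', ''a'', ''b''}"
  \<comment> \<open>The clean-up changes only its loop variables, so all points stay in
    place.\<close>
  define good where "good = (\<lambda>m'. frame ?X m m')"
  have goodD: "m' ''m'' 0 = int n" "\<And>k. k < n \<Longrightarrow> pt_at m' ''A'' (4 * k) (As ! k)" if "good m'" for m'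
    using that mn ptA pt_at_frame[of ?X m m'] frameD[of ?X m m' "''m''"] by (simp_all add: good_def)
  have good_upd: "good (m'(x := f))" if "good m'" "x \<in> ?X" for m' x f
    using that by (auto simp: good_def frame_def)
  have bK: "\<bar>int j + 1\<bar> < 2 ^ K" if "j < n" for j
  proof -
    have "int j + 1 \<le> int n" using that by simp
    then show ?thesis using nK by linarith
  qed
  have less_bok: "bexp_ok m' (Less (V x) (V ''m''))" for m' x using w K by simp
  \<comment> \<open>\<open>P\<close> records whether some earlier \<open>a\<close> has already
    rejected point \<open>k\<close>, which makes the inner loop usable at any stage of the outer
    one.\<close>
  have bloop: "runs_to ?bloop (m1, out1) R"
    if m1: "bounded_mem m1" "good m1" "k < n" "a < n" "m1 ''k'' 0 = int k" "m1 ''a'' 0 = int a" "m1 ''b'' 0 = 0"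
      "m1 ''keep'' 0 = (if P then 0 else 1)"
      and R: "\<And>m'. bounded_mem m' \<Longrightarrow> good m' \<Longrightarrow> m' ''k'' 0 = int k \<Longrightarrow> m' ''a'' 0 = int a \<Longrightarrow>
        m' ''keep'' 0 = (if P \<or> (\<exists>b<n. red k a b) then 0 else 1) \<Longrightarrow> R (m', out1)"
    for m1 out1 R k a P
  proof -
    define J where "J = (\<lambda>c (s :: mem \<times> int list). \<exists>b \<le> n. c = n - b \<and> snd s = out1 \<and> good (fst s) \<and>
      fst s ''k'' 0 = int k \<and> fst s ''a'' 0 = int a \<and> fst s ''b'' 0 = int b \<and>
      fst s ''keep'' 0 = (if P \<or> (\<exists>b'<b. red k a b') then 0 else 1))"
    have J0: "J n (m1, out1)" using m1 by (auto simp: J_def intro!: exI[of _ 0])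
    have nL: "n \<le> L" using n by (simp add: n_def)
    show ?thesis
    proof (rule runs_to_while[where I = J, OF J0 nL])
      show "bounded_mem (fst (m1, out1))" using m1 by simp
      fix c s assume J: "J c s" and bms: "bounded_mem (fst s)"
      show "bexp_ok (fst s) (Less (V ''b'') (V ''m''))" by (rule less_bok)
      obtain m2 b where s: "s = (m2, out1)" and b: "b \<le> n" "c = n - b" "good m2"
        "m2 ''k'' 0 = int k" "m2 ''a'' 0 = int a" "m2 ''b'' 0 = int b"
        "m2 ''keep'' 0 = (if P \<or> (\<exists>b'<b. red k a b') then 0 else 1)"
        using J by (cases s) (auto simp: J_def)
      have bm2: "bounded_mem m2" using bms s by simp
      {
        assume "\<not> bval inp (fst s) (Less (V ''b'') (V ''m''))"
        then have "b = n" using b s goodD(1)[OF b(3)] by simp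
        then show "R s" using R[OF bm2] b s by simp
      }
      assume "bval inp (fst s) (Less (V ''b'') (V ''m''))"
      then have bn: "b < n" using b s goodD(1)[OF b(3)] by simp
      have red: "bval inp m2 redundant \<longleftrightarrow> red k a b"
        using bval_redundant[of m2 k "As ! k" a "As ! a" b "As ! b"] goodD(2)[OF b(3)] b m1(3,4) bn by (simp add: red_def)
      have ex: "(\<exists>b'<Suc b. red k a b') \<longleftrightarrow> (\<exists>b'<b. red k a b') \<or> red k a b"
        by (auto simp: less_Suc_eq)
      have J': "J (c - 1) (m3, out1)" if "good m3" "m3 ''k'' 0 = int k" "m3 ''a'' 0 = int a" "m3 ''b'' 0 = int b + 1"
        "m3 ''keep'' 0 = (if red k a b then 0 else m2 ''keep'' 0)" for m3
        unfolding J_def using that b bn by (intro exI[of _ "Suc b"]) (simp add: ex)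
      have "runs_to ?bbody s (J (c - 1))"
        unfolding s
        apply (rule sym_exec_runs_to)
        subgoal using bm2 by simp
        using w K bok_redundant[of m2 k a b] b(4-6) bK[OF bn] bm2
        apply (simp add: red)
        apply (intro conjI impI J'[unfolded One_nat_def])
        using b by (simp_all add: good_upd)
      then show "0 < c \<and> runs_to ?bbody s (J (c - 1))" using b bn by simp
    qed
  qed
  have aloop: "runs_to ?aloop (m1, out1) R"
    if m1: "bounded_mem m1" "good m1" "k < n" "m1 ''k'' 0 = int k" "m1 ''a'' 0 = 0" "m1 ''keep'' 0 = 1"
      and R: "\<And>m'. bounded_mem m' \<Longrightarrow> good m' \<Longrightarrow> m' ''k'' 0 = int k \<Longrightarrow>
        m' ''keep'' 0 = (if \<exists>a<n. \<exists>b<n. red k a b then 0 else 1) \<Longrightarrow> R (m', out1)"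
    for m1 out1 R k
  proof -
    define J where "J = (\<lambda>c (s :: mem \<times> int list). \<exists>a \<le> n. c = n - a \<and> snd s = out1 \<and> good (fst s) \<and>
      fst s ''k'' 0 = int k \<and> fst s ''a'' 0 = int a \<and>
      fst s ''keep'' 0 = (if \<exists>a'<a. \<exists>b<n. red k a' b then 0 else 1))"
    have J0: "J n (m1, out1)" using m1 by (auto simp: J_def intro!: exI[of _ 0])
    have nL: "n \<le> L" using n by (simp add: n_def)
    show ?thesis
    proof (rule runs_to_while[where I = J, OF J0 nL])
      show "bounded_mem (fst (m1, out1))" using m1 by simp
      fix c s assume J: "J c s" and bms: "bounded_mem (fst s)"
      show "bexp_ok (fst s) (Less (V ''a'') (V ''m''))" by (rule less_bok)
      obtain m2 a where s: "s = (m2, out1)" and a: "a \<le> n" "c = n - a" "good m2"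
        "m2 ''k'' 0 = int k" "m2 ''a'' 0 = int a"
        "m2 ''keep'' 0 = (if \<exists>a'<a. \<exists>b<n. red k a' b then 0 else 1)"
        using J by (cases s) (auto simp: J_def)
      have bm2: "bounded_mem m2" using bms s by simp
      {
        assume "\<not> bval inp (fst s) (Less (V ''a'') (V ''m''))"
        then have "a = n" using a s goodD(1)[OF a(3)] by simp
        then show "R s" using R[OF bm2] a s by simp
      }
      assume "bval inp (fst s) (Less (V ''a'') (V ''m''))"
      then have an: "a < n" using a s goodD(1)[OF a(3)] by simp
      have ex: "(\<exists>a'<Suc a. \<exists>b<n. red k a' b) \<longleftrightarrow> (\<exists>a'<a. \<exists>b<n. red k a' b) \<or> (\<exists>b<n. red k a b)"
        by (auto simp: less_Suc_eq)
      have "runs_to ?abody s (J (c - 1))"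
        unfolding s
      proof (rule sym_exec_step)
        show "bounded_mem (fst (m2, out1))" using bm2 by simp
        define m3 where "m3 = m2(''b'' := (m2 ''b'')(0 := 0))"
        have "runs_to (?bloop ;; ''a'' ::= Add (V ''a'') (N 1)) (m3, out1) (J (c - 1))" if bm3: "bounded_mem m3"
        proof (rule runs_to_seq, rule bloop[OF bm3 _ m1(3) an])
          show "good m3" using good_upd[OF a(3)] by (simp add: m3_def)
          show "m3 ''keep'' 0 = (if \<exists>a'<a. \<exists>b<n. red k a' b then 0 else 1)" using a by (simp add: m3_def)
          fix m4 assume m4: "bounded_mem m4" "good m4" "m4 ''k'' 0 = int k" "m4 ''a'' 0 = int a"
            "m4 ''keep'' 0 = (if (\<exists>a'<a. \<exists>b<n. red k a' b) \<or> (\<exists>b<n. red k a b) then 0 else 1)"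
          have "J (c - 1) (m4(''a'' := (m4 ''a'')(0 := int a + 1)), out1)"
            unfolding J_def using m4 a an good_upd[OF m4(2)] by (intro exI[of _ "Suc a"]) (simp add: ex)
          then show "runs_to (''a'' ::= Add (V ''a'') (N 1)) (m4, out1) (J (c - 1))"
            using m4 w K bK[OF an] by (intro sym_exec_runs_to) simp_all
        qed (use a in \<open>simp_all add: m3_def\<close>)
        then show "sym_exec (''b'' ::= N 0) (\<lambda>s'. bounded_mem (fst s') \<longrightarrow> runs_to (?bloop ;; ''a'' ::= Add (V ''a'') (N 1)) s' (J (c - 1))) (m2, out1)"
          using w K by (simp add: m3_def)
      qed
      then show "0 < c \<and> runs_to ?abody s (J (c - 1))" using a an by simp
    qed
  qed
  let ?P = "\<lambda>y. y \<in> uncovered (set As)"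
  \<comment> \<open>\<open>red\<close> compares positions while \<open>uncovered\<close> compares
    points; these agree because \<open>As\<close> is distinct.\<close>
  have kept: "(\<exists>a<n. \<exists>b<n. red k a b) \<longleftrightarrow> \<not> ?P (As ! k)" if k: "k < n" for k
  proof -
    have ne: "a \<noteq> k \<longleftrightarrow> As ! a \<noteq> As ! k" if "a < n" for a
      using dist that k by (simp add: n_def nth_eq_iff_index_eq)
    have all: "(\<forall>x\<in>set As - {z}. R x) \<longleftrightarrow> (\<forall>i<n. As ! i \<noteq> z \<longrightarrow> R (As ! i))" for z R
      using all_set_conv_all_nth[of As "\<lambda>x. x \<noteq> z \<longrightarrow> R x"] unfolding n_def by blast
    have "As ! k \<in> set As" using k by (simp add: n_def)
    then have "?P (As ! k) \<longleftrightarrow> (\<forall>a<n. As ! a \<noteq> As ! k \<longrightarrow> (\<forall>b<n. As ! b \<noteq> As ! k \<longrightarrow> \<not> covered (As ! a) (As ! b) (As ! k)))"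
      unfolding uncovered_def mem_Collect_eq all by blast
    then show ?thesis unfolding red_def using ne by blast
  qed
  define J where "J = (\<lambda>c (s :: mem \<times> int list). \<exists>k \<le> n. c = n - k \<and> good (fst s) \<and> fst s ''k'' 0 = int k \<and>
    snd s = out @ concat (map enc_pt (filter ?P (take k As))))"
  let ?tail = "IF Eq (V ''keep'') (N 1) THEN write_point (V ''k'') ELSE SKIP ;; ''k'' ::= Add (V ''k'') (N 1)"
  let ?kbody = "''keep'' ::= N 1 ;; ''a'' ::= N 0 ;; ?aloop ;; ?tail"
  have kloop: "runs_to (WHILE Less (V ''k'') (V ''m'') DO ?kbody) (m1, out) Q" if m1: "bounded_mem m1" "good m1" "m1 ''k'' 0 = 0" for m1
  proof -
    have J0: "J n (m1, out)" using m1 by (auto simp: J_def intro!: exI[of _ 0])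
    have nL: "n \<le> L" using n by (simp add: n_def)
    show ?thesis
    proof (rule runs_to_while[where I = J, OF J0 nL])
      show "bounded_mem (fst (m1, out))" using m1 by simp
      fix c s assume J: "J c s" and bms: "bounded_mem (fst s)"
      show "bexp_ok (fst s) (Less (V ''k'') (V ''m''))" by (rule less_bok)
      obtain m2 out2 k where s: "s = (m2, out2)" and k: "k \<le> n" "c = n - k" "good m2" "m2 ''k'' 0 = int k"
        and out2: "out2 = out @ concat (map enc_pt (filter ?P (take k As)))"
        using J by (cases s) (auto simp: J_def)
      have bm2: "bounded_mem m2" using bms s by simp
      {
        assume "\<not> bval inp (fst s) (Less (V ''k'') (V ''m''))"
        then have "k = n" using k s goodD(1)[OF k(3)] by simp
        then show "Q s" using post[OF bm2] s out2 by (simp add: n_def)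
      }
      assume "bval inp (fst s) (Less (V ''k'') (V ''m''))"
      then have kn: "k < n" using k s goodD(1)[OF k(3)] by simp
      have tk: "take (Suc k) As = take k As @ [As ! k]" using kn by (simp add: n_def take_Suc_conv_app_nth)
      have tail: "runs_to ?tail (m4, out2) (J (c - 1))" if m4: "bounded_mem m4" "good m4" "m4 ''k'' 0 = int k"
          "m4 ''keep'' 0 = (if \<exists>a<n. \<exists>b<n. red k a b then 0 else 1)" for m4
      proof -
        have pt: "m4 ''A'' (4 * k) = num (fst (As ! k))" "m4 ''A'' (4 * k + 1) = den (fst (As ! k))"
          "m4 ''A'' (4 * k + 2) = num (snd (As ! k))" "m4 ''A'' (4 * k + 3) = den (snd (As ! k))"
          using goodD(2)[OF m4(2) kn] by (simp_all add: pt_at_def)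
        have keep: "m4 ''keep'' 0 = (if ?P (As ! k) then 1 else 0)" using m4(4) kept[OF kn] by simp
        have J': "J (c - 1) (m4(''k'' := (m4 ''k'')(0 := int k + 1)), out2 @ (if ?P (As ! k) then enc_pt (As ! k) else []))"
          unfolding J_def using m4 k kn good_upd[OF m4(2)] by (intro exI[of _ "Suc k"]) (simp add: tk out2)
        show ?thesis
          apply (rule sym_exec_runs_to)
          subgoal using m4 by simp
          using w K m4(1,3) keep pt bK[OF kn] J'
          by (cases "?P (As ! k)") (simp_all add: write_point_def coord_def enc_pt_def enc_rat_eq)
      qed
      define m3 where "m3 = m2(''keep'' := (m2 ''keep'')(0 := 1), ''a'' := (m2 ''a'')(0 := 0))"
      have good3: "good m3" unfolding m3_def using k(3) by (intro good_upd) simp_all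
      have a_part: "runs_to (?aloop ;; ?tail) (m3, out2) (J (c - 1))" if "bounded_mem m3"
      proof (rule runs_to_seq, rule aloop[OF that good3 kn])
        fix m4 assume "bounded_mem m4" "good m4" "m4 ''k'' 0 = int k"
          "m4 ''keep'' 0 = (if \<exists>a<n. \<exists>b<n. red k a b then 0 else 1)"
        then show "runs_to ?tail (m4, out2) (J (c - 1))" by (rule tail)
      qed (use k(4) in \<open>simp_all add: m3_def\<close>)
      have "runs_to ?kbody s (J (c - 1))"
        unfolding s
        apply (rule sym_exec_step)
        subgoal using bm2 by simp
        using w K apply simp
        apply (rule impI)
        apply (rule sym_exec_step)
        subgoal by simp
        using w K a_part by (simp add: m3_def)
      then show "0 < c \<and> runs_to ?kbody s (J (c - 1))" using k kn by simp
    qed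
  qed
  show ?thesis
    unfolding output_cleaned_def
    apply (rule sym_exec_step)
    subgoal using bm by simp
    using w K apply simp
    apply (rule impI)
    apply (rule kloop)
    by (simp_all add: good_def frame_def)
qed

section \<open>The main loop and the whole program\<close>

lemma runs_to_add_point:
  assumes bm: "bounded_mem m" and pts: "points_at m As" and y: "pt_at m ''y'' 0 y" and n: "length As < 2"
    and post: "\<And>m'. bounded_mem m' \<Longrightarrow> frame {''A'', ''m''} m m' \<Longrightarrow> points_at m' (As @ [y]) \<Longrightarrow> Q (m', out)"
  shows "runs_to add_point (m, out) Q"
proof -
  have yv: "m ''y'' 0 = num (fst y)" "m ''y'' (Suc 0) = den (fst y)" "m ''y'' 2 = num (snd y)" "m ''y'' 3 = den (snd y)"
    using y by (simp_all add: pt_at_def numeral_3_eq_3 numeral_2_eq_2)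
  have yK: "\<bar>num (fst y)\<bar> < 2 ^ K" "\<bar>den (fst y)\<bar> < 2 ^ K" "\<bar>num (snd y)\<bar> < 2 ^ K" "\<bar>den (snd y)\<bar> < 2 ^ K"
    using bmD[OF bm] y unfolding pt_at_def by metis+
  \<comment> \<open>This covers the two initial points only; within the main loop the potential
    bounds the counter.\<close>
  have nK: "\<bar>int (length As) + 1\<bar> < 2 ^ K" using n by (intro K16) simp
  have m: "m ''m'' 0 = int (length As)" using pts by (simp add: points_at_def)
  show ?thesis
    apply (rule sym_exec_runs_to')
    subgoal using bm by simp
    using w K m yv yK nK bm
    apply (simp add: add_point_def)
    apply (rule impI)
    apply (rule post)
    subgoal by simp
    subgoal by (simp add: frame_def)
    by (rule points_at_snoc[OF pts]) simp_all
qed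

lemma runs_to_set_lam:
  assumes bm: "bounded_mem m" and l: "l1 = 0 \<or> l1 = 1" "l2 = 0 \<or> l2 = 1"
    and post: "\<And>m'. bounded_mem m' \<Longrightarrow> frame {''lam''} m m' \<Longrightarrow> pt_at m' ''lam'' 0 (of_int l1, of_int l2) \<Longrightarrow> Q (m', out)"
  shows "runs_to (set_lam l1 l2) (m, out) Q"
proof -
  have nd: "num 0 = 0" "num 1 = 1" "den 0 = 1" "den 1 = 1" by (simp_all add: num_def den_def)
  have K1: "\<bar>l1\<bar> < 2 ^ K" "\<bar>l2\<bar> < 2 ^ K" "\<bar>l1\<bar> < 16" "\<bar>l2\<bar> < 16" "(1::int) < 2 ^ K"
    using l K16[of 0] K16[of 1] by auto
  show ?thesis
    apply (rule sym_exec_runs_to')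
    subgoal using bm by simp
    using w K K1
    apply (simp add: set_lam_def)
    apply (rule impI)
    apply (rule post)
    subgoal by simp
    subgoal by (simp add: frame_def)
    using l by (auto simp: pt_at_def nd)
qed

text \<open>The potential serves as the variant, since the length of the queue grows with every
  split.\<close>

lemma runs_to_main_loop:
  assumes bm: "bounded_mem m" and loop_inv: "loop_inv m As h Q"
    and post: "\<And>m' As h. bounded_mem m' \<Longrightarrow> loop_inv m' As h [] \<Longrightarrow> R (m', out)"
  shows "runs_to (WHILE Less (V ''qh'') (V ''qt'') DO iteration ws) (m, out) R"
proof -
  define J where "J = (\<lambda>n (s :: mem \<times> int list). snd s = out \<and>
    (\<exists>As h Q. loop_inv (fst s) As h Q \<and> queue_potential (image_pts I) Q \<le> n))"
  have J0: "J (queue_potential (image_pts I) Q) (m, out)" using loop_inv by (auto simp: J_def)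
  have L0: "queue_potential (image_pts I) Q \<le> L" using loop_inv Lk by (simp add: loop_inv_def)
  show ?thesis
  proof (rule runs_to_while[where I = J, OF J0 L0])
    show "bounded_mem (fst (m, out))" using bm by simp
    fix n s assume J: "J n s" and bms: "bounded_mem (fst s)"
    show "bexp_ok (fst s) (Less (V ''qh'') (V ''qt''))" using w K by simp
    obtain m' As h Q where s: "s = (m', out)" and loop_inv: "loop_inv m' As h Q" and n: "queue_potential (image_pts I) Q \<le> n"
      using J by (cases s) (auto simp: J_def)
    have bm': "bounded_mem m'" using bms s by simp
    have cond: "bval inp (fst s) (Less (V ''qh'') (V ''qt'')) \<longleftrightarrow> Q \<noteq> []"
      using loop_inv by (auto simp: loop_inv_def s)
    {
      assume "\<not> bval inp (fst s) (Less (V ''qh'') (V ''qt''))"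
      then have "Q = []" using cond by blast
      then show "R s" using post[OF bm'] loop_inv s by simp
    }
    assume "bval inp (fst s) (Less (V ''qh'') (V ''qt''))"
    then obtain a b Q' where Q: "Q = (a, b) # Q'" using cond by (cases Q) auto
    have "0 < n" using n length_le_queue_potential[of Q "image_pts I"] Q by simp
    moreover have "runs_to (iteration ws) s (J (n - 1))"
      unfolding s
    proof (rule runs_to_iteration[OF bm' loop_inv[unfolded Q]])
      fix m2 As2 Q2 assume "loop_inv m2 As2 (Suc h) Q2" "queue_potential (image_pts I) Q2 < queue_potential (image_pts I) ((a, b) # Q')"
      then show "J (n - 1) (m2, out)" using n Q unfolding J_def
        by (intro conjI exI[of _ As2] exI[of _ "Suc h"] exI[of _ Q2]) simp_all
    qed
    ultimately show "0 < n \<and> runs_to (iteration ws) s (J (n - 1))" by simp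
  qed
qed

lemma runs_to_da_program:
  "runs_to (da_program ws) (\<lambda>_ _. 0, [])
     (\<lambda>s. \<exists>ys. snd s = concat (map enc_pt ys) \<and> distinct ys \<and> real_pt ` set ys = nd_extreme I)"
    (is "runs_to _ _ ?R")
proof -
  let ?S = "image_pts I"
  have R: "?R (m', concat (map enc_pt ys))" if "distinct ys" "set ys = uncovered ?S" for m' :: mem and ys
    using that nd_extreme_eq[OF I] by auto
  have bm0: "bounded_mem (\<lambda>_ _. 0)" by (simp add: bounded_mem_def)
  let ?cond = "And (feq (coord (N 0) 0) (coord (N 1) 0)) (feq (coord (N 0) 1) (coord (N 1) 1))"
  let ?W = "{''x'', ''p'', ''q'', ''g'', ''h'', ''r'', ''j'', ''y''}"
  let ?else = "enqueue (N 0) (N 1) ;; WHILE Less (V ''qh'') (V ''qt'') DO iteration ws ;; output_cleaned"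
  let ?if = "IF ?cond THEN write_point (N 0) ELSE ?else"
  have cleaned: "runs_to output_cleaned (m, []) ?R" if "bounded_mem m" "loop_inv m As h []" for m As h
  proof (rule runs_to_output_cleaned[OF that(1)])
    have loop_inv: "points_at m As" "distinct As" "da_inv ?S (set As) []" "length As \<le> 4 * card (uncovered ?S) + 3"
      using that(2) by (simp_all add: loop_inv_def)
    show "points_at m As" "distinct As" "length As \<le> L" using loop_inv Lk by simp_all
    fix m' :: mem
    let ?ys = "filter (\<lambda>y. y \<in> uncovered (set As)) As"
    have "uncovered (set As) \<subseteq> set As" by (auto simp: uncovered_def)
    then have "set ?ys = uncovered ?S" using da_inv_finish(1)[OF fin_image_pts loop_inv(3)] by auto
    then show "?R (m', [] @ concat (map enc_pt ?ys))" using R[of ?ys m'] loop_inv(2) by simp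
  qed
  have if_part: "runs_to ?if (m, []) ?R"
    if bm: "bounded_mem m" and pts: "points_at m [y0, y1]" and q: "m ''qh'' 0 = 0" "m ''qt'' 0 = 0"
      and y: "optimal ?S (1, 0) y0" "optimal ?S (0, 1) y1" for m y0 y1
  proof -
    have pt: "pt_at m ''A'' (4 * 0) y0" "pt_at m ''A'' (4 * 1) y1"
      using pts by (auto simp: points_at_def dest: spec[of _ 0] spec[of _ 1])
    have cond: "bval inp m ?cond \<longleftrightarrow> y0 = y1"
      using frac_val_coord[OF pt(1), of "N 0"] frac_val_coord[OF pt(2), of "N 1"]
      by (simp add: bval_feq component_def prod_eq_iff)
    show ?thesis
    proof (rule runs_to_if)
      show "bexp_ok (fst (m, [])) ?cond" using w K by (simp add: feq_def coord_def)
      show "runs_to (write_point (N 0)) (m, []) ?R" if "bval inp (fst (m, [] :: int list)) ?cond"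
      proof -
        have "y0 = y1" using that unfolding fst_conv cond .
        then have "uncovered ?S = {y0}" using uncovered_ideal y by blast
        then have R0: "?R (m, enc_pt y0)" using R[of "[y0]" m] by simp
        have pt0: "m ''A'' 0 = num (fst y0)" "m ''A'' (Suc 0) = den (fst y0)" "m ''A'' 2 = num (snd y0)" "m ''A'' 3 = den (snd y0)"
          using pt(1) by (simp_all add: pt_at_def numeral_3_eq_3 numeral_2_eq_2)
        show ?thesis
          apply (rule sym_exec_runs_to)
          subgoal using bm by simp
          using w K R0 pt0 by (simp add: write_point_def coord_def enc_pt_def enc_rat_eq)
      qed
      show "runs_to ?else (m, []) ?R" if "\<not> bval inp (fst (m, [] :: int list)) ?cond"
      proof -
        have ne: "y0 \<noteq> y1" using that unfolding fst_conv cond .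
        define m1 where "m1 = m(''Q'' := (m ''Q'')(0 := 0, Suc 0 := 1), ''qt'' := (m ''qt'')(0 := 1))"
        have fr: "frame {''Q'', ''qt''} m m1" by (simp add: m1_def frame_def)
        have que: "queue_at m1 [y0, y1] 0 [(y0, y1)]"
          unfolding queue_at_def by (auto simp: m1_def intro!: exI[of _ 0] exI[of _ "Suc 0"])
        have "points_at m1 [y0, y1]" using points_at_frame[OF pts fr] by simp
        then have "loop_inv m1 [y0, y1] 0 [(y0, y1)]"
          unfolding loop_inv_def using que q ne da_inv_init[OF y ne] queue_potential_single[OF fin_image_pts, of y0 y1]
          by (simp add: m1_def)
        then have "runs_to (WHILE Less (V ''qh'') (V ''qt'') DO iteration ws ;; output_cleaned) (m1, []) ?R" if "bounded_mem m1"
          using that by (intro runs_to_seq runs_to_main_loop) (auto intro: cleaned)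
        then show ?thesis
          apply (intro sym_exec_step)
          subgoal using bm by simp
          using w K q K16[of 1] by (simp add: enqueue_def m1_def)
      qed
    qed (use bm in simp)
  qed
  have second: "runs_to (solve ws ;; add_point ;; ?if) (m, []) ?R"
    if bm: "bounded_mem m" and pts: "points_at m [y0]" and q: "m ''qh'' 0 = 0" "m ''qt'' 0 = 0"
      and y0: "optimal ?S (1, 0) y0" and lam: "pt_at m ''lam'' 0 (0, 1)" for m y0
  proof (rule runs_to_seq, rule runs_to_solve[OF bm lam])
    fix m' assume "sols I = {}"
    then show "runs_to (add_point ;; ?if) (m', []) ?R" using y0 by (simp add: optimal_def)
  next
    fix m' y1 assume m': "bounded_mem m'" "frame ?W m m'" "optimal ?S (0, 1) y1" "pt_at m' ''y'' 0 y1"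
    have pts': "points_at m' [y0]" using points_at_frame[OF pts m'(2)] by simp
    show "runs_to (add_point ;; ?if) (m', []) ?R"
    proof (rule runs_to_seq, rule runs_to_add_point[OF m'(1) pts' m'(4)])
      fix m2 assume m2: "bounded_mem m2" "frame {''A'', ''m''} m' m2" "points_at m2 ([y0] @ [y1])"
      have "m2 ''qh'' 0 = 0" "m2 ''qt'' 0 = 0" using frameD[OF m2(2)] frameD[OF m'(2)] q by simp_all
      then show "runs_to ?if (m2, []) ?R" using if_part m2 y0 m'(3) by simp
    qed simp
  qed simp_all
  let ?first = "add_point ;; set_lam 0 1 ;; solve ws ;; add_point ;; ?if"
  have first: "runs_to (solve ws ;; IF Eq (V ''x'') (N 0) THEN SKIP ELSE ?first) (m, []) ?R"
    if bm: "bounded_mem m" and fr: "frame {''lam''} (\<lambda>_ _. 0) m" and lam: "pt_at m ''lam'' 0 (1, 0)" for m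
  proof (rule runs_to_seq, rule runs_to_solve[OF bm lam])
    fix m' assume m': "sols I = {}" "bounded_mem m'" "m' ''x'' 0 = 0"
    \<comment> \<open>Without solutions there are no extreme points, so an empty output is
      right.\<close>
    have "?R (m', [])" using R[of "[]" m'] m'(1) by (simp add: uncovered_def)
    then show "runs_to (IF Eq (V ''x'') (N 0) THEN SKIP ELSE ?first) (m', []) ?R"
      using m' w K by (intro sym_exec_runs_to) simp_all
  next
    fix m' y0 assume m': "bounded_mem m'" "frame ?W m m'" "m' ''x'' 0 = 1" "optimal ?S (1, 0) y0" "pt_at m' ''y'' 0 y0"
    have z: "m' ''m'' 0 = 0" "m' ''qh'' 0 = 0" "m' ''qt'' 0 = 0"
      using frameD[OF m'(2)] frameD[OF fr] by simp_all
    have pts0: "points_at m' []" using z by (simp add: points_at_def)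
    have "runs_to ?first (m', []) ?R"
    proof (rule runs_to_seq[OF runs_to_add_point[OF m'(1) pts0 m'(5)]])
      fix m2 assume m2: "bounded_mem m2" "frame {''A'', ''m''} m' m2" "points_at m2 ([] @ [y0])"
      show "runs_to (set_lam 0 1 ;; solve ws ;; add_point ;; ?if) (m2, []) ?R"
      proof (rule runs_to_seq[OF runs_to_set_lam[OF m2(1)]])
        fix m3 assume m3: "bounded_mem m3" "frame {''lam''} m2 m3" "pt_at m3 ''lam'' 0 (of_int 0, of_int 1)"
        have "m3 ''qh'' 0 = 0" "m3 ''qt'' 0 = 0" using frameD[OF m3(2)] frameD[OF m2(2)] z by simp_all
        moreover have "points_at m3 [y0]" using points_at_frame[OF m2(3) m3(2)] by simp
        ultimately show "runs_to (solve ws ;; add_point ;; ?if) (m3, []) ?R"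
          using second m3(1,3) m'(4) by simp
      qed simp_all
    qed simp
    then show "runs_to (IF Eq (V ''x'') (N 0) THEN SKIP ELSE ?first) (m', []) ?R"
      using m'(1,3) w K by (intro runs_to_if) simp_all
  qed simp_all
  show ?thesis
    unfolding da_program_def
    by (rule runs_to_seq[OF runs_to_set_lam[OF bm0]]) (use first in simp_all)
qed

end

text \<open>With n = \<open>inst_size I\<close> and K = 2n + 10, weights have length at most 4K + 4
  = 8n + 44, so the solver sees a size of at most 9n + 44. The cells hold what the solver needs plus
  20K = 40n + 200 bits, and 4S + 21 exceeds both 2K + 1 = 4n + 21 and four times the number of
  extreme points plus 3.\<close>

lemma da_program_runs:
  fixes p q :: "nat poly"
  assumes I: "boco_instance I"
    and solver: "\<And>l. 0 \<le> fst l \<Longrightarrow> 0 \<le> snd l \<Longrightarrow>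
      \<exists>t out. runs (poly q (inst_size I + rat_size (fst l) + rat_size (snd l))) (enc_pt l @ enc_inst I) ws t out \<and>
        t \<le> poly p (inst_size I + rat_size (fst l) + rat_size (snd l)) \<and> ws_answer I l out"
  defines "S \<equiv> inst_size I + card (nd_extreme I)"
  shows "\<exists>t ys. runs (poly q (9 * inst_size I + 44) + 40 * inst_size I + 200) (enc_inst I) (da_program ws) t (concat (map enc_pt ys)) \<and>
    distinct ys \<and> real_pt ` set ys = nd_extreme I \<and>
    t \<le> time_bound (4 * S + 21) (poly p (9 * S + 44) + S + 8) (da_program ws)"
proof -
  define K where "K = 2 * inst_size I + 10"
  define w where "w = poly q (9 * inst_size I + 44) + 40 * inst_size I + 200"
  have card: "card (nd_extreme I) = card (uncovered (image_pts I))"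
    unfolding nd_extreme_eq[OF I] by (rule card_image) (meson inj_real_pt inj_on_subset subset_UNIV)
  have dim: "dim I \<le> inst_size I" by (simp add: inst_size_def)
  interpret ram_da w K "4 * S + 21" "poly p (9 * S + 44) + S + 8" "enc_inst I" I ws "poly p (9 * S + 44)"
  proof unfold_locales
    fix l :: point
    assume l: "0 \<le> fst l" "0 \<le> snd l" "rat_size (fst l) + rat_size (snd l) \<le> 4 * K + 4"
    define n where "n = inst_size I + rat_size (fst l) + rat_size (snd l)"
    have n: "n \<le> 9 * inst_size I + 44" "9 * inst_size I + 44 \<le> 9 * S + 44"
      using l(3) by (simp_all add: n_def K_def S_def)
    obtain t out where out: "runs (poly q n) (enc_pt l @ enc_inst I) ws t out" "t \<le> poly p n" "ws_answer I l out"
      using solver[OF l(1,2)] unfolding n_def by blast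
    have "poly q n \<le> w" using poly_nat_mono[OF n(1), of q] by (simp add: w_def)
    then have "runs w (enc_pt l @ enc_inst I) ws t out"
      using out(1) exec_mono unfolding runs_def by blast
    moreover have "t \<le> poly p (9 * S + 44)"
      using out(2) poly_nat_mono[OF order_trans[OF n], of p] by simp
    ultimately show "\<exists>t out. runs w (enc_pt l @ enc_inst I) ws t out \<and> t \<le> poly p (9 * S + 44) \<and> ws_answer I l out"
      using out(3) by blast
  qed (use I dim card in \<open>simp_all add: K_def w_def S_def\<close>)
  show ?thesis
    using runs_to_da_program unfolding runs_to_def runs_def w_def[symmetric] by (metis prod.collapse)
qed

theorem theorem5p8:
  fixes P :: "boco_inst set"
  assumes "boco_problem P"
  shows "(\<forall>I\<in>P. da_terminates I \<and> (\<forall>Y. da_output I Y \<longrightarrow> real_pt ` Y = nd_extreme I))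
    \<and> (\<forall>ws. ws_poly_time_solver P ws \<longrightarrow> output_sensitive P (da_program ws))"
proof (intro conjI ballI allI impI)
  fix I assume "I \<in> P"
  then have I: "boco_instance I" using assms by (simp add: boco_problem_def)
  show "da_terminates I" by (rule da_correct(1)[OF I])
  show "real_pt ` Y = nd_extreme I" if "da_output I Y" for Y using da_correct(2)[OF I that] .
next
  fix ws assume "ws_poly_time_solver P ws"
  then obtain p q :: "nat poly" where solver: "\<And>I l. I \<in> P \<Longrightarrow> 0 \<le> fst l \<Longrightarrow> 0 \<le> snd l \<Longrightarrow>
      \<exists>t out. runs (poly q (inst_size I + rat_size (fst l) + rat_size (snd l))) (enc_pt l @ enc_inst I) ws t out \<and>
        t \<le> poly p (inst_size I + rat_size (fst l) + rat_size (snd l)) \<and> ws_answer I l out"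
    unfolding ws_poly_time_solver_def Let_def by blast
  \<comment> \<open>The bounds of \<open>da_program_runs\<close> as polynomials: in S for the time,
    and in the instance size alone for the cells, which must not depend on the output.\<close>
  obtain p' :: "nat poly" where p': "\<And>S. time_bound (poly [:21, 4:] S) (poly (pcompose p [:44, 9:] + [:8, 1:]) S) (da_program ws) = poly p' S"
    using time_bound_poly by blast
  define q' where "q' = pcompose q [:44, 9:] + [:200, 40:]"
  show "output_sensitive P (da_program ws)"
    unfolding output_sensitive_def
  proof (rule exI[of _ p'], rule exI[of _ q'], rule ballI)
    fix I assume IP: "I \<in> P"
    then have I: "boco_instance I" using assms by (simp add: boco_problem_def)
    let ?S = "inst_size I + card (nd_extreme I)"
    have "time_bound (4 * ?S + 21) (poly p (9 * ?S + 44) + ?S + 8) (da_program ws) = poly p' ?S"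
      using p'[of ?S] by (simp add: poly_pcompose algebra_simps)
    moreover have "poly q' (inst_size I) = poly q (9 * inst_size I + 44) + 40 * inst_size I + 200"
      by (simp add: q'_def poly_pcompose algebra_simps)
    ultimately show "\<exists>t ys. runs (poly q' (inst_size I)) (enc_inst I) (da_program ws) t (concat (map enc_pt ys)) \<and>
        distinct ys \<and> real_pt ` set ys = nd_extreme I \<and> t \<le> poly p' (inst_size I + card (nd_extreme I))"
      using da_program_runs[OF I solver[OF IP]] by metis
  qed
qed

end
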